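(* Let $\mathbb D\subset\mathbb C$ be a simply connected domain, $z_*\in\mathbb D$, and let $\eta$ be a holomorphic potential on $\mathbb D$. Let $C$ be the solution of $\mathrm dC=C\eta$, $C(z_*,\lambda)=\mathrm{Id}$, and let $C=\Phi V_+$ be an Iwasawa decomposition (smooth in $z$) with $\Phi$ taking values in $\Lambda \mathrm{SL}_2\mathbb C_{\sigma,\tau_3}$ and $V_+$ in $\Lambda^+\mathrm{SL}_2\mathbb C_\sigma$. Then, up to a $\lambda$-independent diagonal gauge $D=\mathrm{diag}(e^{i\theta},e^{-i\theta})\in\mathrm U_1$ multiplied from the right (with $\theta$ a real function of $z$) and a change of coordinates, $\Phi$ is the extended frame of some constant mean curvature surface in $\mathbb H^3$ with mean curvature $H>1$.
   Context: Loop groups: $\sigma=\mathrm{Ad}(\mathrm{diag}(1,-1))$; $\Lambda \mathrm{SL}_2\mathbb C_\sigma$ is the Banach Lie group of loops $g:S^1\to\mathrm{SL}_2\mathbb C$ with entries in the Wiener algebra (absolutely convergent Fourier series) and $g(-\lambda)=\sigma g(\lambda)$; $\Lambda^+\mathrm{SL}_2\mathbb C_\sigma$ is the subgroup of loops extending holomorphically to $|\lambda|<1$. $\Lambda\mathfrak{sl}_2\mathbb C_\sigma$ is the Lie algebra of $\Lambda \mathrm{SL}_2\mathbb C_\sigma$. With $g^*=\bar g^t$, put $\tau_3(g)(\lambda)=\{g(1/\bar\lambda)\}^{*-1}$ and $\Lambda \mathrm{SL}_2\mathbb C_{\sigma,\tau_3}=\{g\in\Lambda \mathrm{SL}_2\mathbb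 C_\sigma : \tau_3(g)=g\}$. By the classical Iwasawa decomposition every element of $\Lambda \mathrm{SL}_2\mathbb C_\sigma$ is a product of an element of $\Lambda \mathrm{SL}_2\mathbb C_{\sigma,\tau_3}$ and an element of $\Lambda^+\mathrm{SL}_2\mathbb C_\sigma$. A holomorphic potential is a $\Lambda\mathfrak{sl}_2\mathbb C_\sigma$-valued 1-form $\eta=\sum_{j\ge -1}\lambda^j\eta_j$ on $\mathbb D$, where the $\eta_j$ are $\lambda$-independent holomorphic 1-forms, diagonal for even $j$ and off-diagonal for odd $j$, such that $\lambda\eta$ is holomorphic in $z\in\mathbb D$ and $\lambda\in\mathbb C$, and the upper right entry of $\eta_{-1}$ does not vanish on $\mathbb D$. $\mathbb H^3=\{\xi\in\mathrm{Her}_2\mathbb C:\det\xi=1,\ \mathrm{tr}\,\xi>0\}$, inside the space $\mathrm{Her}_2\mathbb C$ of Hermitian $2\times2$ matrices with Lorentzian scalar product determined by $\langle\xi,\xi\rangle=-\det\xi$. Extended frame ($H>1$): a map $\Psi:\mathbb D\to\Lambda \mathrm{SL}_2\mathbb C_{\sigma,\tau_3}$, extending holomorphically to $\lambda\in\mathbb C^\times$, with $\Psi^{-1}\mathrm d\Psi=U\,\mathrm dz+V\,\mathrm d\bar z$, $$U=\begin{pmatrix}u_z/4&-\frac12\lambda^{-1}\mathscr He^{u/2}\\ \lambda^{-1}Qe^{-u/2}&-u_z/4\end{pmatrix},\quad V=\begin{pmatrix}-u_{\bar z}/4&-\lambda\bar Qe^{-u/2}\\ \frac12\lambda\mathscr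 He^{u/2}&u_{\bar z}/4\end{pmatrix},$$ where $u$ is a real function, $Q$ is holomorphic, and $\mathscr H=e^{-q}(\coth q+1)=1/\sinh q$ for some $q>0$. The associated surface of mean curvature $H=\coth q$ is given by the Sym formula $f=\Psi\,\mathrm{diag}(e^{-q/2},e^{q/2})\,\Psi^*$ evaluated at $|\lambda|=e^{-q/2}$; its metric is $e^u\mathrm dz\mathrm d\bar z$. *)

theory Defs
  imports "HOL-Complex_Analysis.Complex_Analysis"
begin

section \<open>Complex $2\times 2$ matrices\<close>

type_synonym mat2 = "complex^2^2"

definition mat2 :: "complex \<Rightarrow> complex \<Rightarrow> complex \<Rightarrow> complex \<Rightarrow> mat2" where
  "mat2 a b c d = vector [vector [a, b], vector [c, d]]"

abbreviation diag2 :: "complex \<Rightarrow> complex \<Rightarrow> mat2" where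
  "diag2 a d \<equiv> mat2 a 0 0 d"

definition cscale :: "complex \<Rightarrow> mat2 \<Rightarrow> mat2" where
  "cscale c A = map_matrix ((*) c) A"

definition hconj :: "mat2 \<Rightarrow> mat2" where
  "hconj A = map_matrix cnj (transpose A)"

definition Ad :: "mat2 \<Rightarrow> mat2 \<Rightarrow> mat2" where
  "Ad g X = g ** X ** matrix_inv g"

definition sigma :: "mat2 \<Rightarrow> mat2" where
  "sigma = Ad (diag2 1 (- 1))"


section \<open>Smooth functions of one complex variable\<close>

text \<open>Real differentiability with respect to $z = x + i y$ on an open set.\<close>

definition dx :: "(complex \<Rightarrow> 'b::real_normed_vector) \<Rightarrow> complex \<Rightarrow> 'b" where
  "dx f z = frechet_derivative f (at z) 1"

definition dy :: "(complex \<Rightarrow> 'b::real_normed_vector) \<Rightarrow> complex \<Rightarrow> 'b" where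
  "dy f z = frechet_derivative f (at z) \<i>"

primrec Ck_on :: "nat \<Rightarrow> complex set \<Rightarrow> (complex \<Rightarrow> 'b::real_normed_vector) \<Rightarrow> bool" where
  "Ck_on 0 D f \<longleftrightarrow> continuous_on D f"
| "Ck_on (Suc n) D f \<longleftrightarrow>
     (\<forall>z\<in>D. f differentiable (at z)) \<and> Ck_on n D (dx f) \<and> Ck_on n D (dy f)"

definition smooth_on :: "complex set \<Rightarrow> (complex \<Rightarrow> 'b::real_normed_vector) \<Rightarrow> bool" where
  "smooth_on D f \<longleftrightarrow> (\<forall>n. Ck_on n D f)"

text \<open>Wirtinger derivatives of a real function.\<close>

definition wirt_z :: "(complex \<Rightarrow> real) \<Rightarrow> complex \<Rightarrow> complex" where
  "wirt_z u z = (of_real (dx u z) - \<i> * of_real (dy u z)) / 2"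

definition wirt_zbar :: "(complex \<Rightarrow> real) \<Rightarrow> complex \<Rightarrow> complex" where
  "wirt_zbar u z = (of_real (dx u z) + \<i> * of_real (dy u z)) / 2"

text \<open>Holomorphy of a function of two complex variables: complex Frechet differentiability.\<close>

definition holomorphic2_on :: "(complex \<times> complex \<Rightarrow> complex) \<Rightarrow> (complex \<times> complex) set \<Rightarrow> bool" where
  "holomorphic2_on G S \<longleftrightarrow>
     (\<forall>p\<in>S. \<exists>a b. (G has_derivative (\<lambda>(h, k). a * h + b * k)) (at p))"


section \<open>Loop groups\<close>

text \<open>Loops are represented by total functions of the loop parameter; the predicates below
  depend only on the values on the unit circle.\<close>

definition fourier_coeff :: "(complex \<Rightarrow> complex) \<Rightarrow> int \<Rightarrow> complex" where
  "fourier_coeff f k =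
     integral {0..2 * pi} (\<lambda>t. f (cis t) * cis (- (of_int k * t))) / of_real (2 * pi)"

definition wiener :: "(complex \<Rightarrow> complex) \<Rightarrow> bool" where
  "wiener f \<longleftrightarrow>
     (\<lambda>k. norm (fourier_coeff f k)) summable_on UNIV \<and>
     (\<forall>l\<in>sphere 0 1. ((\<lambda>k. fourier_coeff f k * l powi k) has_sum f l) UNIV)"

definition wiener_norm :: "(complex \<Rightarrow> complex) \<Rightarrow> real" where
  "wiener_norm f = (\<Sum>\<^sub>\<infinity>k. norm (fourier_coeff f k))"

definition wiener_loop :: "(complex \<Rightarrow> mat2) \<Rightarrow> bool" where
  "wiener_loop g \<longleftrightarrow> (\<forall>i j. wiener (\<lambda>l. g l $ i $ j))"

definition loop_norm :: "(complex \<Rightarrow> mat2) \<Rightarrow> real" where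
  "loop_norm g = (\<Sum>i\<in>UNIV. \<Sum>j\<in>UNIV. wiener_norm (\<lambda>l. g l $ i $ j))"

definition twisted :: "(complex \<Rightarrow> mat2) \<Rightarrow> bool" where
  "twisted g \<longleftrightarrow> (\<forall>l\<in>sphere 0 1. g (- l) = sigma (g l))"

definition loop_SL2 :: "(complex \<Rightarrow> mat2) \<Rightarrow> bool" where
  "loop_SL2 g \<longleftrightarrow> wiener_loop g \<and> (\<forall>l\<in>sphere 0 1. det (g l) = 1) \<and> twisted g"

definition loop_sl2_alg :: "(complex \<Rightarrow> mat2) \<Rightarrow> bool" where
  "loop_sl2_alg X \<longleftrightarrow> wiener_loop X \<and> (\<forall>l\<in>sphere 0 1. trace (X l) = 0) \<and> twisted X"

text \<open>The extension to the disc has the given loop as its (continuous) boundary values.\<close>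

definition loop_SL2_plus :: "(complex \<Rightarrow> mat2) \<Rightarrow> bool" where
  "loop_SL2_plus g \<longleftrightarrow> loop_SL2 g \<and>
     (\<exists>G. (\<forall>l\<in>sphere 0 1. G l = g l) \<and>
          (\<forall>i j. continuous_on (cball 0 1) (\<lambda>l. G l $ i $ j) \<and>
                 (\<lambda>l. G l $ i $ j) holomorphic_on ball 0 1))"

definition tau3 :: "(complex \<Rightarrow> mat2) \<Rightarrow> complex \<Rightarrow> mat2" where
  "tau3 g l = matrix_inv (hconj (g (1 / cnj l)))"

definition loop_SL2_tau3 :: "(complex \<Rightarrow> mat2) \<Rightarrow> bool" where
  "loop_SL2_tau3 g \<longleftrightarrow> loop_SL2 g \<and> (\<forall>l\<in>sphere 0 1. tau3 g l = g l)"

text \<open>Maps of class $C^n$ from an open set $D$ into the Banach space of matrix loops with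
  entries in the Wiener algebra: differentiability is Frechet differentiability for the
  Wiener norm.\<close>

primrec loop_Ck_on :: "nat \<Rightarrow> complex set \<Rightarrow> (complex \<Rightarrow> complex \<Rightarrow> mat2) \<Rightarrow> bool" where
  "loop_Ck_on 0 D F \<longleftrightarrow>
     (\<forall>z\<in>D. wiener_loop (F z) \<and> ((\<lambda>y. loop_norm (\<lambda>l. F y l - F z l)) \<longlongrightarrow> 0) (at z))"
| "loop_Ck_on (Suc n) D F \<longleftrightarrow>
     (\<forall>z\<in>D. wiener_loop (F z)) \<and>
     (\<exists>Fx Fy. loop_Ck_on n D Fx \<and> loop_Ck_on n D Fy \<and>
       (\<forall>z\<in>D. ((\<lambda>h. loop_norm (\<lambda>l. F (z + h) l - F z l - Re h *\<^sub>R Fx z l - Im h *\<^sub>R Fy z l) / norm h)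
                  \<longlongrightarrow> 0) (at 0)))"

definition loop_smooth_on :: "complex set \<Rightarrow> (complex \<Rightarrow> complex \<Rightarrow> mat2) \<Rightarrow> bool" where
  "loop_smooth_on D F \<longleftrightarrow> (\<forall>n. loop_Ck_on n D F)"


section \<open>Holomorphic potentials\<close>

text \<open>A potential is given by the coefficients of its forms $\eta_j\,dz$, $j \ge -1$.
  Since \<^term>\<open>(0::complex) powi 0 = 1\<close>, the series in the joint holomorphy condition
  is $\lambda\eta$ with its value $\eta_{-1}$ at $\lambda = 0$.\<close>

definition potential_at :: "(int \<Rightarrow> complex \<Rightarrow> mat2) \<Rightarrow> complex \<Rightarrow> complex \<Rightarrow> mat2" where
  "potential_at \<eta> z l = (\<Sum>\<^sub>\<infinity>j\<in>{-1..}. cscale (l powi j) (\<eta> j z))"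

definition holomorphic_potential :: "complex set \<Rightarrow> (int \<Rightarrow> complex \<Rightarrow> mat2) \<Rightarrow> bool" where
  "holomorphic_potential D \<eta> \<longleftrightarrow>
     (\<forall>j\<ge>-1. \<forall>a b. (\<lambda>z. \<eta> j z $ a $ b) holomorphic_on D) \<and>
     (\<forall>j\<ge>-1. \<forall>z\<in>D. if even j then \<eta> j z $ 1 $ 2 = 0 \<and> \<eta> j z $ 2 $ 1 = 0
                              else \<eta> j z $ 1 $ 1 = 0 \<and> \<eta> j z $ 2 $ 2 = 0) \<and>
     (\<forall>z\<in>D. \<forall>l. l \<noteq> 0 \<longrightarrow> (\<lambda>j. cscale (l powi j) (\<eta> j z)) summable_on {-1..}) \<and>
     (\<forall>z\<in>D. loop_sl2_alg (potential_at \<eta> z)) \<and>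
     (\<forall>a b. holomorphic2_on
              (\<lambda>(z, l). \<Sum>\<^sub>\<infinity>j\<in>{-1..}. l powi (j + 1) * \<eta> j z $ a $ b) (D \<times> UNIV)) \<and>
     (\<forall>z\<in>D. \<eta> (-1) z $ 1 $ 2 \<noteq> 0)"


section \<open>Hyperbolic space and surfaces of constant mean curvature\<close>

definition Her2 :: "mat2 set" where
  "Her2 = {X. hconj X = X}"

text \<open>The polarisation of $\langle\xi,\xi\rangle = -\det\xi$; on Hermitian matrices the
  determinants are real.\<close>

definition lorentz :: "mat2 \<Rightarrow> mat2 \<Rightarrow> real" where
  "lorentz X Y = - Re (det (X + Y) - det X - det Y) / 2"

definition H3 :: "mat2 set" where
  "H3 = {X \<in> Her2. det X = 1 \<and> Re (trace X) > 0}"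

definition fffE :: "(complex \<Rightarrow> mat2) \<Rightarrow> complex \<Rightarrow> real" where
  "fffE f z = lorentz (dx f z) (dx f z)"
definition fffF :: "(complex \<Rightarrow> mat2) \<Rightarrow> complex \<Rightarrow> real" where
  "fffF f z = lorentz (dx f z) (dy f z)"
definition fffG :: "(complex \<Rightarrow> mat2) \<Rightarrow> complex \<Rightarrow> real" where
  "fffG f z = lorentz (dy f z) (dy f z)"

definition immersion_H3 :: "complex set \<Rightarrow> (complex \<Rightarrow> mat2) \<Rightarrow> bool" where
  "immersion_H3 D f \<longleftrightarrow> smooth_on D f \<and>
     (\<forall>z\<in>D. f z \<in> H3 \<and> fffE f z > 0 \<and> fffE f z * fffG f z - (fffF f z)\<^sup>2 > 0)"

text \<open>A unit normal of the surface inside $\mathbb{H}^3$; as the unit normal of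
  $\mathbb{H}^3$ in the Minkowski space of Hermitian matrices is the position vector, such an
  \<open>N\<close> is also orthogonal to \<open>f\<close>.\<close>

definition unit_normal_H3 :: "complex set \<Rightarrow> (complex \<Rightarrow> mat2) \<Rightarrow> (complex \<Rightarrow> mat2) \<Rightarrow> bool" where
  "unit_normal_H3 D f N \<longleftrightarrow> smooth_on D N \<and>
     (\<forall>z\<in>D. N z \<in> Her2 \<and> lorentz (N z) (N z) = 1 \<and> lorentz (N z) (f z) = 0 \<and>
            lorentz (N z) (dx f z) = 0 \<and> lorentz (N z) (dy f z) = 0)"

text \<open>Half the trace of the second fundamental form with respect to the first. Since \<open>N\<close> is
  orthogonal to \<open>f\<close>, the Minkowski second derivatives give the second fundamental form in
  $\mathbb{H}^3$.\<close>

definition mean_curv :: "(complex \<Rightarrow> mat2) \<Rightarrow> (complex \<Rightarrow> mat2) \<Rightarrow> complex \<Rightarrow> real" where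
  "mean_curv f N z =
     (fffE f z * lorentz (dy (dy f) z) (N z)
      - 2 * fffF f z * lorentz (dx (dy f) z) (N z)
      + fffG f z * lorentz (dx (dx f) z) (N z))
     / (2 * (fffE f z * fffG f z - (fffF f z)\<^sup>2))"

definition cmc_surface_H3 :: "complex set \<Rightarrow> real \<Rightarrow> (complex \<Rightarrow> mat2) \<Rightarrow> bool" where
  "cmc_surface_H3 D H f \<longleftrightarrow> immersion_H3 D f \<and>
     (\<exists>N. unit_normal_H3 D f N \<and> (\<forall>z\<in>D. mean_curv f N z = H))"


section \<open>Extended frames\<close>

definition coth :: "real \<Rightarrow> real" where
  "coth q = cosh q / sinh q"

definition scrH :: "real \<Rightarrow> real" where
  "scrH q = exp (- q) * (coth q + 1)"

definition Umat :: "real \<Rightarrow> (complex \<Rightarrow> real) \<Rightarrow> (complex \<Rightarrow> complex) \<Rightarrow> complex \<Rightarrow> complex \<Rightarrow> mat2" where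
  "Umat q u Q z l = mat2
     (wirt_z u z / 4)                              (- (1/2) * inverse l * of_real (scrH q * exp (u z / 2)))
     (inverse l * Q z * of_real (exp (- u z / 2))) (- wirt_z u z / 4)"

definition Vmat :: "real \<Rightarrow> (complex \<Rightarrow> real) \<Rightarrow> (complex \<Rightarrow> complex) \<Rightarrow> complex \<Rightarrow> complex \<Rightarrow> mat2" where
  "Vmat q u Q z l = mat2
     (- wirt_zbar u z / 4)                         (- l * cnj (Q z) * of_real (exp (- u z / 2)))
     ((1/2) * l * of_real (scrH q * exp (u z / 2))) (wirt_zbar u z / 4)"

text \<open>\<open>\<Psi> z l\<close> is the frame at \<open>z\<close>, with \<open>\<Psi> z\<close> considered on all of
  $\mathbb{C}^\times$.\<close>

definition extended_frame ::
  "complex set \<Rightarrow> real \<Rightarrow> (complex \<Rightarrow> real) \<Rightarrow> (complex \<Rightarrow> complex) \<Rightarrow> (complex \<Rightarrow> complex \<Rightarrow> mat2) \<Rightarrow> bool" where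
  "extended_frame D q u Q \<Psi> \<longleftrightarrow>
     smooth_on D u \<and> Q holomorphic_on D \<and>
     (\<forall>z\<in>D. loop_SL2_tau3 (\<Psi> z) \<and> (\<forall>i j. (\<lambda>l. \<Psi> z l $ i $ j) holomorphic_on (- {0}))) \<and>
     (\<forall>z\<in>D. \<forall>l. l \<noteq> 0 \<longrightarrow>
        ((\<lambda>z. \<Psi> z l) has_derivative
           (\<lambda>h. \<Psi> z l ** (cscale h (Umat q u Q z l) + cscale (cnj h) (Vmat q u Q z l)))) (at z))"

definition sym_formula :: "real \<Rightarrow> (complex \<Rightarrow> complex \<Rightarrow> mat2) \<Rightarrow> complex \<Rightarrow> complex \<Rightarrow> mat2" where
  "sym_formula q \<Psi> l z =
     \<Psi> z l ** diag2 (of_real (exp (- q / 2))) (of_real (exp (q / 2))) ** hconj (\<Psi> z l)"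

text \<open>The surface is obtained for every \<open>l\<close> with \<open>norm l = exp (- q / 2)\<close>; its metric is
  $e^u\,dz\,d\bar z = e^u (dx^2 + dy^2)$.\<close>

definition extended_frame_of_cmc :: "complex set \<Rightarrow> real \<Rightarrow> (complex \<Rightarrow> complex \<Rightarrow> mat2) \<Rightarrow> bool" where
  "extended_frame_of_cmc D H \<Psi> \<longleftrightarrow>
     (\<exists>q u Q. q > 0 \<and> H = coth q \<and> extended_frame D q u Q \<Psi> \<and>
        (\<forall>l. norm l = exp (- q / 2) \<longrightarrow>
           cmc_surface_H3 D H (sym_formula q \<Psi> l) \<and>
           (\<forall>z\<in>D. fffE (sym_formula q \<Psi> l) z = exp (u z) \<and>
                  fffF (sym_formula q \<Psi> l) z = 0 \<and>
                  fffG (sym_formula q \<Psi> l) z = exp (u z))))"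

end

theory Submission
  imports Defs
begin

text \<open>
On the unit circle \<open>\<Phi>\<^sup>-\<^sup>1 d\<Phi> = V \<eta> V\<^sup>-\<^sup>1 - dV V\<^sup>-\<^sup>1\<close>, so this form has no Fourier modes below \<open>-1\<close>; as \<open>C\<close> is
holomorphic in \<open>z\<close>, its \<open>(0,1)\<close>-part comes from \<open>dV V\<^sup>-\<^sup>1\<close> alone and has no modes below \<open>0\<close>. Since \<open>\<Phi>\<close> is
unitary on the circle, the form is skew-Hermitian, and the adjoint exchanges the \<open>(1,0)\<close>- and
\<open>(0,1)\<close>-parts and reverses the modes. Hence only the modes \<open>-1, 0, 1\<close> survive
(\<open>maurer_cartan_three_terms\<close>), and they are determined by \<open>\<eta>\<^bsub>-1\<^esub>\<close> and by the value
\<open>diag(v, 1/v)\<close> of \<open>V\<close> at \<open>\<lambda> = 0\<close> (\<open>iwasawa_factor_coefficients\<close>).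

Let \<open>a\<close> and \<open>b\<close> be the upper right and the lower left entry of \<open>\<eta>\<^bsub>-1\<^esub>\<close>. As \<open>D\<close> is simply connected and
\<open>a\<close> has no zeros, \<open>v\<^sup>2 a = exp G\<close> for a smooth \<open>G\<close>. The gauge with \<open>\<theta> = (Im G - \<pi>) / 2\<close> turns the entry
\<open>v\<^sup>2 a\<close> into \<open>- exp (Re G)\<close>, which is the required entry if \<open>exp (u/2)\<close> is the suitable multiple of
\<open>exp (Re G)\<close>; the other off-diagonal entry then gives \<open>Q\<close> as a multiple of the holomorphic function
\<open>a b\<close>, and the diagonal entries agree because \<open>a\<close> is holomorphic (\<open>gauge_diagonal\<close>). The change of
coordinates is the identity, and \<open>q > 0\<close> is arbitrary.

All this happens on the circle. To leave it, consider the Fourier coefficients of the gauged \<open>\<Phi>\<close> as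
functions of \<open>z\<close>. They satisfy a linear system that couples each coefficient to its two neighbours,
they are bounded because \<open>\<Phi>\<close> is unitary, and at the base point all but the constant one vanish,
since there \<open>\<Phi> = V\<^sup>-\<^sup>1\<close> extends to the disc and by reflection to its outside. By
\<open>three_term_decay\<close> they decay faster than every geometric sequence at all points of \<open>D\<close>. So the
Laurent series converges for all \<open>\<lambda> \<noteq> 0\<close> and may be differentiated termwise (\<open>laurent_frame\<close>); it
is an extended frame.

Finally, for \<open>\<bar>\<lambda>\<bar> = exp (-q/2)\<close> the Sym formula can be differentiated by means of the frame equation alone.
The first derivatives are \<open>\<Psi> X \<Psi>\<^sup>*\<close> with off-diagonal Hermitian \<open>X\<close>, and a normal is obtained from the
diagonal matrix \<open>diag(exp (-q/2), - exp (q/2))\<close>, so that metric and mean curvature reduce to matrix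
identities (\<open>sym_formula_cmc\<close>).
\<close>

(* Power series coefficients share the dollar sign with vector components, which are meant here. *)
no_notation fps_nth (infixl "$" 75)

section \<open>Algebra of complex two by two matrices\<close>

lemma mat2_nth [simp]:
  "mat2 a b c d $ 1 $ 1 = a" "mat2 a b c d $ 1 $ 2 = b"
  "mat2 a b c d $ 2 $ 1 = c" "mat2 a b c d $ 2 $ 2 = d"
  by (simp_all add: mat2_def)

lemma mat2_eq_iff:
  "(A :: mat2) = B \<longleftrightarrow> A $ 1 $ 1 = B $ 1 $ 1 \<and> A $ 1 $ 2 = B $ 1 $ 2 \<and>
     A $ 2 $ 1 = B $ 2 $ 1 \<and> A $ 2 $ 2 = B $ 2 $ 2"
  by (auto simp: vec_eq_iff forall_2)

lemma mult_nth [simp]: "((A :: mat2) ** B) $ i $ j = A $ i $ 1 * B $ 1 $ j + A $ i $ 2 * B $ 2 $ j"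
  by (simp add: matrix_matrix_mult_def sum_2)

lemma cscale_nth [simp]: "cscale c A $ i $ j = c * A $ i $ j"
  by (simp add: cscale_def)

lemma hconj_nth [simp]: "hconj A $ i $ j = cnj (A $ j $ i)"
  by (simp add: hconj_def transpose_def)

lemma mat_1_nth [simp]: "(mat 1 :: mat2) $ 1 $ 1 = 1" "(mat 1 :: mat2) $ 1 $ 2 = 0"
  "(mat 1 :: mat2) $ 2 $ 1 = 0" "(mat 1 :: mat2) $ 2 $ 2 = 1"
  by (simp_all add: mat_def)

definition adjugate :: "mat2 \<Rightarrow> mat2" where
  "adjugate A = mat2 (A $ 2 $ 2) (- (A $ 1 $ 2)) (- (A $ 2 $ 1)) (A $ 1 $ 1)"

lemma adjugate_nth [simp]:
  "adjugate A $ 1 $ 1 = A $ 2 $ 2" "adjugate A $ 1 $ 2 = - (A $ 1 $ 2)"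
  "adjugate A $ 2 $ 1 = - (A $ 2 $ 1)" "adjugate A $ 2 $ 2 = A $ 1 $ 1"
  by (simp_all add: adjugate_def)

lemma hconj_mult: "hconj (A ** B) = hconj B ** hconj A"
  by (simp add: mat2_eq_iff algebra_simps)

lemma det_hconj: "det (hconj A) = cnj (det A)"
  by (simp add: det_2 algebra_simps)

lemma adjugate_inverse:
  assumes "det A = 1"
  shows "A ** adjugate A = mat 1" "adjugate A ** A = mat 1"
  using assms by (auto simp: mat2_eq_iff det_2 algebra_simps)

lemma matrix_inv_unique:
  assumes "A ** B = mat 1" "B ** A = (mat 1 :: mat2)"
  shows "matrix_inv A = B"
proof -
  have "\<exists>X. A ** X = mat 1 \<and> X ** A = mat 1" using assms by blast
  then have "A ** matrix_inv A = mat 1"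
    unfolding matrix_inv_def by (rule someI2_ex) blast
  then have "B ** (A ** matrix_inv A) = B" by simp
  then show ?thesis by (simp add: matrix_mul_assoc assms)
qed

lemma sigma_eq: "sigma X = mat2 (X $ 1 $ 1) (- (X $ 1 $ 2)) (- (X $ 2 $ 1)) (X $ 2 $ 2)"
proof -
  have "matrix_inv (diag2 1 (- 1)) = diag2 1 (- 1)"
    by (rule matrix_inv_unique) (simp_all add: mat2_eq_iff)
  then show ?thesis by (simp add: sigma_def Ad_def mat2_eq_iff)
qed

text \<open>The reflection \<open>\<lambda> \<mapsto> 1 / cnj \<lambda>\<close> fixes the circle, where the real form therefore consists of the
  unitary loops.\<close>

lemma tau3_circle_iff:
  assumes "det (g l) = 1" and l: "norm l = 1"
  shows "tau3 g l = g l \<longleftrightarrow> hconj (g l) ** g l = mat 1"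
proof -
  have 1: "1 / cnj l = l"
  proof -
    have "cnj l * l = 1" using l complex_norm_square[of l] by (simp add: mult.commute)
    then show ?thesis by (metis mult_zero_left nonzero_eq_divide_eq mult.commute zero_neq_one)
  qed
  have d: "det (hconj (g l)) = 1" by (simp add: det_hconj assms)
  have "matrix_inv (hconj (g l)) = adjugate (hconj (g l))"
    using adjugate_inverse[OF d] by (rule matrix_inv_unique)
  then have "tau3 g l = adjugate (hconj (g l))" by (simp add: tau3_def 1)
  moreover have "adjugate (hconj (g l)) = g l \<longleftrightarrow> hconj (g l) ** g l = mat 1"
    using adjugate_inverse[OF d] by (metis matrix_mul_assoc matrix_mul_lid matrix_mul_rid)
  ultimately show ?thesis by simp
qed

lemma norm_mat2_entry: "norm ((A :: mat2) $ i $ j) \<le> norm A"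
  using Finite_Cartesian_Product.norm_nth_le[of "A $ i" j] Finite_Cartesian_Product.norm_nth_le[of A i] by linarith

lemma norm_mat2_le: "norm (A :: mat2) \<le> (\<Sum>i\<in>UNIV. \<Sum>j\<in>UNIV. norm (A $ i $ j))"
proof -
  have *: "norm v \<le> (\<Sum>j\<in>UNIV. norm (v $ j))" for v :: "'b::real_normed_vector^2"
    unfolding norm_vec_def by (rule L2_set_le_sum) simp
  show ?thesis by (rule order_trans[OF *]) (intro sum_mono *)
qed

section \<open>Absolutely convergent Fourier series\<close>

text \<open>Coefficients are carried explicitly; they turn out to be the Fourier coefficients
  (\<open>fourier_coeff_circle_series\<close>), so that operations on loops can be read off from series.\<close>

definition circle_series :: "(complex \<Rightarrow> complex) \<Rightarrow> (int \<Rightarrow> complex) \<Rightarrow> bool" where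
  "circle_series f a \<longleftrightarrow> (\<lambda>k. norm (a k)) summable_on UNIV \<and>
     (\<forall>l\<in>sphere 0 1. ((\<lambda>k. a k * l powi k) has_sum f l) UNIV)"

lemma cis_powi: "cis t powi k = cis (of_int k * t)"
proof (cases "k \<ge> 0")
  case True
  then show ?thesis by (simp add: power_int_def Complex.DeMoivre)
next
  case False
  then show ?thesis
    by (simp add: power_int_def cis_inverse Complex.DeMoivre)
qed

lemma norm_powi_circle: "norm l = 1 \<Longrightarrow> norm ((l::complex) powi k) = 1"
  by (simp add: norm_power_int)

lemma integral_cis_int:
  "integral {0..2 * pi} (\<lambda>t. cis (of_int n * t)) = (if n = 0 then of_real (2 * pi) else 0)"
proof (cases "n = 0")
  case False
  define F where "F = (\<lambda>t. cis (of_int n * t) / (\<i> * of_int n))"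
  have "((\<lambda>t. cis (of_int n * t)) has_integral F (2 * pi) - F 0) {0..2 * pi}"
  proof (rule fundamental_theorem_of_calculus)
    fix x assume "x \<in> {0..2 * pi}"
    have "((\<lambda>z. exp (\<i> * of_int n * z) / (\<i> * of_int n)) has_field_derivative
            exp (\<i> * of_int n * of_real x)) (at (of_real x))"
      using False by (auto intro!: derivative_eq_intros)
    then have "((\<lambda>t. exp (\<i> * of_int n * of_real t) / (\<i> * of_int n)) has_vector_derivative
            exp (\<i> * of_int n * of_real x)) (at x within {0..2 * pi})"
      by (rule has_vector_derivative_real_field)
    then show "(F has_vector_derivative cis (of_int n * x)) (at x within {0..2 * pi})"
      by (simp add: F_def cis_conv_exp mult.assoc)
  qed (use pi_ge_zero in simp)
  moreover have "F (2 * pi) = F 0"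
  proof -
    have "cis (of_int n * (2 * pi)) = 1"
      using cis_multiple_2pi[of "of_int n"] by (simp only: mult.commute Ints_of_int)
    then show ?thesis by (simp add: F_def)
  qed
  ultimately show ?thesis using False by (simp add: integral_unique)
qed (simp add: scaleR_conv_of_real)

text \<open>Termwise integration, which the uniform convergence of the series permits.\<close>

lemma fourier_coeff_circle_series:
  assumes "circle_series f a"
  shows "fourier_coeff f k = a k"
proof -
  let ?g = "\<lambda>j t. a j * cis (of_int (j - k) * t)"
  have split: "cis (of_int j * t) * cis (- (of_int k * t)) = cis (of_int (j - k) * t)" for j t
    by (simp add: cis_mult algebra_simps)
  have lim: "uniform_limit (cbox 0 (2 * pi)) (\<lambda>X t. \<Sum>j\<in>X. ?g j t)
     (\<lambda>t. f (cis t) * cis (- (of_int k * t))) (finite_subsets_at_top UNIV)"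
  proof (rule Weierstrass_m_test_general')
    show "norm (?g j t) \<le> norm (a j)" for j t by (simp add: norm_mult)
    show "(\<lambda>k. norm (a k)) summable_on UNIV" using assms by (simp add: circle_series_def)
    fix t
    have "((\<lambda>j. a j * cis t powi j) has_sum f (cis t)) UNIV"
      using assms by (simp add: circle_series_def)
    then have "((\<lambda>j. a j * cis t powi j * cis (- (of_int k * t))) has_sum
        f (cis t) * cis (- (of_int k * t))) UNIV"
      by (rule has_sum_cmult_left)
    then show "((\<lambda>j. ?g j t) has_sum f (cis t) * cis (- (of_int k * t))) UNIV"
      by (simp add: cis_powi mult.assoc split)
  qed
  have cont: "continuous_on (cbox 0 (2 * pi)) (\<lambda>t. \<Sum>j\<in>X. ?g j t)" for X
    by (intro continuous_intros continuous_on_cis)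
  obtain I J where I: "\<And>X. ((\<lambda>t. \<Sum>j\<in>X. ?g j t) has_integral I X) (cbox 0 (2 * pi))"
    and J: "((\<lambda>t. f (cis t) * cis (- (of_int k * t))) has_integral J) (cbox 0 (2 * pi))"
    and IJ: "(I \<longlongrightarrow> J) (finite_subsets_at_top UNIV)"
    using uniform_limit_integral_cbox[OF lim cont finite_subsets_at_top_neq_bot] by blast
  have "I X = of_real (2 * pi) * a k" if X: "finite X" "k \<in> X" for X
  proof -
    have "I X = integral {0..2 * pi} (\<lambda>t. \<Sum>j\<in>X. ?g j t)"
      using I by (metis integral_unique box_real(2))
    also have "\<dots> = (\<Sum>j\<in>X. integral {0..2 * pi} (?g j))"
      by (intro integral_sum X integrable_continuous_interval continuous_intros continuous_on_cis)
    also have "\<dots> = (\<Sum>j\<in>X. if j = k then of_real (2 * pi) * a k else 0)"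
      by (rule sum.cong[OF refl]) (simp only: integral_mult_right integral_cis_int, simp)
    also have "\<dots> = of_real (2 * pi) * a k" using X by simp
    finally show ?thesis .
  qed
  then have "\<forall>\<^sub>F X in finite_subsets_at_top UNIV. I X = of_real (2 * pi) * a k"
    by (auto simp: eventually_finite_subsets_at_top intro!: exI[of _ "{k}"])
  then have "(I \<longlongrightarrow> of_real (2 * pi) * a k) (finite_subsets_at_top UNIV)"
    by (rule tendsto_eventually)
  then have "J = of_real (2 * pi) * a k"
    using IJ tendsto_unique finite_subsets_at_top_neq_bot by blast
  then show ?thesis
    using integral_unique[OF J] by (simp add: fourier_coeff_def)
qed

lemma wiener_iff_circle_series: "wiener f \<longleftrightarrow> circle_series f (fourier_coeff f)"
  by (simp add: wiener_def circle_series_def)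

lemma circle_series_wiener: "circle_series f a \<Longrightarrow> wiener f"
  using fourier_coeff_circle_series[of f a] by (metis ext wiener_iff_circle_series)

lemma circle_series_cong:
  "circle_series f a \<Longrightarrow> (\<And>l. norm l = 1 \<Longrightarrow> f l = g l) \<Longrightarrow> circle_series g a"
  unfolding circle_series_def by auto

lemma circle_series_add:
  "circle_series f a \<Longrightarrow> circle_series g b \<Longrightarrow> circle_series (\<lambda>l. f l + g l) (\<lambda>k. a k + b k)"
  unfolding circle_series_def
  by (auto simp: ring_distribs intro!: has_sum_add norm_triangle_ineq
      summable_on_comparison_test[OF summable_on_add, of "\<lambda>k. norm (a k)" _ "\<lambda>k. norm (b k)"])

lemma circle_series_cmult:
  "circle_series f a \<Longrightarrow> circle_series (\<lambda>l. c * f l) (\<lambda>k. c * a k)"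
  unfolding circle_series_def
  by (auto simp: norm_mult mult.assoc intro!: has_sum_cmult_right summable_on_cmult_right)

lemma circle_series_diff:
  "circle_series f a \<Longrightarrow> circle_series g b \<Longrightarrow> circle_series (\<lambda>l. f l - g l) (\<lambda>k. a k - b k)"
  using circle_series_add[of f a "\<lambda>l. -1 * g l" "\<lambda>k. -1 * b k"] circle_series_cmult[of g b "-1"]
  by simp

lemma circle_series_powi_mult:
  assumes "circle_series f a"
  shows "circle_series (\<lambda>l. l powi m * f l) (\<lambda>k. a (k - m))"
proof -
  have bij: "bij_betw (\<lambda>k. k - m) UNIV (UNIV :: int set)"
    by (rule bij_betwI[where g = "\<lambda>k. k + m"]) auto
  have "((\<lambda>k. a (k - m) * l powi k) has_sum l powi m * f l) UNIV" if l: "norm l = 1" for l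
  proof -
    have "((\<lambda>k. a k * l powi k) has_sum f l) UNIV" using assms l by (simp add: circle_series_def)
    then have "((\<lambda>k. a (k - m) * l powi (k - m)) has_sum f l) UNIV"
      by (subst has_sum_reindex_bij_betw[OF bij, where f = "\<lambda>k. a k * l powi k"])
    then have "((\<lambda>k. l powi m * (a (k - m) * l powi (k - m))) has_sum l powi m * f l) UNIV"
      by (rule has_sum_cmult_right)
    moreover have "l powi m * (a (k - m) * l powi (k - m)) = a (k - m) * l powi k" for k
    proof -
      have "l \<noteq> 0" using l by auto
      then have "l powi k = l powi m * l powi (k - m)" using power_int_add[of l m "k - m"] by simp
      then show ?thesis by simp
    qed
    ultimately show ?thesis by simp
  qed
  moreover have "(\<lambda>k. norm (a (k - m))) summable_on UNIV"
    using assms summable_on_reindex_bij_betw[OF bij, of "\<lambda>k. norm (a k)"]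
    by (simp add: circle_series_def)
  ultimately show ?thesis by (auto simp: circle_series_def)
qed

text \<open>On the circle conjugation inverts \<open>\<lambda>\<close>.\<close>

lemma circle_series_cnj:
  assumes "circle_series f a"
  shows "circle_series (\<lambda>l. cnj (f l)) (\<lambda>k. cnj (a (- k)))"
proof -
  have bij: "bij_betw uminus UNIV (UNIV :: int set)"
    by (rule bij_betwI[where g = uminus]) auto
  have "((\<lambda>k. cnj (a (- k)) * l powi k) has_sum cnj (f l)) UNIV" if l: "norm l = 1" for l
  proof -
    have "((\<lambda>k. cnj (a k * l powi k)) has_sum cnj (f l)) UNIV"
      using assms l by (simp only: has_sum_cnj_iff circle_series_def) simp
    then have "((\<lambda>k. cnj (a (- k) * l powi (- k))) has_sum cnj (f l)) UNIV"
      by (subst has_sum_reindex_bij_betw[OF bij, where f = "\<lambda>k. cnj (a k * l powi k)"])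
    moreover have "cnj (l powi (- k)) = l powi k" for k
    proof -
      have "cnj l * l = 1" using l complex_norm_square[of l] by (simp add: mult.commute)
      then have "inverse (cnj l) = l" by (metis inverse_unique)
      then show ?thesis by (simp add: complex_cnj_power_int power_int_minus flip: power_int_inverse)
    qed
    ultimately show ?thesis by simp
  qed
  moreover have "(\<lambda>k. norm (a (- k))) summable_on UNIV"
    using assms summable_on_reindex_bij_betw[OF bij, of "\<lambda>k. norm (a k)"]
    by (simp add: circle_series_def)
  ultimately show ?thesis by (auto simp: circle_series_def)
qed

text \<open>Absolute summability over pairs of indices permits to sort the product of the two series by the
  degree \<open>n\<close> of its terms.\<close>

lemma circle_series_mult:
  assumes f: "circle_series f a" and g: "circle_series g b"
  shows "circle_series (\<lambda>l. f l * g l) (\<lambda>n. \<Sum>\<^sub>\<infinity>k. a k * b (n - k))"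
proof -
  have na: "(\<lambda>k. norm (a k)) summable_on UNIV" and nb: "(\<lambda>k. norm (b k)) summable_on UNIV"
    using f g by (auto simp: circle_series_def)
  have pairs: "(\<lambda>p. norm (a (fst p) * b (snd p))) summable_on UNIV \<times> UNIV"
  proof (rule iffD2[OF Infinite_Sum.abs_summable_on_Sigma_iff], intro conjI ballI)
    show "(\<lambda>m. norm (a (fst (k, m)) * b (snd (k, m)))) summable_on UNIV" for k
      by (simp only: fst_conv snd_conv norm_mult) (rule summable_on_cmult_right[OF nb])
    have "(\<lambda>k. norm (a k) * (\<Sum>\<^sub>\<infinity>m. norm (b m))) summable_on UNIV"
      by (rule summable_on_cmult_left[OF na])
    moreover have "norm (\<Sum>\<^sub>\<infinity>m. norm (a (fst (k, m)) * b (snd (k, m)))) =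
        norm (a k) * (\<Sum>\<^sub>\<infinity>m. norm (b m))" for k
      by (simp add: norm_mult infsum_cmult_right' abs_mult infsum_nonneg)
    ultimately show "(\<lambda>k. norm (\<Sum>\<^sub>\<infinity>m. norm (a (fst (k, m)) * b (snd (k, m))))) summable_on UNIV"
      by simp
  qed
  define \<phi> where "\<phi> = (\<lambda>(n :: int, k :: int). (k, n - k))"
  have bij: "bij_betw \<phi> (UNIV \<times> UNIV) (UNIV \<times> UNIV)"
    by (rule bij_betwI[where g = "\<lambda>(k, m). (k + m, k)"]) (auto simp: \<phi>_def)
  have "(\<lambda>q. norm (a (fst (\<phi> q)) * b (snd (\<phi> q)))) summable_on UNIV \<times> UNIV"
    using pairs summable_on_reindex_bij_betw[OF bij, of "\<lambda>p. norm (a (fst p) * b (snd p))"] by simp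
  then have abs: "(\<lambda>(n, k). norm (a k * b (n - k))) summable_on UNIV \<times> UNIV"
    by (simp add: \<phi>_def case_prod_unfold)
  have inner: "(\<lambda>k. norm (a k * b (n - k))) summable_on UNIV" for n
    using summable_on_SigmaD1[OF abs] by simp
  have outer: "(\<lambda>n. norm (\<Sum>\<^sub>\<infinity>k. norm (a k * b (n - k)))) summable_on UNIV"
    using abs Infinite_Sum.abs_summable_on_Sigma_iff[where f = "\<lambda>(n, k). a k * b (n - k)" and A = UNIV and B = "\<lambda>_. UNIV"]
    by (simp add: case_prod_unfold)
  have "(\<lambda>n. norm (\<Sum>\<^sub>\<infinity>k. a k * b (n - k))) summable_on UNIV"
  proof (rule Infinite_Sum.abs_summable_on_comparison_test[OF outer])
    fix n
    have "norm (\<Sum>\<^sub>\<infinity>k. a k * b (n - k)) \<le> (\<Sum>\<^sub>\<infinity>k. norm (a k * b (n - k)))"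
      by (rule norm_infsum_bound[OF inner])
    then show "norm (\<Sum>\<^sub>\<infinity>k. a k * b (n - k)) \<le> norm (\<Sum>\<^sub>\<infinity>k. norm (a k * b (n - k)))"
      by simp
  qed
  moreover have "((\<lambda>n. (\<Sum>\<^sub>\<infinity>k. a k * b (n - k)) * l powi n) has_sum f l * g l) UNIV"
    if l: "norm l = 1" for l
  proof -
    have fl: "((\<lambda>k. a k * l powi k) has_sum f l) UNIV" and gl: "((\<lambda>k. b k * l powi k) has_sum g l) UNIV"
      using f g l by (auto simp: circle_series_def)
    define F where "F = (\<lambda>p. a (fst p) * l powi (fst p) * (b (snd p) * l powi (snd p)))"
    have "(\<lambda>p. norm (F p)) summable_on UNIV \<times> UNIV"
      using pairs l by (simp add: F_def norm_mult norm_powi_circle)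
    then have "F summable_on UNIV \<times> UNIV" by (rule abs_summable_summable)
    then have "(F has_sum f l * g l) (UNIV \<times> UNIV)"
      by (intro has_sum_SigmaI[where g = "\<lambda>k. a k * l powi k * g l"] has_sum_cmult_left[OF fl])
        (auto simp: F_def intro!: has_sum_cmult_right gl)
    then have "((\<lambda>q. F (\<phi> q)) has_sum f l * g l) (UNIV \<times> UNIV)"
      using has_sum_reindex_bij_betw[OF bij, of F "f l * g l"] by simp
    then show ?thesis
    proof (rule has_sum_SigmaD)
      fix n
      have "F (\<phi> (n, k)) = a k * b (n - k) * l powi n" for k
      proof -
        have "l \<noteq> 0" using l by auto
        then have "l powi n = l powi k * l powi (n - k)" using power_int_add[of l k "n - k"] by simp
        then show ?thesis by (simp add: F_def \<phi>_def)
      qed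
      moreover have "((\<lambda>k. a k * b (n - k) * l powi n) has_sum (\<Sum>\<^sub>\<infinity>k. a k * b (n - k)) * l powi n) UNIV"
        by (intro has_sum_cmult_left has_sum_infsum abs_summable_summable[OF inner])
      ultimately show "((\<lambda>k. F (\<phi> (n, k))) has_sum (\<Sum>\<^sub>\<infinity>k. a k * b (n - k)) * l powi n) UNIV"
        by simp
    qed
  qed
  ultimately show ?thesis by (auto simp: circle_series_def)
qed

text \<open>Only the lowest term of the convolution survives in the lowest degree.\<close>

lemma convolution_lowest:
  fixes a b :: "int \<Rightarrow> complex"
  assumes a: "\<And>k. k < m \<Longrightarrow> a k = 0" and b: "\<And>k. k < n \<Longrightarrow> b k = 0"
  shows "(\<Sum>\<^sub>\<infinity>k. a k * b (m + n - k)) = a m * b n"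
    and "N < m + n \<Longrightarrow> (\<Sum>\<^sub>\<infinity>k. a k * b (N - k)) = 0"
proof -
  have "a k * b (m + n - k) = 0" if "k \<noteq> m" for k
    using a[of k] b[of "m + n - k"] that by (cases "k < m") auto
  then have "(\<Sum>\<^sub>\<infinity>k. a k * b (m + n - k)) = (\<Sum>\<^sub>\<infinity>k\<in>{m}. a k * b (m + n - k))"
    by (intro infsum_cong_neutral) auto
  then show "(\<Sum>\<^sub>\<infinity>k. a k * b (m + n - k)) = a m * b n" by simp
  assume N: "N < m + n"
  have "a k * b (N - k) = 0" for k
    using a[of k] b[of "N - k"] N by (cases "k < m") auto
  then show "(\<Sum>\<^sub>\<infinity>k. a k * b (N - k)) = 0" by (intro infsum_0) simp
qed

lemma circle_series_neg:
  assumes "circle_series f a"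
  shows "circle_series (\<lambda>l. f (- l)) (\<lambda>k. (- 1) powi k * a k)"
  unfolding circle_series_def
proof (intro conjI ballI)
  show "(\<lambda>k. norm ((- 1) powi k * a k)) summable_on UNIV"
    using assms by (simp add: circle_series_def norm_mult norm_power_int)
  fix l :: complex assume "l \<in> sphere 0 1"
  then have "((\<lambda>k. a k * (- l) powi k) has_sum f (- l)) UNIV"
    using assms by (simp add: circle_series_def)
  moreover have "(- l) powi k = (- 1) powi k * l powi k" for k
    using power_int_mult_distrib[of "-1" l k] by simp
  ultimately show "((\<lambda>k. (- 1) powi k * a k * l powi k) has_sum f (- l)) UNIV"
    by (simp add: mult.left_commute mult.assoc)
qed

text \<open>By Cauchy's integral formula at the centre, applied to the extension times a power.\<close>

lemma fourier_coeff_disc_extension: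
  assumes cont: "continuous_on (cball 0 1) F" and hol: "F holomorphic_on ball 0 1"
    and eq: "\<And>l. norm l = 1 \<Longrightarrow> F l = f l" and k: "k < 0"
  shows "fourier_coeff f k = 0"
proof -
  define n where "n = nat (- k)"
  have n: "n > 0" "k = - int n" using k by (auto simp: n_def)
  let ?F = "\<lambda>u. F u * u ^ n"
  have "((\<lambda>u. ?F u / (u - 0)) has_contour_integral (2 * of_real pi * \<i> * ?F 0)) (circlepath 0 1)"
    by (rule Cauchy_integral_circlepath)
      (auto intro!: continuous_intros holomorphic_intros cont hol)
  then have "contour_integral (part_circlepath 0 1 0 (2 * pi)) (\<lambda>u. ?F u / u) = 0"
    using n by (simp add: contour_integral_unique circlepath_def)
  then have "integral {0..2 * pi} (\<lambda>t. ?F (cis t) / cis t * \<i> * cis t) = 0"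
    by (subst (asm) contour_integral_part_circlepath_eq) simp_all
  moreover have "?F (cis t) / cis t * \<i> * cis t = \<i> * (f (cis t) * cis (- (of_int k * t)))" for t
    using n by (simp add: eq Complex.DeMoivre)
  ultimately show ?thesis by (simp add: fourier_coeff_def)
qed


section \<open>Matrix loops with entries in the Wiener algebra\<close>

definition loop_coeff :: "(complex \<Rightarrow> mat2) \<Rightarrow> int \<Rightarrow> mat2" where
  "loop_coeff g k = (\<chi> i j. fourier_coeff (\<lambda>l. g l $ i $ j) k)"

definition loop_series :: "(complex \<Rightarrow> mat2) \<Rightarrow> (int \<Rightarrow> mat2) \<Rightarrow> bool" where
  "loop_series g A \<longleftrightarrow> (\<forall>i j. circle_series (\<lambda>l. g l $ i $ j) (\<lambda>k. A k $ i $ j))"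

lemma loop_seriesD: "loop_series g A \<Longrightarrow> circle_series (\<lambda>l. g l $ i $ j) (\<lambda>k. A k $ i $ j)"
  by (simp add: loop_series_def)

lemma loop_series_wiener: "loop_series g A \<Longrightarrow> wiener_loop g"
  by (auto simp: loop_series_def wiener_loop_def intro: circle_series_wiener)

lemma loop_coeff_series: "loop_series g A \<Longrightarrow> loop_coeff g k = A k"
  by (simp add: loop_coeff_def vec_eq_iff fourier_coeff_circle_series[OF loop_seriesD])

lemma wiener_loop_series: "wiener_loop g \<Longrightarrow> loop_series g (loop_coeff g)"
  by (simp add: loop_series_def wiener_loop_def loop_coeff_def wiener_iff_circle_series)

lemma loop_series_cong:
  assumes "loop_series g A" "\<And>l. norm l = 1 \<Longrightarrow> g l = h l"
  shows "loop_series h A"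
  unfolding loop_series_def
proof (intro allI)
  fix i j
  have "circle_series (\<lambda>l. g l $ i $ j) (\<lambda>k. A k $ i $ j)" using assms by (simp add: loop_series_def)
  then show "circle_series (\<lambda>l. h l $ i $ j) (\<lambda>k. A k $ i $ j)"
    by (rule circle_series_cong) (simp add: assms)
qed

lemma loop_series_add:
  "loop_series g A \<Longrightarrow> loop_series h B \<Longrightarrow> loop_series (\<lambda>l. g l + h l) (\<lambda>k. A k + B k)"
  by (simp add: loop_series_def circle_series_add)

lemma loop_series_diff:
  "loop_series g A \<Longrightarrow> loop_series h B \<Longrightarrow> loop_series (\<lambda>l. g l - h l) (\<lambda>k. A k - B k)"
  by (simp add: loop_series_def circle_series_diff)

lemma loop_series_cscale:
  "loop_series g A \<Longrightarrow> loop_series (\<lambda>l. cscale c (g l)) (\<lambda>k. cscale c (A k))"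
  by (simp add: loop_series_def circle_series_cmult)

lemma loop_series_hconj:
  "loop_series g A \<Longrightarrow> loop_series (\<lambda>l. hconj (g l)) (\<lambda>k. hconj (A (- k)))"
  using circle_series_cnj[OF loop_seriesD] by (simp add: loop_series_def)

lemma loop_series_adjugate:
  "loop_series g A \<Longrightarrow> loop_series (\<lambda>l. adjugate (g l)) (\<lambda>k. adjugate (A k))"
  using circle_series_cmult[where c = "-1"]
  by (force simp: loop_series_def forall_2)

lemma loop_series_mult_const:
  "loop_series g A \<Longrightarrow> loop_series (\<lambda>l. g l ** M) (\<lambda>k. A k ** M)"
  unfolding loop_series_def mult_nth
  by (intro allI circle_series_add) (auto simp: mult.commute[of _ "M $ _ $ _"] intro: circle_series_cmult)

lemma loop_series_powi:
  "loop_series g A \<Longrightarrow> loop_series (\<lambda>l. cscale (l powi m) (g l)) (\<lambda>k. A (k - m))"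
  using circle_series_powi_mult[OF loop_seriesD] by (simp add: loop_series_def)

lemma loop_series_const: "loop_series (\<lambda>l. M) (\<lambda>k. if k = 0 then M else 0)"
  unfolding loop_series_def circle_series_def
proof (intro allI conjI ballI)
  fix i j :: 2 and l :: complex
  have fin: "finite {k :: int. k = 0}" by simp
  show "(\<lambda>k::int. norm ((if k = 0 then M else 0) $ i $ j)) summable_on UNIV"
    by (rule summable_on_cong_neutral[THEN iffD1, OF _ _ _ summable_on_finite[of "{0}"]]) auto
  show "((\<lambda>k. (if k = 0 then M else 0) $ i $ j * l powi k) has_sum M $ i $ j) UNIV"
    by (rule has_sum_finite_neutralI[where B = "{0}"]) auto
qed

text \<open>The second clause is stated for all bounds \<open>m\<close> and \<open>n\<close> on the orders of the factors: orders add, and the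
  lowest coefficients multiply.\<close>

lemma loop_series_mult:
  assumes g: "loop_series g A" and h: "loop_series h B"
  obtains E where "loop_series (\<lambda>l. g l ** h l) E"
    "\<And>m n. (\<And>k. k < m \<Longrightarrow> A k = 0) \<Longrightarrow> (\<And>k. k < n \<Longrightarrow> B k = 0) \<Longrightarrow>
      E (m + n) = A m ** B n \<and> (\<forall>k<m + n. E k = 0)"
proof
  define E :: "int \<Rightarrow> mat2" where "E = (\<lambda>N. \<chi> i j. (\<Sum>\<^sub>\<infinity>k. A k $ i $ 1 * B (N - k) $ 1 $ j) +
      (\<Sum>\<^sub>\<infinity>k. A k $ i $ 2 * B (N - k) $ 2 $ j))"
  show "loop_series (\<lambda>l. g l ** h l) E"
    using g h unfolding loop_series_def mult_nth E_def
    by (auto intro!: circle_series_add circle_series_mult)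
  fix m n
  assume A: "\<And>k. k < m \<Longrightarrow> A k = 0" and B: "\<And>k. k < n \<Longrightarrow> B k = 0"
  show "E (m + n) = A m ** B n \<and> (\<forall>k<m + n. E k = 0)"
  proof (intro conjI allI impI)
    have c: "(\<Sum>\<^sub>\<infinity>k. A k $ i $ p * B (m + n - k) $ p $ j) = A m $ i $ p * B n $ p $ j" for i p j
      by (rule convolution_lowest(1)) (simp_all add: A B)
    then show "E (m + n) = A m ** B n" by (simp add: E_def vec_eq_iff)
    fix N assume N: "N < m + n"
    have "(\<Sum>\<^sub>\<infinity>k. A k $ i $ p * B (N - k) $ p $ j) = 0" for i p j
      by (rule convolution_lowest(2)[OF _ _ N]) (simp_all add: A B)
    then show "E N = 0" by (simp add: E_def vec_eq_iff)
  qed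
qed

lemma loop_series_laurent:
  assumes g: "loop_series g A" and z: "\<And>k. k \<notin> {-1, 0} \<Longrightarrow> A k = 0" and l: "norm l = 1"
  shows "g l = cscale (inverse l) (A (-1)) + A 0"
proof -
  have "g l $ i $ j = (cscale (inverse l) (A (-1)) + A 0) $ i $ j" for i j
  proof -
    have "((\<lambda>k. A k $ i $ j * l powi k) has_sum g l $ i $ j) UNIV"
      using g l by (simp add: loop_series_def circle_series_def)
    moreover have "((\<lambda>k. A k $ i $ j * l powi k) has_sum (\<Sum>k\<in>{-1, 0}. A k $ i $ j * l powi k)) UNIV"
      by (rule has_sum_finite_neutralI[where B = "{-1, 0}"]) (use z in auto)
    ultimately have "g l $ i $ j = (\<Sum>k\<in>{-1, 0}. A k $ i $ j * l powi k)"
      by (rule has_sum_unique)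
    then show ?thesis by (simp add: power_int_minus mult.commute)
  qed
  then show ?thesis by (simp add: vec_eq_iff)
qed

text \<open>Twisted loops have odd off-diagonal entries.\<close>

lemma twisted_coeff_0:
  assumes g: "loop_series g A" and t: "twisted g"
  shows "A 0 $ 1 $ 2 = 0" "A 0 $ 2 $ 1 = 0"
proof -
  have *: "A 0 $ i $ j = 0" if "\<And>l. norm l = 1 \<Longrightarrow> g (- l) $ i $ j = - (g l $ i $ j)" for i j
  proof -
    have s: "circle_series (\<lambda>l. g l $ i $ j) (\<lambda>k. A k $ i $ j)" using g by (simp add: loop_series_def)
    have "circle_series (\<lambda>l. - 1 * g l $ i $ j) (\<lambda>k. (- 1) powi k * A k $ i $ j)"
      by (rule circle_series_cong[OF circle_series_neg[OF s]]) (simp add: that)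
    moreover have "circle_series (\<lambda>l. - 1 * g l $ i $ j) (\<lambda>k. - 1 * A k $ i $ j)"
      by (rule circle_series_cmult[OF s])
    ultimately have "(- 1) powi 0 * A 0 $ i $ j = - 1 * A 0 $ i $ j"
      by (metis (lifting) fourier_coeff_circle_series)
    then show ?thesis by simp
  qed
  show "A 0 $ 1 $ 2 = 0" "A 0 $ 2 $ 1 = 0"
    by (rule *; use t in \<open>simp add: twisted_def sigma_eq\<close>)+
qed

lemma plus_loop_coeff_neg:
  assumes "loop_SL2_plus g" "k < 0"
  shows "loop_coeff g k = 0"
proof -
  obtain G where G: "\<And>l. norm l = 1 \<Longrightarrow> G l = g l"
    "\<And>i j. continuous_on (cball 0 1) (\<lambda>l. G l $ i $ j)" "\<And>i j. (\<lambda>l. G l $ i $ j) holomorphic_on ball 0 1"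
  proof -
    from assms(1) obtain G where "\<forall>l\<in>sphere 0 1. G l = g l"
      "\<forall>i j. continuous_on (cball 0 1) (\<lambda>l. G l $ i $ j) \<and> (\<lambda>l. G l $ i $ j) holomorphic_on ball 0 1"
      unfolding loop_SL2_plus_def by auto
    then show ?thesis by (intro that[of G]) auto
  qed
  have "fourier_coeff (\<lambda>l. g l $ i $ j) k = 0" for i j
    by (rule fourier_coeff_disc_extension[OF G(2,3)]) (use G(1) assms(2) in auto)
  then show ?thesis by (simp add: loop_coeff_def vec_eq_iff)
qed

text \<open>In finite dimension summability is absolute summability, so the expansion of the potential is its
  Fourier series.\<close>

lemma potential_series:
  assumes "holomorphic_potential D \<eta>" "z \<in> D"
  shows "loop_series (potential_at \<eta> z) (\<lambda>k. if k \<ge> -1 then \<eta> k z else 0)"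
proof -
  have sum: "(\<lambda>j. cscale (l powi j) (\<eta> j z)) summable_on {-1..}" if "l \<noteq> 0" for l
    using assms that by (simp add: holomorphic_potential_def)
  have hs: "((\<lambda>k. \<eta> k z $ a $ b * l powi k) has_sum potential_at \<eta> z l $ a $ b) {-1..}"
    if "l \<noteq> 0" for l a b
  proof -
    have "bounded_linear (\<lambda>A :: mat2. A $ a $ b)"
      by (intro bounded_linear_compose[OF bounded_linear_vec_nth] bounded_linear_vec_nth)
    from has_sum_bounded_linear[OF this has_sum_infsum[OF sum[OF that]]]
    show ?thesis by (simp add: potential_at_def mult.commute)
  qed
  show ?thesis unfolding loop_series_def circle_series_def
  proof (intro allI conjI ballI)
    fix a b :: 2
    have "(\<lambda>k. \<eta> k z $ a $ b) summable_on {-1..}"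
      using has_sum_imp_summable[OF hs[of 1 a b]] by simp
    then have "(\<lambda>k. norm (\<eta> k z $ a $ b)) summable_on {-1..}"
      by (simp add: summable_on_iff_abs_summable_on_complex)
    then show "(\<lambda>k. norm ((if k \<ge> -1 then \<eta> k z else 0) $ a $ b)) summable_on UNIV"
      by (rule summable_on_cong_neutral[THEN iffD1, rotated -1]) auto
    fix l :: complex assume "l \<in> sphere 0 1"
    then have "l \<noteq> 0" by auto
    then show "((\<lambda>k. (if k \<ge> -1 then \<eta> k z else 0) $ a $ b * l powi k) has_sum
        potential_at \<eta> z l $ a $ b) UNIV"
      by (intro has_sum_cong_neutral[THEN iffD1, OF _ _ _ hs]) auto
  qed
qed

section \<open>Calculus of smooth functions of one complex variable\<close>

lemma dx_dy_eqI:
  assumes "(f has_derivative (\<lambda>h. Re h *\<^sub>R a + Im h *\<^sub>R b)) (at z)"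
  shows "dx f z = a" "dy f z = b"
  unfolding dx_def dy_def frechet_derivative_at[OF assms, symmetric] by simp_all

lemma has_derivative_dx_dy:
  assumes "f differentiable (at z)"
  shows "(f has_derivative (\<lambda>h. Re h *\<^sub>R dx f z + Im h *\<^sub>R dy f z)) (at z)"
proof -
  let ?F = "frechet_derivative f (at z)"
  have F: "(f has_derivative ?F) (at z)" using assms by (simp add: frechet_derivative_works)
  then have lin: "linear ?F" by (rule has_derivative_linear)
  have "?F h = Re h *\<^sub>R dx f z + Im h *\<^sub>R dy f z" for h
  proof -
    have "h = Re h *\<^sub>R 1 + Im h *\<^sub>R \<i>" by (simp add: complex_eq_iff)
    then have "?F h = ?F (Re h *\<^sub>R 1 + Im h *\<^sub>R \<i>)" by simp
    then show ?thesis by (simp only: linear_add[OF lin] linear_scale[OF lin] dx_def dy_def)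
  qed
  then have "?F = (\<lambda>h. Re h *\<^sub>R dx f z + Im h *\<^sub>R dy f z)" by (rule ext)
  then show ?thesis using F by simp
qed

text \<open>The derivatives are total functions that are junk off \<open>D\<close>; openness of \<open>D\<close> makes the class depend on the
  values in \<open>D\<close> only.\<close>

lemma Ck_on_cong:
  assumes "open D" "Ck_on n D f" "\<And>z. z \<in> D \<Longrightarrow> f z = g z"
  shows "Ck_on n D g"
  using assms(2,3)
proof (induction n arbitrary: f g)
  case 0
  then show ?case using continuous_on_cong[of D D f g] by simp
next
  case (Suc n)
  have d: "(g has_derivative (\<lambda>h. Re h *\<^sub>R dx f z + Im h *\<^sub>R dy f z)) (at z)" if z: "z \<in> D" for z
    using Suc.prems z
    by (intro has_derivative_transform_within_open[OF has_derivative_dx_dy assms(1) z]) auto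
  have "Ck_on n D (dx g)" "Ck_on n D (dy g)"
    using Suc.prems(1) Suc.IH[of "dx f" "dx g"] Suc.IH[of "dy f" "dy g"] dx_dy_eqI[OF d] by auto
  with d show ?case by (auto simp: differentiable_def)
qed

lemma Ck_on_SucI:
  assumes "open D"
    and d: "\<And>z. z \<in> D \<Longrightarrow> (f has_derivative (\<lambda>h. Re h *\<^sub>R fx z + Im h *\<^sub>R fy z)) (at z)"
    and "Ck_on n D fx" "Ck_on n D fy"
  shows "Ck_on (Suc n) D f"
  using d dx_dy_eqI[OF d] Ck_on_cong[OF assms(1,3), of "dx f"] Ck_on_cong[OF assms(1,4), of "dy f"]
  by (auto simp: differentiable_def)

lemma Ck_on_Suc_imp: "Ck_on (Suc n) D f \<Longrightarrow> Ck_on n D f"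
proof (induction n arbitrary: f)
  case 0
  then show ?case
    by (auto intro!: continuous_at_imp_continuous_on differentiable_imp_continuous_within)
next
  case (Suc n)
  from Suc.prems Suc.IH[of "dx f"] Suc.IH[of "dy f"] show ?case by simp
qed

lemma Ck_on_const: "Ck_on n D (\<lambda>_. c)"
proof (induction n arbitrary: c)
  case (Suc n)
  have "dx (\<lambda>_. c) = (\<lambda>_. 0)" "dy (\<lambda>_. c) = (\<lambda>_. 0)"
    by (auto simp: dx_def dy_def fun_eq_iff)
  with Suc[of 0] show ?case by simp
qed simp

lemma Ck_on_bounded_linear:
  assumes "open D" and T: "bounded_linear T" and "Ck_on n D f"
  shows "Ck_on n D (\<lambda>z. T (f z))"
  using assms(3)
proof (induction n arbitrary: f)
  case 0
  then show ?case using bounded_linear.continuous_on[OF T] by auto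
next
  case (Suc n)
  show ?case
  proof (rule Ck_on_SucI[OF assms(1)])
    fix z assume z: "z \<in> D"
    have "((\<lambda>z. T (f z)) has_derivative (\<lambda>h. T (Re h *\<^sub>R dx f z + Im h *\<^sub>R dy f z))) (at z)"
      using Suc.prems z by (intro bounded_linear.has_derivative[OF T] has_derivative_dx_dy) auto
    then show "((\<lambda>z. T (f z)) has_derivative (\<lambda>h. Re h *\<^sub>R T (dx f z) + Im h *\<^sub>R T (dy f z))) (at z)"
      using T by (simp add: linear_add linear_scale bounded_linear.linear)
  qed (use Suc in auto)
qed

lemma Ck_on_add:
  assumes "open D" "Ck_on n D f" "Ck_on n D g"
  shows "Ck_on n D (\<lambda>z. f z + g z)"
  using assms(2,3)
proof (induction n arbitrary: f g)
  case (Suc n)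
  show ?case
  proof (rule Ck_on_SucI[OF assms(1)])
    fix z assume z: "z \<in> D"
    have "((\<lambda>z. f z + g z) has_derivative
      (\<lambda>h. Re h *\<^sub>R dx f z + Im h *\<^sub>R dy f z + (Re h *\<^sub>R dx g z + Im h *\<^sub>R dy g z))) (at z)"
      using Suc.prems z by (intro has_derivative_add has_derivative_dx_dy) auto
    then show "((\<lambda>z. f z + g z) has_derivative
      (\<lambda>h. Re h *\<^sub>R (dx f z + dx g z) + Im h *\<^sub>R (dy f z + dy g z))) (at z)"
      by (simp add: algebra_simps)
  qed (use Suc in auto)
qed (auto intro: continuous_intros)

lemma Ck_on_bilinear:
  assumes "open D" and T: "bounded_bilinear T" and "Ck_on n D f" "Ck_on n D g"
  shows "Ck_on n D (\<lambda>z. T (f z) (g z))"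
  using assms(3,4)
proof (induction n arbitrary: f g)
  case 0
  then show ?case using bounded_bilinear.continuous_on[OF T] by auto
next
  case (Suc n)
  interpret T: bounded_bilinear T by (rule T)
  have fg: "Ck_on n D f" "Ck_on n D g" using Suc.prems Ck_on_Suc_imp by blast+
  show ?case
  proof (rule Ck_on_SucI[OF assms(1)])
    fix z assume z: "z \<in> D"
    have "((\<lambda>z. T (f z) (g z)) has_derivative
      (\<lambda>h. T (f z) (Re h *\<^sub>R dx g z + Im h *\<^sub>R dy g z) + T (Re h *\<^sub>R dx f z + Im h *\<^sub>R dy f z) (g z))) (at z)"
      using Suc.prems z by (intro T.FDERIV has_derivative_dx_dy) auto
    then show "((\<lambda>z. T (f z) (g z)) has_derivative
      (\<lambda>h. Re h *\<^sub>R (T (f z) (dx g z) + T (dx f z) (g z)) + Im h *\<^sub>R (T (f z) (dy g z) + T (dy f z) (g z)))) (at z)"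
      by (simp add: T.add_left T.add_right T.scaleR_left T.scaleR_right algebra_simps)
  qed (use Suc fg in \<open>auto intro!: Ck_on_add[OF assms(1)]\<close>)
qed

lemma Ck_on_exp:
  fixes f :: "complex \<Rightarrow> 'b::{real_normed_field,banach}"
  assumes "open D" "Ck_on n D f"
  shows "Ck_on n D (\<lambda>z. exp (f z))"
  using assms(2)
proof (induction n arbitrary: f)
  case (Suc n)
  have e: "Ck_on n D (\<lambda>z. exp (f z))" by (rule Suc.IH[OF Ck_on_Suc_imp[OF Suc.prems]])
  show ?case
  proof (rule Ck_on_SucI[OF assms(1)])
    fix z assume z: "z \<in> D"
    have "((\<lambda>z. exp (f z)) has_derivative
      (\<lambda>h. exp (f z) * (Re h *\<^sub>R dx f z + Im h *\<^sub>R dy f z))) (at z)"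
      using Suc.prems z
      by (intro has_derivative_compose[OF has_derivative_dx_dy] DERIV_exp[unfolded has_field_derivative_def]) auto
    then show "((\<lambda>z. exp (f z)) has_derivative
      (\<lambda>h. Re h *\<^sub>R (exp (f z) * dx f z) + Im h *\<^sub>R (exp (f z) * dy f z))) (at z)"
      by (simp add: algebra_simps)
  qed (use Suc.prems in \<open>auto intro!: Ck_on_bilinear[OF assms(1) bounded_bilinear_mult e]\<close>)
qed (auto intro: continuous_intros)

lemma Ck_on_holomorphic:
  assumes "open D" "f holomorphic_on D"
  shows "Ck_on n D f"
  using assms(2)
proof (induction n arbitrary: f)
  case 0
  then show ?case by (simp add: holomorphic_on_imp_continuous_on)
next
  case (Suc n)
  have d: "deriv f holomorphic_on D" by (rule holomorphic_deriv[OF Suc.prems assms(1)])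
  show ?case
  proof (rule Ck_on_SucI[OF assms(1)])
    fix z assume "z \<in> D"
    then have "(f has_field_derivative deriv f z) (at z)"
      using Suc.prems assms(1) holomorphic_derivI by blast
    moreover have "(*) (deriv f z) = (\<lambda>h. Re h *\<^sub>R deriv f z + Im h *\<^sub>R (\<i> * deriv f z))"
      by (auto simp: fun_eq_iff complex_eq_iff)
    ultimately show "(f has_derivative (\<lambda>h. Re h *\<^sub>R deriv f z + Im h *\<^sub>R (\<i> * deriv f z))) (at z)"
      by (simp only: has_field_derivative_def)
  qed (use Suc.IH d in \<open>auto intro!: holomorphic_intros\<close>)
qed

text \<open>A continuous logarithm is locally the principal one up to a constant.\<close>

lemma has_derivative_continuous_log:
  fixes f G :: "complex \<Rightarrow> complex"
  assumes "open D" "z \<in> D" "continuous_on D G" and G: "\<And>w. w \<in> D \<Longrightarrow> exp (G w) = f w"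
    and f: "(f has_derivative f') (at z)"
  shows "(G has_derivative (\<lambda>h. exp (- G z) * f' h)) (at z)"
proof -
  have fz: "f z * exp (- G z) = 1"
    unfolding G[OF assms(2), symmetric] by (simp flip: exp_add)
  have "isCont G z" using assms by (simp add: continuous_on_eq_continuous_at)
  then have "\<forall>\<^sub>F w in at z. dist (G w) (G z) < pi"
    by (simp add: isCont_def tendsto_iff)
  then have "\<forall>\<^sub>F w in at z. dist (G w) (G z) < pi \<and> w \<in> D"
    using eventually_at_in_open'[OF assms(1,2)] by eventually_elim simp
  then have ev: "\<forall>\<^sub>F w in nhds z. G z + Ln (f w * exp (- G z)) = G w"
    unfolding eventually_at_filter
  proof eventually_elim
    case (elim w)
    show ?case
    proof (cases "w = z")
      case True
      then show ?thesis by (simp add: fz)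
    next
      case False
      have "\<bar>Im (G w - G z)\<bar> < pi"
        using abs_Im_le_cmod[of "G w - G z"] elim False by (simp add: dist_norm)
      then have "Ln (exp (G w - G z)) = G w - G z" by (intro Ln_exp) auto
      moreover have "f w * exp (- G z) = exp (G w - G z)"
        using G[of w] elim False by (simp add: exp_diff exp_minus field_simps)
      ultimately show ?thesis by simp
    qed
  qed
  have "(Ln has_derivative (\<lambda>h. 1 * h)) (at (f z * exp (- G z)))"
    unfolding fz by (rule has_field_derivative_imp_has_derivative) (rule derivative_eq_intros refl | simp)+
  moreover have "((\<lambda>w. f w * exp (- G z)) has_derivative (\<lambda>h. f' h * exp (- G z))) (at z)"
    by (rule has_derivative_mult_left[OF f])
  ultimately have "((\<lambda>w. Ln (f w * exp (- G z))) has_derivative (\<lambda>h. 1 * (f' h * exp (- G z)))) (at z)"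
    by (rule has_derivative_compose[rotated])
  then have "((\<lambda>w. G z + Ln (f w * exp (- G z))) has_derivative (\<lambda>h. exp (- G z) * f' h)) (at z)"
    by (auto intro!: derivative_eq_intros simp: mult.commute)
  moreover have "\<forall>\<^sub>F w in at z. G z + Ln (f w * exp (- G z)) = G w"
    using ev by (simp add: eventually_at_filter eventually_mono)
  ultimately show ?thesis
    using eventually_nhds_x_imp_x[OF ev] by (rule has_derivative_transform_eventually) simp
qed

lemma Ck_on_continuous_log:
  fixes f G :: "complex \<Rightarrow> complex"
  assumes "open D" "continuous_on D G" "\<And>w. w \<in> D \<Longrightarrow> exp (G w) = f w" and f: "\<And>n. Ck_on n D f"
  shows "Ck_on n D G"
proof (induction n)
  case (Suc n)
  have f1: "Ck_on (Suc n) D f" by (rule f)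
  have e: "Ck_on n D (\<lambda>z. exp (- G z))"
    by (intro Ck_on_exp assms(1) Ck_on_bounded_linear[OF assms(1) bounded_linear_minus] Suc bounded_linear_ident)
  show ?case
  proof (rule Ck_on_SucI[OF assms(1)])
    fix z assume z: "z \<in> D"
    have "(f has_derivative (\<lambda>h. Re h *\<^sub>R dx f z + Im h *\<^sub>R dy f z)) (at z)"
      using f1 z by (intro has_derivative_dx_dy) auto
    from has_derivative_continuous_log[OF assms(1) z assms(2,3) this]
    show "(G has_derivative (\<lambda>h. Re h *\<^sub>R (exp (- G z) * dx f z) + Im h *\<^sub>R (exp (- G z) * dy f z))) (at z)"
      by (simp add: algebra_simps)
  qed (use f1 in \<open>auto intro!: Ck_on_bilinear[OF assms(1) bounded_bilinear_mult e]\<close>)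
qed (simp add: assms)


lemma bounded_bilinear_mat2_mult: "bounded_bilinear ((**) :: mat2 \<Rightarrow> mat2 \<Rightarrow> mat2)"
proof -
  have "bilinear ((**) :: mat2 \<Rightarrow> mat2 \<Rightarrow> mat2)"
    unfolding bilinear_def
    by (intro conjI allI linearI) (simp_all add: vec_eq_iff algebra_simps)
  then show ?thesis by (simp add: bilinear_conv_bounded_bilinear)
qed

lemma bounded_bilinear_cscale: "bounded_bilinear cscale"
proof -
  have "bilinear cscale"
    unfolding bilinear_def
    by (intro conjI allI linearI) (simp_all add: vec_eq_iff algebra_simps)
  then show ?thesis by (simp add: bilinear_conv_bounded_bilinear)
qed

lemma bounded_linear_hconj: "bounded_linear hconj"
proof -
  have "linear hconj" by (intro linearI) (simp_all add: vec_eq_iff)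
  then show ?thesis by (simp add: linear_conv_bounded_linear)
qed

lemma bounded_linear_mat2_nth: "bounded_linear (\<lambda>A :: mat2. A $ i $ j)"
  by (intro bounded_linear_compose[OF bounded_linear_vec_nth] bounded_linear_vec_nth)


section \<open>Differentiable families of loops\<close>

lemma norm_fourier_coeff_le: "wiener f \<Longrightarrow> norm (fourier_coeff f k) \<le> wiener_norm f"
  unfolding wiener_def wiener_norm_def
  using finite_sum_le_infsum[of "\<lambda>k. norm (fourier_coeff f k)" UNIV "{k}"] by simp

lemma norm_wiener_le:
  assumes "wiener f" "norm l = 1"
  shows "norm (f l) \<le> wiener_norm f"
proof -
  have s: "(\<lambda>k. norm (fourier_coeff f k * l powi k)) summable_on UNIV"
    using assms by (simp add: wiener_def norm_mult norm_powi_circle)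
  have "f l = (\<Sum>\<^sub>\<infinity>k. fourier_coeff f k * l powi k)"
    using assms by (intro infsumI[symmetric]) (simp add: wiener_def)
  also have "norm \<dots> \<le> (\<Sum>\<^sub>\<infinity>k. norm (fourier_coeff f k * l powi k))"
    by (rule norm_infsum_bound[OF s])
  finally show ?thesis using assms by (simp add: wiener_norm_def norm_mult norm_powi_circle)
qed

lemma norm_loop_coeff_le: "wiener_loop g \<Longrightarrow> norm (loop_coeff g k) \<le> loop_norm g"
  unfolding loop_norm_def wiener_loop_def
  by (rule order_trans[OF norm_mat2_le]) (auto simp: loop_coeff_def intro!: sum_mono norm_fourier_coeff_le)

lemma norm_loop_le: "wiener_loop g \<Longrightarrow> norm l = 1 \<Longrightarrow> norm (g l) \<le> loop_norm g"
  unfolding loop_norm_def wiener_loop_def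
  by (rule order_trans[OF norm_mat2_le]) (auto intro!: sum_mono norm_wiener_le)

lemma loop_series_scaleR:
  assumes "loop_series g A"
  shows "loop_series (\<lambda>l. a *\<^sub>R g l) (\<lambda>k. a *\<^sub>R A k)"
proof -
  have "cscale (of_real a) M = a *\<^sub>R M" for M
    by (simp add: vec_eq_iff complex_eq_iff)
  then show ?thesis using loop_series_cscale[OF assms, of "of_real a"] by simp
qed

text \<open>The remainders in the definition of differentiability lie in the Wiener space, where the norm
  controls values and coefficients.\<close>

lemma loop_series_remainder:
  assumes "wiener_loop F" "wiener_loop A" "wiener_loop X" "wiener_loop Y"
  shows "loop_series (\<lambda>l. F l - A l - a *\<^sub>R X l - b *\<^sub>R Y l)
    (\<lambda>k. loop_coeff F k - loop_coeff A k - a *\<^sub>R loop_coeff X k - b *\<^sub>R loop_coeff Y k)"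
  by (intro loop_series_diff loop_series_scaleR wiener_loop_series assms)

text \<open>Evaluation at a point of the circle and the Fourier coefficients are bounded linear
  functionals for the Wiener norm, so that they commute with differentiation of loops.\<close>

lemma loop_functional_has_derivative:
  fixes T :: "(complex \<Rightarrow> mat2) \<Rightarrow> 'b::real_normed_vector"
  assumes lin: "\<And>F A X Y a b. wiener_loop F \<Longrightarrow> wiener_loop A \<Longrightarrow> wiener_loop X \<Longrightarrow> wiener_loop Y \<Longrightarrow>
      T (\<lambda>l. F l - A l - a *\<^sub>R X l - b *\<^sub>R Y l) = T F - T A - a *\<^sub>R T X - b *\<^sub>R T Y"
    and bound: "\<And>g. wiener_loop g \<Longrightarrow> norm (T g) \<le> loop_norm g"
    and D: "open D" "z \<in> D" and F: "\<And>w. w \<in> D \<Longrightarrow> wiener_loop (F w)"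
    and X: "wiener_loop X" "wiener_loop Y"
    and lim: "((\<lambda>h. loop_norm (\<lambda>l. F (z + h) l - F z l - Re h *\<^sub>R X l - Im h *\<^sub>R Y l) / norm h) \<longlongrightarrow> 0) (at 0)"
  shows "((\<lambda>w. T (F w)) has_derivative (\<lambda>h. Re h *\<^sub>R T X + Im h *\<^sub>R T Y)) (at z)"
  unfolding has_derivative_at
proof
  show "bounded_linear (\<lambda>h. Re h *\<^sub>R T X + Im h *\<^sub>R T Y)"
    by (intro bounded_linear_add bounded_linear_scaleR_const bounded_linear_Re bounded_linear_Im)
  have "\<forall>\<^sub>F w in at z. w \<in> D" using D by (simp add: eventually_at_in_open')
  then have "\<forall>\<^sub>F h in at 0. z + h \<in> D" by (simp add: eventually_at_to_0[of _ z] add.commute)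
  then have "\<forall>\<^sub>F h in at 0. norm (norm (T (F (z + h)) - T (F z) - (Re h *\<^sub>R T X + Im h *\<^sub>R T Y)) / norm h) \<le>
      loop_norm (\<lambda>l. F (z + h) l - F z l - Re h *\<^sub>R X l - Im h *\<^sub>R Y l) / norm h"
  proof eventually_elim
    case (elim h)
    have w: "wiener_loop (\<lambda>l. F (z + h) l - F z l - Re h *\<^sub>R X l - Im h *\<^sub>R Y l)"
      by (rule loop_series_wiener[OF loop_series_remainder]) (use F D X elim in auto)
    have "T (F (z + h)) - T (F z) - (Re h *\<^sub>R T X + Im h *\<^sub>R T Y) =
        T (\<lambda>l. F (z + h) l - F z l - Re h *\<^sub>R X l - Im h *\<^sub>R Y l)"
      by (subst lin) (use F D X elim in auto)
    then show ?case using bound[OF w] by (simp add: divide_right_mono)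
  qed
  then show "(\<lambda>h. norm (T (F (z + h)) - T (F z) - (Re h *\<^sub>R T X + Im h *\<^sub>R T Y)) / norm h) \<midarrow>0\<rightarrow> 0"
    by (rule Lim_null_comparison) (rule lim)
qed

lemma loop_coeff_has_derivative:
  assumes "open D" "z \<in> D" "\<And>w. w \<in> D \<Longrightarrow> wiener_loop (F w)" "wiener_loop X" "wiener_loop Y"
    "((\<lambda>h. loop_norm (\<lambda>l. F (z + h) l - F z l - Re h *\<^sub>R X l - Im h *\<^sub>R Y l) / norm h) \<longlongrightarrow> 0) (at 0)"
  shows "((\<lambda>w. loop_coeff (F w) k) has_derivative
    (\<lambda>h. Re h *\<^sub>R loop_coeff X k + Im h *\<^sub>R loop_coeff Y k)) (at z)"
  by (rule loop_functional_has_derivative[OF _ norm_loop_coeff_le assms])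
    (rule loop_coeff_series[OF loop_series_remainder])

lemma loop_eval_has_derivative:
  assumes "open D" "z \<in> D" "\<And>w. w \<in> D \<Longrightarrow> wiener_loop (F w)" "wiener_loop X" "wiener_loop Y"
    "((\<lambda>h. loop_norm (\<lambda>l. F (z + h) l - F z l - Re h *\<^sub>R X l - Im h *\<^sub>R Y l) / norm h) \<longlongrightarrow> 0) (at 0)"
    and "norm l = 1"
  shows "((\<lambda>w. F w l) has_derivative (\<lambda>h. Re h *\<^sub>R X l + Im h *\<^sub>R Y l)) (at z)"
  by (rule loop_functional_has_derivative[OF _ norm_loop_le assms(1-6)]) (simp_all add: assms)

lemma loop_Ck_on_wiener: "loop_Ck_on n D F \<Longrightarrow> z \<in> D \<Longrightarrow> wiener_loop (F z)"
  by (cases n) auto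

lemma Ck_on_loop_coeff:
  assumes "open D" "loop_Ck_on n D F"
  shows "Ck_on n D (\<lambda>z. loop_coeff (F z) k)"
  using assms(2)
proof (induction n arbitrary: F)
  case 0
  have "isCont (\<lambda>z. loop_coeff (F z) k) z" if z: "z \<in> D" for z
  proof -
    have "\<forall>\<^sub>F y in at z. y \<in> D" using z assms(1) by (simp add: eventually_at_in_open')
    then have "\<forall>\<^sub>F y in at z. norm (loop_coeff (F y) k - loop_coeff (F z) k) \<le> loop_norm (\<lambda>l. F y l - F z l)"
    proof eventually_elim
      case (elim y)
      have s: "loop_series (\<lambda>l. F y l - F z l) (\<lambda>k. loop_coeff (F y) k - loop_coeff (F z) k)"
        using elim z 0 by (intro loop_series_diff wiener_loop_series) auto
      show ?case using norm_loop_coeff_le[OF loop_series_wiener[OF s], of k] by (simp add: loop_coeff_series[OF s])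
    qed
    moreover have "((\<lambda>y. loop_norm (\<lambda>l. F y l - F z l)) \<longlongrightarrow> 0) (at z)" using 0 z by simp
    ultimately have "((\<lambda>y. loop_coeff (F y) k - loop_coeff (F z) k) \<longlongrightarrow> 0) (at z)"
      by (rule Lim_null_comparison)
    then show ?thesis by (simp add: isCont_def LIM_zero_cancel)
  qed
  then show ?case by (simp add: continuous_at_imp_continuous_on)
next
  case (Suc n)
  then obtain Fx Fy where F: "loop_Ck_on n D Fx" "loop_Ck_on n D Fy"
    "\<And>z. z \<in> D \<Longrightarrow> ((\<lambda>h. loop_norm (\<lambda>l. F (z + h) l - F z l - Re h *\<^sub>R Fx z l - Im h *\<^sub>R Fy z l) / norm h) \<longlongrightarrow> 0) (at 0)"
    by auto
  show ?case
  proof (rule Ck_on_SucI[OF assms(1)])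
    fix z assume z: "z \<in> D"
    show "((\<lambda>z. loop_coeff (F z) k) has_derivative
        (\<lambda>h. Re h *\<^sub>R loop_coeff (Fx z) k + Im h *\<^sub>R loop_coeff (Fy z) k)) (at z)"
      by (rule loop_coeff_has_derivative[OF assms(1) z]) (use Suc.prems F z loop_Ck_on_wiener in auto)
  qed (use F Suc.IH in auto)
qed

section \<open>Three-term systems and their Laurent series\<close>

text \<open>The weights \<open>R ^ min N \<bar>k\<bar>\<close> are bounded, so that the weighted norms have some bound \<open>T\<close>, and they change
  at most by the factor \<open>R\<close> between neighbours. The mean value theorem on a small set improves the bound
  \<open>T\<close> to \<open>A + T / 2\<close>; iteration leads to the fixed point \<open>2 A\<close>, which does not depend on \<open>N\<close>.\<close>

lemma three_term_decay_convex:
  fixes X :: "int \<Rightarrow> 'a::real_normed_vector \<Rightarrow> 'b::real_normed_vector"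
  assumes S: "convex S" "p \<in> S" "z \<in> S"
    and der: "\<And>k y. y \<in> S \<Longrightarrow> (X k has_derivative X' k y) (at y within S)"
    and der_bound: "\<And>k y h. y \<in> S \<Longrightarrow>
      norm (X' k y h) \<le> M * norm h * (norm (X (k - 1) y) + norm (X k y) + norm (X (k + 1) y))"
    and bounded: "\<And>k y. y \<in> S \<Longrightarrow> norm (X k y) \<le> B"
    and R: "R \<ge> 1" and M: "M \<ge> 0"
    and diam: "\<And>y. y \<in> S \<Longrightarrow> norm (y - p) \<le> d" and small: "6 * M * R * d \<le> 1"
    and start: "\<And>k. R ^ nat \<bar>k\<bar> * norm (X k p) \<le> A"
  shows "R ^ nat \<bar>k\<bar> * norm (X k z) \<le> 2 * A"
proof -
  define N where "N = nat \<bar>k\<bar>"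
  \<comment> \<open>The weight is \<open>R ^ \<bar>k\<bar>\<close> at the index of interest.\<close>
  define w where "w = (\<lambda>k :: int. R ^ min N (nat \<bar>k\<bar>))"
  have w1: "w j \<ge> 1" for j using R by (simp add: w_def)
  have w_step: "w j \<le> R * w (j + i)" if "\<bar>i\<bar> \<le> 1" for i j
  proof -
    have "w j \<le> R ^ Suc (min N (nat \<bar>j + i\<bar>))"
      unfolding w_def using R that by (intro power_increasing) auto
    then show ?thesis by (simp add: w_def)
  qed
  have d: "d \<ge> 0" using diam[OF S(2)] by simp
  have B: "B \<ge> 0" using bounded[OF S(2)] norm_ge_zero order_trans by blast
  have improve: "w j * norm (X j y) \<le> A + T / 2"
    if T: "\<And>j y. y \<in> S \<Longrightarrow> w j * norm (X j y) \<le> T" and y: "y \<in> S" for T j y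
  proof -
    have "0 \<le> w 0 * norm (X 0 p)" using w1[of 0] by simp
    then have T0: "T \<ge> 0" using T[OF S(2), of 0] by linarith
    have wX: "w j * norm (X (j + i) x) \<le> R * T" if "x \<in> S" "\<bar>i\<bar> \<le> 1" for x i
    proof -
      have "w j * norm (X (j + i) x) \<le> R * w (j + i) * norm (X (j + i) x)"
        using w_step[OF that(2)] by (intro mult_right_mono) auto
      also have "\<dots> \<le> R * T" using T[OF that(1), of "j + i"] R by (simp add: mult.assoc mult_left_mono)
      finally show ?thesis .
    qed
    have on: "onorm (X' j x) \<le> 3 * M * R * T / w j" if x: "x \<in> S" for x
    proof (rule onorm_bound)
      show "0 \<le> 3 * M * R * T / w j" using M R T0 w1[of j] by simp
      fix h
      have "w j * norm (X' j x h) \<le> w j * (M * norm h * (norm (X (j - 1) x) + norm (X j x) + norm (X (j + 1) x)))"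
        using der_bound[OF x] w1[of j] by (intro mult_left_mono) auto
      also have "\<dots> = M * norm h * (w j * norm (X (j + - 1) x) + w j * norm (X (j + 0) x) + w j * norm (X (j + 1) x))"
        by (simp add: algebra_simps)
      also have "\<dots> \<le> M * norm h * (R * T + R * T + R * T)"
        using M by (intro mult_left_mono add_mono wX x) auto
      finally have "w j * norm (X' j x h) \<le> M * norm h * (3 * R * T)" by simp
      then show "norm (X' j x h) \<le> 3 * M * R * T / w j * norm h"
        using w1[of j] by (simp add: field_simps)
    qed
    have "norm (X j y - X j p) \<le> 3 * M * R * T / w j * norm (y - p)"
      by (rule differentiable_bound[OF S(1) der on y S(2)])
    also have "\<dots> \<le> 3 * M * R * T / w j * d"
      using M R T0 w1[of j] diam[OF y] by (intro mult_left_mono) auto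
    finally have "norm (X j y) - norm (X j p) \<le> 3 * M * R * T / w j * d"
      using norm_triangle_ineq2[of "X j y" "X j p"] by linarith
    then have "w j * norm (X j y) \<le> w j * norm (X j p) + (6 * M * R * d) * T / 2"
      using w1[of j] by (simp add: field_simps)
    moreover have "(6 * M * R * d) * T \<le> 1 * T" by (rule mult_right_mono[OF small T0])
    moreover have "w j * norm (X j p) \<le> A"
    proof -
      have "w j \<le> R ^ nat \<bar>j\<bar>" unfolding w_def using R by (intro power_increasing) auto
      then have "w j * norm (X j p) \<le> R ^ nat \<bar>j\<bar> * norm (X j p)" by (intro mult_right_mono) auto
      then show ?thesis using start[of j] by linarith
    qed
    ultimately show ?thesis by linarith
  qed
  have A: "A \<ge> 0" using order_trans[OF norm_ge_zero, of "X 0 p" A] start[of 0] by simp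
  have iter: "w j * norm (X j y) \<le> 2 * A + R ^ N * B / 2 ^ n" if "y \<in> S" for j y n
    using that
  proof (induction n arbitrary: j y)
    case 0
    have "w j \<le> R ^ N" unfolding w_def using R by (intro power_increasing) auto
    then have "w j * norm (X j y) \<le> R ^ N * B" using bounded[OF 0] R by (intro mult_mono) auto
    then show ?case using A by simp
  next
    case (Suc n)
    have "w j * norm (X j y) \<le> A + (2 * A + R ^ N * B / 2 ^ n) / 2"
      by (rule improve[OF Suc.IH Suc.prems])
    then show ?case by (simp add: field_simps)
  qed
  have "(\<lambda>n. 2 * A + R ^ N * B * (1 / 2) ^ n) \<longlonglongrightarrow> 2 * A + R ^ N * B * 0"
    by (intro tendsto_intros LIMSEQ_power_zero) simp
  then have "w k * norm (X k z) \<le> 2 * A"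
    using iter[OF S(3)] by (intro LIMSEQ_le_const[where X = "\<lambda>n. 2 * A + R ^ N * B * (1 / 2) ^ n"])
      (auto simp: power_one_over)
  then show ?thesis by (simp add: w_def N_def)
qed

text \<open>Along a connected domain the decay is therefore inherited from the base point, at every rate.\<close>

lemma three_term_decay:
  fixes X :: "int \<Rightarrow> 'a::euclidean_space \<Rightarrow> 'b::real_normed_vector"
  assumes D: "open D" "connected D" "z0 \<in> D"
    and der: "\<And>k z. z \<in> D \<Longrightarrow> (X k has_derivative X' k z) (at z)"
    and der_bound: "\<And>k z h. z \<in> D \<Longrightarrow>
      norm (X' k z h) \<le> m z * norm h * (norm (X (k - 1) z) + norm (X k z) + norm (X (k + 1) z))"
    and m: "continuous_on D m"
    and bounded: "\<And>k z. z \<in> D \<Longrightarrow> norm (X k z) \<le> B"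
    and start: "\<And>k. k \<noteq> 0 \<Longrightarrow> X k z0 = 0"
    and R: "R \<ge> 1" and q: "q \<in> D"
  obtains r A where "r > 0" "cball q r \<subseteq> D" "\<And>z k. z \<in> cball q r \<Longrightarrow> R ^ nat \<bar>k\<bar> * norm (X k z) \<le> A"
proof -
  define decay where "decay = (\<lambda>p A. \<forall>k. R ^ nat \<bar>k\<bar> * norm (X k p) \<le> A)"
  have local: "\<exists>r>0. cball a r \<subseteq> D \<and> (\<forall>p\<in>cball a r. \<forall>A. decay p A \<longrightarrow> (\<forall>z\<in>cball a r. decay z (2 * A)))"
    if a: "a \<in> D" for a
  proof -
    obtain r0 where r0: "r0 > 0" "cball a r0 \<subseteq> D" using D(1) a open_contains_cball by blast
    have "compact (m ` cball a r0)"
      by (intro compact_continuous_image continuous_on_subset[OF m] r0 compact_cball)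
    then have "bounded (m ` cball a r0)" by (rule compact_imp_bounded)
    then obtain M where M: "M > 0" "\<And>y. y \<in> cball a r0 \<Longrightarrow> norm (m y) \<le> M"
      unfolding bounded_pos by blast
    \<comment> \<open>Two points of the ball have distance at most \<open>2 r\<close>, which has to satisfy \<open>6 M R (2 r) \<le> 1\<close>.\<close>
    define r where "r = min r0 (1 / (12 * M * R))"
    have MR: "12 * M * R > 0" using M(1) R by simp
    have r: "r > 0" using r0 MR by (simp add: r_def)
    have sub: "cball a r \<subseteq> cball a r0" by (simp add: r_def subset_cball)
    have small: "6 * M * R * (2 * r) \<le> 1"
    proof -
      have "12 * M * R * r \<le> 12 * M * R * (1 / (12 * M * R))"
        using MR by (intro mult_left_mono) (auto simp: r_def)
      also have "\<dots> = 1" using M(1) R by simp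
      finally show ?thesis by simp
    qed
    have "R ^ nat \<bar>k\<bar> * norm (X k z) \<le> 2 * A"
      if p: "p \<in> cball a r" and z: "z \<in> cball a r" and A: "decay p A" for p z A k
    proof (rule three_term_decay_convex[where S = "cball a r" and M = M and d = "2 * r" and p = p and z = z and
          X = X and X' = X' and R = R and B = B and A = A and k = k, OF convex_cball p z])
      fix y j h assume y: "y \<in> cball a r"
      then have yD: "y \<in> D" and ym: "m y \<le> M" using sub r0 M(2)[of y] by auto
      show "(X j has_derivative X' j y) (at y within cball a r)"
        by (rule has_derivative_at_withinI[OF der[OF yD]])
      show "norm (X' j y h) \<le> M * norm h * (norm (X (j - 1) y) + norm (X j y) + norm (X (j + 1) y))"
        by (rule order_trans[OF der_bound[OF yD]]) (intro mult_right_mono ym, auto)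
      show "norm (X j y) \<le> B" by (rule bounded[OF yD])
      show "norm (y - p) \<le> 2 * r"
        using y p dist_triangle[of y p a] by (simp add: dist_norm norm_minus_commute)
    qed (use R M small A in \<open>auto simp: decay_def\<close>)
    then have "\<forall>p\<in>cball a r. \<forall>A. decay p A \<longrightarrow> (\<forall>z\<in>cball a r. decay z (2 * A))"
      by (simp only: decay_def) blast
    then show ?thesis using r sub r0(2) by blast
  qed
  have "\<exists>A. decay q A"
  proof (rule connected_induction_simple[OF D(2,3) q, where P = "\<lambda>z. \<exists>A. decay z A"])
    have "R ^ nat \<bar>k\<bar> * norm (X k z0) \<le> norm (X 0 z0)" for k using start[of k] by (cases "k = 0") auto
    then show "\<exists>A. decay z0 A" unfolding decay_def by blast
    fix a assume "a \<in> D"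
    then obtain r where r: "r > 0" "cball a r \<subseteq> D"
      "\<forall>p\<in>cball a r. \<forall>A. decay p A \<longrightarrow> (\<forall>z\<in>cball a r. decay z (2 * A))"
      using local by blast
    have "openin (top_of_set D) (ball a r)"
      using r(2) ball_subset_cball[of a r] by (intro open_subset) auto
    moreover have "a \<in> ball a r" using r(1) by simp
    moreover have "\<forall>x\<in>ball a r. \<forall>y\<in>ball a r. (\<exists>A. decay x A) \<longrightarrow> (\<exists>A. decay y A)"
      using r(3) ball_subset_cball[of a r] by blast
    ultimately show "\<exists>T. openin (top_of_set D) T \<and> a \<in> T \<and>
        (\<forall>x\<in>T. \<forall>y\<in>T. (\<exists>A. decay x A) \<longrightarrow> (\<exists>A. decay y A))"
      by blast
  qed
  then obtain A where A: "decay q A" by blast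
  obtain r where r: "r > 0" "cball q r \<subseteq> D"
    "\<forall>p\<in>cball q r. \<forall>A. decay p A \<longrightarrow> (\<forall>z\<in>cball q r. decay z (2 * A))"
    using local[OF q] by blast
  have "q \<in> cball q r" using r(1) by simp
  with r(3) A have "\<forall>z\<in>cball q r. decay z (2 * A)" by blast
  then show ?thesis using r(1,2) by (intro that[of r "2 * A"]) (auto simp: decay_def)
qed

lemma summable_on_power_abs_int:
  fixes c :: real
  assumes "0 \<le> c" "c < 1"
  shows "(\<lambda>k :: int. c ^ nat \<bar>k\<bar>) summable_on UNIV"
proof -
  have g: "(\<lambda>n :: nat. c ^ n) summable_on UNIV"
    using assms by (intro norm_summable_imp_summable_on) simp
  have inj: "inj_on (\<lambda>n :: nat. int n) UNIV" "inj_on (\<lambda>n :: nat. - int n) UNIV"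
    by (auto intro: inj_onI)
  have "(\<lambda>k :: int. c ^ nat \<bar>k\<bar>) summable_on range (\<lambda>n :: nat. int n)"
    by (subst summable_on_reindex[OF inj(1)]) (use g in \<open>simp add: o_def\<close>)
  moreover have "(\<lambda>k :: int. c ^ nat \<bar>k\<bar>) summable_on range (\<lambda>n :: nat. - int n)"
    by (subst summable_on_reindex[OF inj(2)]) (use g in \<open>simp add: o_def\<close>)
  ultimately have "(\<lambda>k :: int. c ^ nat \<bar>k\<bar>) summable_on (range (\<lambda>n :: nat. int n) \<union> range (\<lambda>n :: nat. - int n))"
    by (rule summable_on_union)
  moreover have "range (\<lambda>n :: nat. int n) \<union> range (\<lambda>n :: nat. - int n) = UNIV"
  proof -
    have "k \<in> range (\<lambda>n :: nat. int n) \<union> range (\<lambda>n :: nat. - int n)" for k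
    proof (cases "k \<ge> 0")
      case True
      then have "k = int (nat k)" by simp
      then show ?thesis by blast
    next
      case False
      then have "k = - int (nat (- k))" by simp
      then show ?thesis by blast
    qed
    then show ?thesis by blast
  qed
  ultimately show ?thesis by simp
qed

text \<open>Termwise differentiation under a summable majorant of the derivatives; the integers are enumerated
  in order to pass to ordinary series.\<close>

lemma has_derivative_has_sum_int:
  fixes f :: "int \<Rightarrow> 'a::real_normed_vector \<Rightarrow> 'b::banach"
  assumes S: "convex S" "open S" "x \<in> S"
    and der: "\<And>k y. y \<in> S \<Longrightarrow> (f k has_derivative f' k y) (at y within S)"
    and bound: "\<And>k y h. y \<in> S \<Longrightarrow> norm (f' k y h) \<le> M k * norm h"
    and M: "M summable_on UNIV"
    and F: "\<And>y. y \<in> S \<Longrightarrow> ((\<lambda>k. f k y) has_sum F y) UNIV"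
    and F': "\<And>y h. y \<in> S \<Longrightarrow> ((\<lambda>k. f' k y h) has_sum F' y h) UNIV"
  shows "(F has_derivative F' x) (at x)"
proof -
  let ?d = int_decode
  have sums: "(\<lambda>n. g (?d n)) sums s" if "(g has_sum s) UNIV" for g :: "int \<Rightarrow> 'c::{topological_comm_monoid_add,t2_space}" and s
    using that by (intro has_sum_imp_sums) (subst has_sum_reindex_bij_betw[OF bij_int_decode])
  have sM: "summable (\<lambda>n. M (?d n))"
    using sums[OF has_sum_infsum[OF M]] by (rule sums_summable)
  have unif: "\<forall>\<^sub>F n in sequentially. \<forall>y\<in>S. \<forall>h. norm (sum (\<lambda>i. f' (?d i) y h) {..<n} - F' y h) \<le> e * norm h"
    if e: "e > 0" for e
  proof -
    obtain N where N: "\<And>n. n \<ge> N \<Longrightarrow> norm (\<Sum>i. M (?d (i + n))) < e"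
      using suminf_exist_split[OF e sM] by blast
    have "norm (sum (\<lambda>i. f' (?d i) y h) {..<n} - F' y h) \<le> e * norm h" if n: "n \<ge> N" and y: "y \<in> S" for n y h
    proof -
      have s: "(\<lambda>i. f' (?d i) y h) sums F' y h" by (rule sums[OF F'[OF y]])
      have sMn: "summable (\<lambda>i. M (?d (i + n)) * norm h)"
        by (intro summable_mult2 summable_ignore_initial_segment sM)
      have "norm (\<Sum>i. f' (?d (i + n)) y h) \<le> (\<Sum>i. M (?d (i + n)) * norm h)"
      proof -
        have a: "summable (\<lambda>i. norm (f' (?d (i + n)) y h))"
          by (rule summable_comparison_test'[OF sMn, of 0]) (simp add: bound[OF y])
        have "norm (\<Sum>i. f' (?d (i + n)) y h) \<le> (\<Sum>i. norm (f' (?d (i + n)) y h))"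
          by (rule summable_norm[OF a])
        also have "\<dots> \<le> (\<Sum>i. M (?d (i + n)) * norm h)"
          by (rule suminf_le[OF _ a sMn]) (rule bound[OF y])
        finally show ?thesis .
      qed
      also have "\<dots> = (\<Sum>i. M (?d (i + n))) * norm h"
        by (intro suminf_mult2[symmetric] summable_ignore_initial_segment sM)
      also have "\<dots> \<le> e * norm h" using N[OF n] by (intro mult_right_mono) auto
      finally have "norm (\<Sum>i. f' (?d (i + n)) y h) \<le> e * norm h" .
      moreover have "(\<Sum>i. f' (?d (i + n)) y h) = F' y h - sum (\<lambda>i. f' (?d i) y h) {..<n}"
        using suminf_minus_initial_segment[OF sums_summable[OF s], of n] sums_unique[OF s] by simp
      ultimately show ?thesis by (simp add: norm_minus_commute)
    qed
    then show ?thesis by (auto simp: eventually_sequentially)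
  qed
  have "\<exists>g. \<forall>y\<in>S. (\<lambda>n. f (?d n) y) sums g y \<and> (g has_derivative F' y) (at y within S)"
    by (rule has_derivative_series[OF S(1) der unif S(3) sums[OF F[OF S(3)]]])
  then obtain g where g: "\<And>y. y \<in> S \<Longrightarrow> (\<lambda>n. f (?d n) y) sums g y"
    "(g has_derivative F' x) (at x within S)" using S(3) by blast
  have eq: "g y = F y" if "y \<in> S" for y
    using g(1)[OF that] sums[OF F[OF that]] by (rule sums_unique2)
  have "(g has_derivative F' x) (at x)" using g(2) unfolding at_within_open[OF S(3,2)] .
  then show ?thesis by (rule has_derivative_transform_within_open[OF _ S(2,3) eq])
qed

lemma norm_cscale_le: "norm (cscale c A) \<le> 4 * norm c * norm A"
proof -
  have "norm (cscale c A) \<le> (\<Sum>i\<in>UNIV. \<Sum>j\<in>UNIV. norm (cscale c A $ i $ j))" by (rule norm_mat2_le)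
  also have "\<dots> \<le> (\<Sum>i\<in>(UNIV :: 2 set). \<Sum>j\<in>(UNIV :: 2 set). norm c * norm A)"
    by (intro sum_mono) (simp add: norm_mult mult_left_mono norm_mat2_entry)
  also have "\<dots> = 4 * norm c * norm A" by simp
  finally show ?thesis .
qed

lemma power_abs_bound:
  fixes l :: complex
  assumes "norm l \<le> \<rho>" "norm (inverse l) \<le> \<rho>"
  shows "norm (l powi k) \<le> \<rho> ^ nat \<bar>k\<bar>"
proof (cases "k \<ge> 0")
  case True
  then show ?thesis using assms(1) by (simp add: power_int_def norm_power power_mono)
next
  case False
  then show ?thesis using assms(2) by (simp add: power_int_def norm_power power_mono flip: norm_inverse)
qed

lemma cscale_mult_left: "cscale c A ** B = cscale c (A ** B)"
  by (simp add: mat2_eq_iff algebra_simps)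

lemma cscale_cscale: "cscale c (cscale d A) = cscale (c * d) A"
  by (simp add: mat2_eq_iff)

text \<open>The hypothesis on the derivatives is the coefficientwise form of the linear system with connection
  form \<open>(\<lambda>\<^sup>-\<^sup>1 A + B) dz + (C + \<lambda> E) d(cnj z)\<close>. Shifting the index by one amounts to multiplication by
  \<open>\<lambda>\<close>, so the Laurent series solves the system wherever it can be differentiated termwise. Decay at
  every rate makes this possible for every \<open>\<lambda> \<noteq> 0\<close>.\<close>

lemma laurent_frame:
  fixes X :: "int \<Rightarrow> complex \<Rightarrow> mat2" and A B C E :: "complex \<Rightarrow> mat2"
  assumes D: "open D" "connected D" "z0 \<in> D"
    and der: "\<And>k z. z \<in> D \<Longrightarrow> (X k has_derivative
        (\<lambda>h. cscale h (X (k + 1) z ** A z + X k z ** B z) +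
             cscale (cnj h) (X k z ** C z + X (k - 1) z ** E z))) (at z)"
    and cont: "continuous_on D A" "continuous_on D B" "continuous_on D C" "continuous_on D E"
    and bounded: "\<And>k z. z \<in> D \<Longrightarrow> norm (X k z) \<le> K"
    and start: "\<And>k. k \<noteq> 0 \<Longrightarrow> X k z0 = 0"
  defines "\<Psi> \<equiv> \<lambda>z l. \<Sum>\<^sub>\<infinity>k. cscale (l powi k) (X k z)"
  shows "\<And>z l. z \<in> D \<Longrightarrow> l \<noteq> 0 \<Longrightarrow> ((\<lambda>k. cscale (l powi k) (X k z)) has_sum \<Psi> z l) UNIV"
    and "\<And>z i j. z \<in> D \<Longrightarrow> (\<lambda>l. \<Psi> z l $ i $ j) holomorphic_on - {0}"
    and "\<And>z l. z \<in> D \<Longrightarrow> l \<noteq> 0 \<Longrightarrow> ((\<lambda>z. \<Psi> z l) has_derivative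
        (\<lambda>h. \<Psi> z l ** (cscale h (cscale (inverse l) (A z) + B z) + cscale (cnj h) (C z + cscale l (E z))))) (at z)"
proof -
  define X' where "X' = (\<lambda>k z h. cscale h (X (k + 1) z ** A z + X k z ** B z) +
             cscale (cnj h) (X k z ** C z + X (k - 1) z ** E z))"
  have derX: "(X k has_derivative X' k z) (at z)" if "z \<in> D" for k z
    unfolding X'_def by (rule der[OF that])
  from bounded_bilinear.pos_bounded[OF bounded_bilinear_mat2_mult]
  obtain L where L: "L > 0" and L_all: "\<forall>(M :: mat2) (N :: mat2). norm (M ** N) \<le> norm M * norm N * L"
    by (elim exE conjE) (rule that)
  note L_le = L_all[THEN spec, THEN spec]
  define m where "m = (\<lambda>z. 4 * L * (norm (A z) + norm (B z) + norm (C z) + norm (E z)))"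
  have m_cont: "continuous_on D m" unfolding m_def by (intro continuous_intros cont)
  have X'_bound: "norm (X' k z h) \<le> m z * norm h * (norm (X (k - 1) z) + norm (X k z) + norm (X (k + 1) z))"
    for k z h
  proof -
    let ?a = "norm (A z)" and ?b = "norm (B z)" and ?c = "norm (C z)" and ?e = "norm (E z)"
    let ?x = "norm (X (k - 1) z)" and ?y = "norm (X k z)" and ?w = "norm (X (k + 1) z)"
    have "norm (X' k z h) \<le> norm (cscale h (X (k + 1) z ** A z + X k z ** B z)) +
        norm (cscale (cnj h) (X k z ** C z + X (k - 1) z ** E z))"
      unfolding X'_def by (rule norm_triangle_ineq)
    also have "\<dots> \<le> 4 * norm h * norm (X (k + 1) z ** A z + X k z ** B z) +
        4 * norm h * norm (X k z ** C z + X (k - 1) z ** E z)"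
      using norm_cscale_le[of h] norm_cscale_le[of "cnj h"] by (intro add_mono) auto
    also have "\<dots> \<le> 4 * norm h * (?w * ?a * L + ?y * ?b * L) + 4 * norm h * (?y * ?c * L + ?x * ?e * L)"
      by (intro add_mono mult_left_mono order_trans[OF norm_triangle_ineq] L_le) auto
    also have "\<dots> = 4 * norm h * L * (?w * ?a + ?y * ?b + ?y * ?c + ?x * ?e)" by (simp add: algebra_simps)
    also have "\<dots> \<le> 4 * norm h * L * ((?a + ?b + ?c + ?e) * (?x + ?y + ?w))"
    proof (intro mult_left_mono)
      have "0 \<le> ?a * (?x + ?y) + ?b * (?x + ?w) + ?c * (?x + ?w) + ?e * (?y + ?w)" by simp
      then show "?w * ?a + ?y * ?b + ?y * ?c + ?x * ?e \<le> (?a + ?b + ?c + ?e) * (?x + ?y + ?w)"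
        by (simp add: algebra_simps)
    qed (use L in auto)
    finally show ?thesis by (simp only: m_def mult_ac)
  qed
  have decay: "\<exists>r>0. \<exists>a. cball q r \<subseteq> D \<and> (\<forall>z\<in>cball q r. \<forall>k. R ^ nat \<bar>k\<bar> * norm (X k z) \<le> a)"
    if qR: "q \<in> D" "R \<ge> 1" for q R
  proof (rule three_term_decay[OF D derX X'_bound m_cont bounded start qR(2,1)])
    fix r a
    assume "r > 0" "cball q r \<subseteq> D" "\<And>z k. z \<in> cball q r \<Longrightarrow> R ^ nat \<bar>k\<bar> * norm (X k z) \<le> a"
    then show ?thesis by (intro exI[of _ r] exI[of _ a] conjI ballI allI)
  qed
  have decay_at: "\<exists>a. \<forall>k. R ^ nat \<bar>k\<bar> * norm (X k q) \<le> a" if "q \<in> D" "R \<ge> 1" for q R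
  proof -
    from decay[OF that] obtain r a where "r > 0"
      and a: "\<forall>z\<in>cball q r. \<forall>k. R ^ nat \<bar>k\<bar> * norm (X k z) \<le> a"
      by (elim exE conjE) (rule that)
    then have "q \<in> cball q r" by simp
    with a show ?thesis by (intro exI[of _ a]) (rule bspec)
  qed
  \<comment> \<open>Decay at the rate \<open>2 \<rho>\<close> beats the growth \<open>\<rho> ^ \<bar>k\<bar>\<close> of the powers by a geometric factor.\<close>
  have term_bound: "norm (cscale (l powi k) (X k z)) \<le> 4 * a * (1 / 2) ^ nat \<bar>k\<bar>"
    if \<rho>: "norm l \<le> \<rho>" "norm (inverse l) \<le> \<rho>" "\<rho> > 0" and a: "(2 * \<rho>) ^ nat \<bar>k\<bar> * norm (X k z) \<le> a" for l \<rho> k z a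
  proof -
    have "norm (cscale (l powi k) (X k z)) \<le> 4 * norm (l powi k) * norm (X k z)" by (rule norm_cscale_le)
    also have "\<dots> \<le> 4 * \<rho> ^ nat \<bar>k\<bar> * norm (X k z)"
      using power_abs_bound[OF \<rho>(1,2), of k] by (intro mult_right_mono) auto
    also have "\<dots> = 4 * ((2 * \<rho>) ^ nat \<bar>k\<bar> * norm (X k z)) * (1 / 2) ^ nat \<bar>k\<bar>"
      by (simp add: power_mult_distrib power_one_over)
    also have "\<dots> \<le> 4 * a * (1 / 2) ^ nat \<bar>k\<bar>" using a by (intro mult_right_mono) auto
    finally show ?thesis .
  qed
  have geo: "(\<lambda>k :: int. c * (1 / 2) ^ nat \<bar>k\<bar>) summable_on UNIV" for c :: real
    by (intro summable_on_cmult_right summable_on_power_abs_int) auto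
  show sum: "((\<lambda>k. cscale (l powi k) (X k z)) has_sum \<Psi> z l) UNIV" if z: "z \<in> D" and l: "l \<noteq> 0" for z l
  proof -
    define \<rho> where "\<rho> = max 1 (max (norm l) (norm (inverse l)))"
    have \<rho>: "norm l \<le> \<rho>" "norm (inverse l) \<le> \<rho>" "\<rho> > 0" "2 * \<rho> \<ge> 1" by (auto simp: \<rho>_def)
    from decay_at[OF z \<rho>(4)] obtain a where "\<forall>k. (2 * \<rho>) ^ nat \<bar>k\<bar> * norm (X k z) \<le> a" by (elim exE) (rule that)
    note a = this[THEN spec]
    have "(\<lambda>k. norm (cscale (l powi k) (X k z))) summable_on UNIV"
      by (rule Infinite_Sum.abs_summable_on_comparison_test'[OF geo term_bound[OF \<rho>(1-3) a]])
    then show ?thesis unfolding \<Psi>_def by (rule has_sum_infsum[OF abs_summable_summable])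
  qed
  show "(\<lambda>l. \<Psi> z l $ i $ j) holomorphic_on - {0}" if z: "z \<in> D" for z i j
  proof -
    have "\<exists>r>0. (\<lambda>l. \<Psi> z l $ i $ j) holomorphic_on ball l0 r" if l0: "l0 \<noteq> 0" for l0
    proof -
      define r where "r = norm l0 / 2"
      define \<rho> where "\<rho> = max 1 (max (2 * norm l0) (2 / norm l0))"
      have r: "r > 0" using l0 by (simp add: r_def)
      have \<rho>: "\<rho> > 0" "2 * \<rho> \<ge> 1" by (auto simp: \<rho>_def)
      have ball: "norm l \<le> \<rho>" "norm (inverse l) \<le> \<rho>" "l \<noteq> 0" if "l \<in> cball l0 r" for l
      proof -
        have d: "norm (l0 - l) \<le> norm l0 / 2" using that by (simp add: r_def dist_norm)
        have "norm l \<ge> norm l0 / 2" using norm_triangle_ineq2[of l0 l] d by linarith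
        moreover have "norm l \<le> 2 * norm l0"
          using norm_triangle_ineq2[of l l0] norm_minus_commute[of l l0] d norm_ge_zero[of l0] by linarith
        ultimately show "norm l \<le> \<rho>" "l \<noteq> 0" using l0 by (auto simp: \<rho>_def)
        have "inverse (norm l) \<le> inverse (norm l0 / 2)"
          using \<open>norm l \<ge> norm l0 / 2\<close> l0 by (intro le_imp_inverse_le) auto
        then show "norm (inverse l) \<le> \<rho>" by (simp add: \<rho>_def norm_inverse)
      qed
      from decay_at[OF z \<rho>(2)] obtain a where "\<forall>k. (2 * \<rho>) ^ nat \<bar>k\<bar> * norm (X k z) \<le> a" by (elim exE) (rule that)
      note a = this[THEN spec]
      have lim: "uniform_limit (cball l0 r) (\<lambda>S l. \<Sum>k\<in>S. l powi k * X k z $ i $ j) (\<lambda>l. \<Psi> z l $ i $ j)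
          (finite_subsets_at_top UNIV)"
      proof (rule Weierstrass_m_test_general'[where M = "\<lambda>k. 4 * a * (1 / 2) ^ nat \<bar>k\<bar>"])
        fix k l assume l: "l \<in> cball l0 r"
        have "norm (cscale (l powi k) (X k z) $ i $ j) \<le> 4 * a * (1 / 2) ^ nat \<bar>k\<bar>"
          by (rule order_trans[OF norm_mat2_entry term_bound[OF ball(1,2)[OF l] \<rho>(1) a]])
        then show "norm (l powi k * X k z $ i $ j) \<le> 4 * a * (1 / 2) ^ nat \<bar>k\<bar>" by simp
      next
        fix l assume l: "l \<in> cball l0 r"
        have "((\<lambda>k. cscale (l powi k) (X k z) $ i $ j) has_sum \<Psi> z l $ i $ j) UNIV"
          using has_sum_bounded_linear[OF bounded_linear_mat2_nth sum[OF z ball(3)[OF l]]] .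
        then show "((\<lambda>k. l powi k * X k z $ i $ j) has_sum \<Psi> z l $ i $ j) UNIV" by simp
      qed (rule geo)
      have hol: "(\<lambda>l. \<Sum>k\<in>S. l powi k * X k z $ i $ j) holomorphic_on cball l0 r" for S
        using ball(3) by (intro holomorphic_intros) auto
      have ev: "\<forall>\<^sub>F S in finite_subsets_at_top UNIV.
          continuous_on (cball l0 r) (\<lambda>l. \<Sum>k\<in>S. l powi k * X k z $ i $ j) \<and>
          (\<lambda>l. \<Sum>k\<in>S. l powi k * X k z $ i $ j) holomorphic_on ball l0 r"
        by (intro always_eventually allI conjI holomorphic_on_imp_continuous_on[OF hol]
            holomorphic_on_subset[OF hol ball_subset_cball])
      have "(\<lambda>l. \<Psi> z l $ i $ j) holomorphic_on ball l0 r"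
        by (rule holomorphic_uniform_limit[OF ev lim finite_subsets_at_top_neq_bot])
      then show ?thesis using r by blast
    qed
    then have "(\<lambda>l. \<Psi> z l $ i $ j) field_differentiable at l0" if "l0 \<noteq> 0" for l0
      using that holomorphic_on_imp_differentiable_at[OF _ open_ball] centre_in_ball by blast
    then show ?thesis by (auto simp: holomorphic_on_def intro: field_differentiable_at_within)
  qed
  show "((\<lambda>z. \<Psi> z l) has_derivative
        (\<lambda>h. \<Psi> z l ** (cscale h (cscale (inverse l) (A z) + B z) + cscale (cnj h) (C z + cscale l (E z))))) (at z)"
    if z: "z \<in> D" and l: "l \<noteq> 0" for z l
  proof -
    define \<rho> where "\<rho> = max 1 (max (norm l) (norm (inverse l)))"
    have \<rho>: "norm l \<le> \<rho>" "norm (inverse l) \<le> \<rho>" "\<rho> > 0" "2 * \<rho> \<ge> 1" by (auto simp: \<rho>_def)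
    from decay[OF z \<rho>(4)] obtain r a where r: "r > 0" "cball z r \<subseteq> D"
      and "\<forall>y\<in>cball z r. \<forall>k. (2 * \<rho>) ^ nat \<bar>k\<bar> * norm (X k y) \<le> a"
      by (elim exE conjE) (rule that)
    note a = this(3)[THEN bspec, THEN spec]
    have "bounded (m ` cball z r)"
      by (intro compact_imp_bounded compact_continuous_image continuous_on_subset[OF m_cont] r compact_cball)
    then obtain M where M: "M > 0" "\<And>y. y \<in> cball z r \<Longrightarrow> norm (m y) \<le> M"
      unfolding bounded_pos by blast
    have a0: "a \<ge> 0" using order_trans[OF _ a[of z 0]] r(1) by simp
    have yD: "y \<in> D" if "y \<in> ball z r" for y using that r(2) by auto
    let ?F' = "\<lambda>y h. \<Psi> y l ** (cscale h (cscale (inverse l) (A y) + B y) + cscale (cnj h) (C y + cscale l (E y)))"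
    show ?thesis
    proof (rule has_derivative_has_sum_int[where S = "ball z r" and M = "\<lambda>k. 24 * \<rho> * M * a * (1 / 2) ^ nat \<bar>k\<bar>"
          and f = "\<lambda>k y. cscale (l powi k) (X k y)" and f' = "\<lambda>k y h. cscale (l powi k) (X' k y h)" and F' = ?F'])
      fix k y assume y: "y \<in> ball z r"
      show "((\<lambda>y. cscale (l powi k) (X k y)) has_derivative (\<lambda>h. cscale (l powi k) (X' k y h))) (at y within ball z r)"
        by (rule bounded_linear.has_derivative[OF bounded_bilinear.bounded_linear_right[OF bounded_bilinear_cscale]
            has_derivative_at_withinI[OF derX[OF yD[OF y]]]])
      fix h
      have step: "(2 * \<rho>) ^ nat \<bar>k\<bar> * norm (X (k + i) y) \<le> 2 * \<rho> * a" if "\<bar>i\<bar> \<le> 1" for i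
      proof -
        have "(2 * \<rho>) ^ nat \<bar>k\<bar> \<le> (2 * \<rho>) ^ Suc (nat \<bar>k + i\<bar>)"
          using \<rho>(4) that by (intro power_increasing) auto
        then have "(2 * \<rho>) ^ nat \<bar>k\<bar> * norm (X (k + i) y) \<le> (2 * \<rho>) ^ Suc (nat \<bar>k + i\<bar>) * norm (X (k + i) y)"
          by (rule mult_right_mono) simp
        also have "\<dots> = 2 * \<rho> * ((2 * \<rho>) ^ nat \<bar>k + i\<bar> * norm (X (k + i) y))" by simp
        also have "\<dots> \<le> 2 * \<rho> * a" using \<rho>(3) a[of y "k + i"] y by (intro mult_left_mono) auto
        finally show ?thesis .
      qed
      have "norm (cscale (l powi k) (X' k y h)) \<le> 4 * norm (l powi k) * norm (X' k y h)" by (rule norm_cscale_le)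
      also have "\<dots> \<le> 4 * \<rho> ^ nat \<bar>k\<bar> * (M * norm h * (norm (X (k + - 1) y) + norm (X (k + 0) y) + norm (X (k + 1) y)))"
      proof (intro mult_mono)
        have "norm (X' k y h) \<le> m y * norm h * (norm (X (k - 1) y) + norm (X k y) + norm (X (k + 1) y))"
          by (rule X'_bound)
        also have "\<dots> \<le> M * norm h * (norm (X (k - 1) y) + norm (X k y) + norm (X (k + 1) y))"
          using M(2)[of y] y by (intro mult_right_mono) auto
        finally show "norm (X' k y h) \<le> M * norm h * (norm (X (k + - 1) y) + norm (X (k + 0) y) + norm (X (k + 1) y))"
          by simp
      qed (use power_abs_bound[OF \<rho>(1,2), of k] \<rho>(3) in auto)
      also have "\<dots> = 4 * M * norm h * (1 / 2) ^ nat \<bar>k\<bar> * ((2 * \<rho>) ^ nat \<bar>k\<bar> * norm (X (k + - 1) y) +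
          (2 * \<rho>) ^ nat \<bar>k\<bar> * norm (X (k + 0) y) + (2 * \<rho>) ^ nat \<bar>k\<bar> * norm (X (k + 1) y))"
        by (simp add: algebra_simps power_mult_distrib power_one_over)
      also have "\<dots> \<le> 4 * M * norm h * (1 / 2) ^ nat \<bar>k\<bar> * (2 * \<rho> * a + 2 * \<rho> * a + 2 * \<rho> * a)"
        using M(1) by (intro mult_left_mono add_mono step) auto
      finally show "norm (cscale (l powi k) (X' k y h)) \<le> 24 * \<rho> * M * a * (1 / 2) ^ nat \<bar>k\<bar> * norm h"
        by (simp add: mult_ac)
    next
      fix y h assume y: "y \<in> ball z r"
      have s: "((\<lambda>k. cscale (l powi k) (X (k - n) y) ** N) has_sum cscale (l powi n) (\<Psi> y l) ** N) UNIV" for n and N :: mat2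
      proof -
        have bij: "bij_betw (\<lambda>k. k - n) UNIV (UNIV :: int set)"
          by (rule bij_betwI[where g = "\<lambda>k. k + n"]) auto
        have "((\<lambda>k. cscale (l powi (k - n)) (X (k - n) y)) has_sum \<Psi> y l) UNIV"
          by (subst has_sum_reindex_bij_betw[OF bij, where f = "\<lambda>k. cscale (l powi k) (X k y)"])
            (rule sum[OF yD[OF y] l])
        then have "((\<lambda>k. cscale (l powi n) (cscale (l powi (k - n)) (X (k - n) y))) has_sum cscale (l powi n) (\<Psi> y l)) UNIV"
          by (rule has_sum_bounded_linear[OF bounded_bilinear.bounded_linear_right[OF bounded_bilinear_cscale]])
        moreover have "l powi n * l powi (k - n) = l powi k" for k
          using power_int_add[of l n "k - n"] l by simp
        ultimately have "((\<lambda>k. cscale (l powi k) (X (k - n) y)) has_sum cscale (l powi n) (\<Psi> y l)) UNIV"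
          by (simp add: cscale_cscale)
        then show ?thesis
          by (rule has_sum_bounded_linear[OF bounded_bilinear.bounded_linear_left[OF bounded_bilinear_mat2_mult]])
      qed
      have "((\<lambda>k. cscale (l powi k) (X (k - - 1) y) ** cscale h (A y) + cscale (l powi k) (X (k - 0) y) ** cscale h (B y) +
           (cscale (l powi k) (X (k - 0) y) ** cscale (cnj h) (C y) + cscale (l powi k) (X (k - 1) y) ** cscale (cnj h) (E y)))
         has_sum (cscale (l powi - 1) (\<Psi> y l) ** cscale h (A y) + cscale (l powi 0) (\<Psi> y l) ** cscale h (B y) +
           (cscale (l powi 0) (\<Psi> y l) ** cscale (cnj h) (C y) + cscale (l powi 1) (\<Psi> y l) ** cscale (cnj h) (E y)))) UNIV"
        by (intro has_sum_add s)
      moreover have "cscale (l powi k) (X (k - - 1) y) ** cscale h (A y) + cscale (l powi k) (X (k - 0) y) ** cscale h (B y) +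
           (cscale (l powi k) (X (k - 0) y) ** cscale (cnj h) (C y) + cscale (l powi k) (X (k - 1) y) ** cscale (cnj h) (E y)) =
           cscale (l powi k) (X' k y h)" for k
        by (simp add: X'_def mat2_eq_iff algebra_simps)
      moreover have "cscale (l powi - 1) (\<Psi> y l) ** cscale h (A y) + cscale (l powi 0) (\<Psi> y l) ** cscale h (B y) +
           (cscale (l powi 0) (\<Psi> y l) ** cscale (cnj h) (C y) + cscale (l powi 1) (\<Psi> y l) ** cscale (cnj h) (E y)) = ?F' y h"
        by (simp add: mat2_eq_iff algebra_simps)
      ultimately show "((\<lambda>k. cscale (l powi k) (X' k y h)) has_sum ?F' y h) UNIV" by (simp only:)
    qed (use r(1) geo sum yD l in auto)
  qed
qed

section \<open>The Sym formula\<close>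

lemma lorentz_eq:
  "lorentz X Y = - Re (X $ 1 $ 1 * Y $ 2 $ 2 + X $ 2 $ 2 * Y $ 1 $ 1 - X $ 1 $ 2 * Y $ 2 $ 1 - X $ 2 $ 1 * Y $ 1 $ 2) / 2"
  by (simp add: lorentz_def det_2 algebra_simps)

text \<open>\<open>SL(2, C)\<close> acts by isometries of the Minkowski space of Hermitian matrices.\<close>

lemma lorentz_invariant:
  assumes "det P = 1"
  shows "lorentz (P ** X ** hconj P) (P ** Y ** hconj P) = lorentz X Y"
proof -
  have "P ** X ** hconj P + P ** Y ** hconj P = P ** (X + Y) ** hconj P"
    by (simp add: mat2_eq_iff algebra_simps)
  then show ?thesis by (simp add: lorentz_def det_mul det_hconj assms)
qed

lemma islimpt_unit_circle: "(1 :: complex) islimpt sphere 0 1"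
proof (rule connected_imp_perfect)
  show "connected (sphere (0 :: complex) 1)" by (rule connected_sphere) simp
  show one: "(1 :: complex) \<in> sphere 0 1" by simp
  fix x :: complex
  show "sphere 0 1 \<noteq> {x}"
  proof
    assume eq: "sphere 0 1 = {x}"
    have "- 1 \<in> sphere (0 :: complex) 1" by simp
    then have "- 1 = x" unfolding eq by (rule singletonD)
    moreover have "1 = x" using one unfolding eq by (rule singletonD)
    ultimately show False by simp
  qed
qed

text \<open>The determinant is known on the circle, which has accumulation points in the connected domain
  \<open>\<lambda> \<noteq> 0\<close>.\<close>

lemma extended_frame_det:
  assumes F: "extended_frame D q u Q \<Psi>" and z: "z \<in> D" and l: "l \<noteq> 0"
  shows "det (\<Psi> z l) = 1"
proof -
  have hol: "(\<lambda>l. \<Psi> z l $ i $ j) holomorphic_on - {0}" for i j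
    using F z by (simp add: extended_frame_def)
  have "det (\<Psi> z l) - 1 = 0"
  proof (rule analytic_continuation[where f = "\<lambda>l. det (\<Psi> z l) - 1" and S = "- {0}" and U = "sphere 0 1" and \<xi> = 1])
    show "(\<lambda>l. det (\<Psi> z l) - 1) holomorphic_on - {0}"
      unfolding det_2 by (intro holomorphic_intros hol)
    show "connected (- {0 :: complex})" by (rule connected_punctured_universe) simp
    show "det (\<Psi> z l) - 1 = 0" if "l \<in> sphere 0 1" for l
      using F z that by (simp add: extended_frame_def loop_SL2_tau3_def loop_SL2_def)
  qed (use l islimpt_unit_circle in auto)
  then show ?thesis by simp
qed

lemma scrH_eq: "q \<noteq> 0 \<Longrightarrow> scrH q = 1 / sinh q"
proof -
  assume "q \<noteq> 0"
  then have "sinh q \<noteq> 0" by simp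
  then have "scrH q = exp (- q) * ((cosh q + sinh q) / sinh q)"
    by (simp add: scrH_def Defs.coth_def field_simps)
  then show ?thesis by (simp add: cosh_plus_sinh exp_minus)
qed

lemma Ck_on_mat2:
  assumes "open D" "Ck_on n D a" "Ck_on n D b" "Ck_on n D c" "Ck_on n D d"
  shows "Ck_on n D (\<lambda>z. mat2 (a z) (b z) (c z) (d z))"
proof -
  have lin: "bounded_linear (\<lambda>x. cscale x M)" for M
    by (rule bounded_bilinear.bounded_linear_left[OF bounded_bilinear_cscale])
  have eq: "mat2 (a z) (b z) (c z) (d z) = cscale (a z) (mat2 1 0 0 0) + cscale (b z) (mat2 0 1 0 0) +
      (cscale (c z) (mat2 0 0 1 0) + cscale (d z) (mat2 0 0 0 1))" for z
    by (simp add: mat2_eq_iff)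
  show ?thesis unfolding eq
    by (intro Ck_on_add[OF assms(1)] Ck_on_bounded_linear[OF assms(1) lin] assms)
qed

lemma Ck_on_of_real: "open D \<Longrightarrow> Ck_on n D f \<Longrightarrow> Ck_on n D (\<lambda>z. of_real (f z) :: complex)"
  by (rule Ck_on_bounded_linear[OF _ bounded_linear_of_real])

lemma Ck_on_cmult:
  fixes f :: "complex \<Rightarrow> 'b::real_normed_algebra"
  shows "open D \<Longrightarrow> Ck_on n D f \<Longrightarrow> Ck_on n D (\<lambda>z. c * f z)"
  by (rule Ck_on_bounded_linear[OF _ bounded_linear_mult_right])

lemma Ck_on_Umat_Vmat:
  assumes D: "open D" and u: "smooth_on D u" and Q: "Q holomorphic_on D"
  shows "Ck_on n D (\<lambda>z. Umat q u Q z l)" "Ck_on n D (\<lambda>z. Vmat q u Q z l)"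
proof -
  have un: "Ck_on k D u" for k using u by (simp add: smooth_on_def)
  have du: "Ck_on n D (\<lambda>z. of_real (dx u z) :: complex)" "Ck_on n D (\<lambda>z. of_real (dy u z) :: complex)"
    using un[of "Suc n"] by (auto intro!: Ck_on_of_real D)
  have eu: "Ck_on n D (\<lambda>z. of_real (exp (c * u z)) :: complex)" for c
    by (intro Ck_on_of_real Ck_on_exp Ck_on_cmult D un)
  have Qn: "Ck_on n D Q" "Ck_on n D (\<lambda>z. cnj (Q z))"
    by (intro Ck_on_holomorphic D Q Ck_on_bounded_linear[OF D bounded_linear_cnj])+
  have U: "Umat q u Q z l = mat2 (1 / 8 * of_real (dx u z) + (- \<i> / 8) * of_real (dy u z))
      ((- (1 / 2) * inverse l * scrH q) * of_real (exp (1 / 2 * u z)))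
      (inverse l * (Q z * of_real (exp ((- 1 / 2) * u z))))
      ((- 1 / 8) * of_real (dx u z) + \<i> / 8 * of_real (dy u z))" for z
    by (simp add: Umat_def wirt_z_def mat2_eq_iff field_simps)
  have V: "Vmat q u Q z l = mat2 ((- 1 / 8) * of_real (dx u z) + (- \<i> / 8) * of_real (dy u z))
      ((- l) * (cnj (Q z) * of_real (exp ((- 1 / 2) * u z))))
      ((1 / 2 * l * scrH q) * of_real (exp (1 / 2 * u z)))
      (1 / 8 * of_real (dx u z) + \<i> / 8 * of_real (dy u z))" for z
    by (simp add: Vmat_def wirt_zbar_def mat2_eq_iff field_simps)
  show "Ck_on n D (\<lambda>z. Umat q u Q z l)" unfolding U
    by (intro Ck_on_mat2 Ck_on_add Ck_on_cmult Ck_on_bilinear[OF D bounded_bilinear_mult] D du eu Qn)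
  show "Ck_on n D (\<lambda>z. Vmat q u Q z l)" unfolding V
    by (intro Ck_on_mat2 Ck_on_add Ck_on_cmult Ck_on_bilinear[OF D bounded_bilinear_mult] D du eu Qn)
qed

text \<open>The equation of the frame expresses its derivatives by itself, so that differentiability
  bootstraps to smoothness.\<close>

lemma Ck_on_extended_frame:
  assumes D: "open D" and F: "extended_frame D q u Q \<Psi>" and l: "l \<noteq> 0"
  shows "Ck_on n D (\<lambda>z. \<Psi> z l)"
proof (induction n)
  case 0
  have "isCont (\<lambda>z. \<Psi> z l) z" if "z \<in> D" for z
    using F that l unfolding extended_frame_def by (meson has_derivative_continuous)
  then show ?case by (simp add: continuous_at_imp_continuous_on)
next
  case (Suc n)
  let ?U = "\<lambda>z. Umat q u Q z l" and ?V = "\<lambda>z. Vmat q u Q z l"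
  have UV: "Ck_on n D ?U" "Ck_on n D ?V"
    using F by (auto simp: extended_frame_def intro!: Ck_on_Umat_Vmat D)
  have lin: "bounded_linear (cscale c)" for c
    by (rule bounded_bilinear.bounded_linear_right[OF bounded_bilinear_cscale])
  show ?case
  proof (rule Ck_on_SucI[OF D])
    fix z assume "z \<in> D"
    then have "((\<lambda>z. \<Psi> z l) has_derivative (\<lambda>h. \<Psi> z l ** (cscale h (?U z) + cscale (cnj h) (?V z)))) (at z)"
      using F l by (simp add: extended_frame_def)
    moreover have "\<Psi> z l ** (cscale h (?U z) + cscale (cnj h) (?V z)) =
        Re h *\<^sub>R (\<Psi> z l ** (cscale 1 (?U z) + cscale 1 (?V z))) +
        Im h *\<^sub>R (\<Psi> z l ** (cscale \<i> (?U z) + cscale (- \<i>) (?V z)))" for h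
      by (simp add: mat2_eq_iff complex_eq_iff algebra_simps)
    ultimately show "((\<lambda>z. \<Psi> z l) has_derivative (\<lambda>h. Re h *\<^sub>R (\<Psi> z l ** (cscale 1 (?U z) + cscale 1 (?V z))) +
        Im h *\<^sub>R (\<Psi> z l ** (cscale \<i> (?U z) + cscale (- \<i>) (?V z))))) (at z)"
      by simp
  qed (intro Ck_on_bilinear[OF D bounded_bilinear_mat2_mult Suc] Ck_on_add D UV Ck_on_bounded_linear[OF D lin])+
qed

lemma congruence_has_derivative:
  fixes P X :: "complex \<Rightarrow> mat2"
  assumes P: "(P has_derivative (\<lambda>h. P z ** W h)) (at z)" and X: "(X has_derivative X') (at z)"
  shows "((\<lambda>z. P z ** X z ** hconj (P z)) has_derivative
    (\<lambda>h. P z ** (W h ** X z + X' h + X z ** hconj (W h)) ** hconj (P z))) (at z)"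
proof -
  have "((\<lambda>z. P z ** X z) has_derivative (\<lambda>h. P z ** X' h + P z ** W h ** X z)) (at z)"
    by (rule bounded_bilinear.FDERIV[OF bounded_bilinear_mat2_mult P X])
  from bounded_bilinear.FDERIV[OF bounded_bilinear_mat2_mult this bounded_linear.has_derivative[OF bounded_linear_hconj P]]
  show ?thesis
    by (rule has_derivative_eq_rhs) (simp add: fun_eq_iff mat2_eq_iff algebra_simps)
qed

lemma has_derivative_dx_dy_eq:
  assumes "(f has_derivative f') (at z)"
  shows "dx f z = f' 1" "dy f z = f' \<i>"
  using frechet_derivative_at[OF assms] by (simp_all add: dx_def dy_def)

definition offdiag :: "complex \<Rightarrow> mat2" where
  "offdiag b = mat2 0 b (cnj b) 0"

lemma offdiag_nth [simp]:
  "offdiag b $ 1 $ 1 = 0" "offdiag b $ 1 $ 2 = b" "offdiag b $ 2 $ 1 = cnj b" "offdiag b $ 2 $ 2 = 0"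
  by (simp_all add: offdiag_def)

lemma bounded_linear_offdiag: "bounded_linear offdiag"
proof -
  have "linear offdiag" by (intro linearI) (simp_all add: mat2_eq_iff)
  then show ?thesis by (simp add: linear_conv_bounded_linear)
qed

text \<open>With \<open>W h = h U + cnj h V\<close> and \<open>E = diag(s, 1/s)\<close>, the relation \<open>\<bar>\<lambda>\<bar> = s\<close> makes the terms that
  contain \<open>Q\<close> cancel in \<open>W h E + E (W h)\<^sup>*\<close>: the surface is conformal.\<close>

lemma sym_first_derivative:
  assumes l: "norm l = s" and s: "s > 0"
    and W: "W = cscale h (Umat q u Q z l) + cscale (cnj h) (Vmat q u Q z l)"
  shows "W ** diag2 (of_real s) (of_real (1 / s)) + diag2 (of_real s) (of_real (1 / s)) ** hconj W =
    offdiag (h * (1 / 2 * cnj l * of_real (scrH q * exp (u z / 2) * (s - 1 / s ^ 3))))"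
proof -
  have ll: "l * cnj l = of_real (s\<^sup>2)" using complex_norm_square[of l] l by simp
  have l0: "l \<noteq> 0" using l s by auto
  obtain k where k: "inverse l = k" "l = cnj k * (of_real s)\<^sup>2" "cnj l = k * (of_real s)\<^sup>2"
  proof
    show "inverse l = inverse l" ..
    show "cnj l = inverse l * (of_real s)\<^sup>2" using ll l0 by (simp add: field_simps)
    then have "cnj (cnj l) = cnj (inverse l * (of_real s)\<^sup>2)" by (simp only:)
    then show "l = cnj (inverse l) * (of_real s)\<^sup>2" by simp
  qed
  have z: "cnj (wirt_z u z) = wirt_zbar u z" by (simp add: wirt_z_def wirt_zbar_def)
  have zb: "cnj (wirt_zbar u z) = wirt_z u z" by (simp add: wirt_z_def wirt_zbar_def)
  show ?thesis
    unfolding W Umat_def Vmat_def k(1,3)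
    using s by (simp add: k(2) mat2_eq_iff z zb field_simps power2_eq_square power3_eq_cube)
qed

lemma lorentz_offdiag: "lorentz (offdiag b) (offdiag b') = Re (b * cnj b')"
  by (simp add: lorentz_eq)

text \<open>\<open>M h b\<close> represents the derivative in direction \<open>h\<close> of the first derivative that belongs to the factor \<open>b\<close>, so that
  the sum is the Laplacian paired with the normal. Only diagonal entries of \<open>M\<close> contribute, and \<open>C\<close>, which
  stands for the derivative of the off-diagonal entry, has none. Adding \<open>h = b = 1\<close> and \<open>h = b = \<i>\<close> removes
  the terms with \<open>Q\<close>, which carry the factor \<open>h\<^sup>2\<close> or its conjugate.\<close>

lemma sym_second_derivative_normal:
  assumes l: "norm l = s" and s: "s > 0"
    and W: "\<And>h. W h = cscale h (Umat q u Q z l) + cscale (cnj h) (Vmat q u Q z l)"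
    and c: "c = 1 / 2 * cnj l * of_real \<rho>"
    and M: "\<And>h b. M h b = W h ** offdiag (b * c) + offdiag (C h b) + offdiag (b * c) ** hconj (W h)"
  shows "lorentz (M 1 1) (diag2 (of_real s) (of_real (- 1 / s))) + lorentz (M \<i> \<i>) (diag2 (of_real s) (of_real (- 1 / s))) =
    - (1 / 2) * (scrH q * exp (u z / 2)) * \<rho> * (1 / s + s ^ 3)"
proof -
  define H where "H = scrH q * exp (u z / 2)"
  have ll: "l * cnj l = of_real (s\<^sup>2)" using complex_norm_square[of l] l by simp
  have l0: "l \<noteq> 0" using l s by auto
  have 1: "M 1 1 $ 1 $ 1 + M \<i> \<i> $ 1 $ 1 = of_real (- H * \<rho>)"
  proof -
    have "inverse l * l = 1" using l0 by simp
    then have a: "(1 / 2 * inverse l * of_real H) * (1 / 2 * l * of_real \<rho>) = of_real (1 / 4 * H * \<rho>)"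
      by simp
    have "M 1 1 $ 1 $ 1 + M \<i> \<i> $ 1 $ 1 =
        - 2 * ((1 / 2 * inverse l * of_real H) * (1 / 2 * l * of_real \<rho>)) +
        - 2 * cnj ((1 / 2 * inverse l * of_real H) * (1 / 2 * l * of_real \<rho>))"
      by (simp add: M W c Umat_def Vmat_def H_def algebra_simps)
    then show ?thesis unfolding a by simp
  qed
  have 2: "M 1 1 $ 2 $ 2 + M \<i> \<i> $ 2 $ 2 = of_real (H * \<rho> * s\<^sup>2)"
  proof -
    have a: "(1 / 2 * l * of_real H) * (1 / 2 * cnj l * of_real \<rho>) = of_real (1 / 4 * H * \<rho> * s\<^sup>2)"
    proof -
      have "(1 / 2 * l * of_real H) * (1 / 2 * cnj l * of_real \<rho>) = 1 / 4 * of_real H * of_real \<rho> * (l * cnj l)"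
        by simp
      then show ?thesis unfolding ll by simp
    qed
    have "M 1 1 $ 2 $ 2 + M \<i> \<i> $ 2 $ 2 =
        2 * ((1 / 2 * l * of_real H) * (1 / 2 * cnj l * of_real \<rho>)) +
        2 * cnj ((1 / 2 * l * of_real H) * (1 / 2 * cnj l * of_real \<rho>))"
      by (simp add: M W c Umat_def Vmat_def H_def algebra_simps)
    then show ?thesis unfolding a by simp
  qed
  have lor: "lorentz X (diag2 (of_real s) (of_real (- 1 / s))) = Re (X $ 1 $ 1) / (2 * s) - Re (X $ 2 $ 2) * s / 2" for X
    using s by (simp add: lorentz_eq Re_divide_of_real)
  have "lorentz (M 1 1) (diag2 (of_real s) (of_real (- 1 / s))) + lorentz (M \<i> \<i>) (diag2 (of_real s) (of_real (- 1 / s))) =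
      Re (M 1 1 $ 1 $ 1 + M \<i> \<i> $ 1 $ 1) / (2 * s) - Re (M 1 1 $ 2 $ 2 + M \<i> \<i> $ 2 $ 2) * s / 2"
    by (simp only: lor plus_complex.sel) (simp add: algebra_simps add_divide_distrib)
  also have "\<dots> = - (1 / 2) * H * \<rho> * (1 / s + s ^ 3)"
    unfolding 1 2 using s by (simp add: field_simps power2_eq_square power3_eq_cube)
  finally show ?thesis by (simp add: H_def)
qed

text \<open>A matrix congruent to a positive diagonal matrix is positive definite.\<close>

lemma positive_congruence_trace:
  assumes "det P = 1" "s > 0"
  shows "Re (trace (P ** diag2 (of_real s) (of_real (1 / s)) ** hconj P)) > 0"
proof -
  have t: "Re (trace (P ** diag2 (of_real s) (of_real (1 / s)) ** hconj P)) =
      s * ((cmod (P $ 1 $ 1))\<^sup>2 + (cmod (P $ 2 $ 1))\<^sup>2) + ((cmod (P $ 1 $ 2))\<^sup>2 + (cmod (P $ 2 $ 2))\<^sup>2) / s"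
    unfolding cmod_power2
    by (simp add: trace_def sum_2 algebra_simps power2_eq_square add_divide_distrib)
  have "P $ 1 $ 1 \<noteq> 0 \<or> P $ 2 $ 1 \<noteq> 0" using assms(1) by (auto simp: det_2)
  then have "(cmod (P $ 1 $ 1))\<^sup>2 + (cmod (P $ 2 $ 1))\<^sup>2 > 0"
    by (auto simp: sum_power2_gt_zero_iff)
  then have "s * ((cmod (P $ 1 $ 1))\<^sup>2 + (cmod (P $ 2 $ 1))\<^sup>2) > 0" using assms(2) by simp
  moreover have "((cmod (P $ 1 $ 2))\<^sup>2 + (cmod (P $ 2 $ 2))\<^sup>2) / s \<ge> 0" using assms(2) by simp
  ultimately show ?thesis unfolding t by linarith
qed

text \<open>With \<open>s = exp (-q/2)\<close> one has \<open>s - 1/s\<^sup>3 = - 2 sinh q / s\<close>, which cancels against \<open>scrH q = 1 / sinh q\<close>; this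
  is why the metric factor is exactly \<open>exp u\<close>. In the Laplacian the sum \<open>1/s\<^sup>2 + s\<^sup>2 = 2 cosh q\<close> appears in
  place of the difference, and the quotient is \<open>coth q\<close>.\<close>

lemma sym_formula_cmc:
  assumes D: "open D" and q: "q > 0" and F: "extended_frame D q u Q \<Psi>" and l: "norm l = exp (- q / 2)"
  defines "f \<equiv> sym_formula q \<Psi> l"
  shows "cmc_surface_H3 D (Defs.coth q) f"
    and "\<forall>z\<in>D. fffE f z = exp (u z) \<and> fffF f z = 0 \<and> fffG f z = exp (u z)"
proof -
  define s where "s = exp (- q / 2)"
  have s: "s > 0" and ls: "norm l = s" by (simp_all add: s_def l)
  have l0: "l \<noteq> 0" using ls s by auto
  have s_inv: "exp (q / 2) = 1 / s" by (simp add: s_def exp_minus field_simps)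
  have s2: "s\<^sup>2 = exp (- q)" by (simp add: s_def power2_eq_square flip: exp_add)
  have is2: "1 / s\<^sup>2 = exp q" by (simp add: s2 exp_minus divide_inverse)
  have sinh_s: "sinh q = (1 / s\<^sup>2 - s\<^sup>2) / 2" unfolding is2 unfolding s2 by (simp add: sinh_def)
  have cosh_s: "cosh q = (1 / s\<^sup>2 + s\<^sup>2) / 2" unfolding is2 unfolding s2 by (simp add: cosh_def)
  have sinh0: "sinh q \<noteq> 0" and scr: "scrH q = 1 / sinh q" using q scrH_eq by auto
  define P where "P = (\<lambda>z. \<Psi> z l)"
  define E where "E = diag2 (of_real s) (of_real (1 / s))"
  define N where "N = diag2 (of_real s) (of_real (- 1 / s))"
  define \<rho> where "\<rho> = (\<lambda>z. scrH q * exp (u z / 2) * (s - 1 / s ^ 3))"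
  define c where "c = (\<lambda>z. 1 / 2 * cnj l * of_real (\<rho> z))"
  define W where "W = (\<lambda>z h. cscale h (Umat q u Q z l) + cscale (cnj h) (Vmat q u Q z l))"
  have \<rho>s: "\<rho> z * s = - 2 * exp (u z / 2)" for z
  proof -
    have a: "(s - 1 / s ^ 3) * s = - 2 * sinh q"
      unfolding sinh_s using s by (simp add: field_simps power2_eq_square power3_eq_cube)
    have "\<rho> z * s = scrH q * exp (u z / 2) * ((s - 1 / s ^ 3) * s)" by (simp add: \<rho>_def)
    then show ?thesis unfolding a scr using sinh0 by simp
  qed
  have f_eq: "f = (\<lambda>z. P z ** E ** hconj (P z))"
    by (simp add: fun_eq_iff f_def sym_formula_def P_def E_def s_def exp_minus field_simps)
  have u: "smooth_on D u" and Q: "Q holomorphic_on D" using F by (auto simp: extended_frame_def)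
  have PC: "Ck_on n D P" for n unfolding P_def by (rule Ck_on_extended_frame[OF D F l0])
  have hPC: "Ck_on n D (\<lambda>z. hconj (P z))" for n by (rule Ck_on_bounded_linear[OF D bounded_linear_hconj PC])
  have smooth: "smooth_on D (\<lambda>z. P z ** M ** hconj (P z))" for M
    unfolding smooth_on_def
    by (intro allI Ck_on_bilinear[OF D bounded_bilinear_mat2_mult] PC hPC Ck_on_const)
  have detP: "det (P z) = 1" if "z \<in> D" for z
    unfolding P_def by (rule extended_frame_det[OF F that l0])
  have dP: "(P has_derivative (\<lambda>h. P z ** W z h)) (at z)" if "z \<in> D" for z
    using F that l0 by (simp add: extended_frame_def P_def W_def)
  have WE: "W z h ** E + E ** hconj (W z h) = offdiag (h * c z)" for z h
    unfolding E_def c_def \<rho>_def by (rule sym_first_derivative[OF ls s]) (simp add: W_def)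
  have df: "(f has_derivative (\<lambda>h. P z ** offdiag (h * c z) ** hconj (P z))) (at z)" if z: "z \<in> D" for z
    using congruence_has_derivative[OF dP[OF z], of "\<lambda>_. E" "\<lambda>_. 0"] by (simp add: f_eq WE)
  have dxf: "dx f z = P z ** offdiag (1 * c z) ** hconj (P z)" and dyf: "dy f z = P z ** offdiag (\<i> * c z) ** hconj (P z)"
    if "z \<in> D" for z
    using has_derivative_dx_dy_eq[OF df[OF that]] by simp_all
  have cc: "c z * cnj (c z) = of_real (exp (u z))" for z
  proof -
    have "c z * cnj (c z) = of_real ((\<rho> z)\<^sup>2 / 4) * (l * cnj l)"
      by (simp add: c_def power2_eq_square)
    also have "l * cnj l = of_real (s\<^sup>2)" using complex_norm_square[of l] ls by simp
    also have "of_real ((\<rho> z)\<^sup>2 / 4) * (of_real (s\<^sup>2) :: complex) = of_real ((\<rho> z * s)\<^sup>2 / 4)"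
      by (simp add: power_mult_distrib)
    also have "(\<rho> z * s)\<^sup>2 / 4 = exp (u z)"
      by (simp add: \<rho>s power2_eq_square flip: exp_add)
    finally show ?thesis .
  qed
  have metric: "fffE f z = exp (u z)" "fffF f z = 0" "fffG f z = exp (u z)" if z: "z \<in> D" for z
  proof -
    have "lorentz (dx f z) (dx f z) = Re (c z * cnj (c z))"
      unfolding dxf[OF z] lorentz_invariant[OF detP[OF z]] lorentz_offdiag by simp
    then show "fffE f z = exp (u z)" unfolding cc by (simp add: fffE_def)
    have "lorentz (dx f z) (dy f z) = Re (- \<i> * (c z * cnj (c z)))"
      unfolding dxf[OF z] dyf[OF z] lorentz_invariant[OF detP[OF z]] lorentz_offdiag by (simp add: algebra_simps)
    then show "fffF f z = 0" unfolding cc by (simp add: fffF_def)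
    have "lorentz (dy f z) (dy f z) = Re (c z * cnj (c z))"
      unfolding dyf[OF z] lorentz_invariant[OF detP[OF z]] lorentz_offdiag by (simp add: algebra_simps)
    then show "fffG f z = exp (u z)" unfolding cc by (simp add: fffG_def)
  qed
  then show "\<forall>z\<in>D. fffE f z = exp (u z) \<and> fffF f z = 0 \<and> fffG f z = exp (u z)" by blast
  have Her: "hconj (P z ** diag2 (of_real a) (of_real b) ** hconj (P z)) = P z ** diag2 (of_real a) (of_real b) ** hconj (P z)"
    for z a b
    by (simp add: mat2_eq_iff algebra_simps)
  have fH: "f z \<in> H3" if z: "z \<in> D" for z
  proof -
    have "det E = 1" using s by (simp add: E_def det_2)
    then have "det (f z) = 1" unfolding f_eq det_mul det_hconj detP[OF z] by simp
    moreover have "hconj (f z) = f z" unfolding f_eq E_def by (rule Her)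
    moreover have "Re (trace (f z)) > 0"
      unfolding f_eq E_def by (rule positive_congruence_trace[OF detP[OF z] s])
    ultimately show ?thesis by (simp add: H3_def Her2_def)
  qed
  have imm: "immersion_H3 D f"
    unfolding immersion_H3_def using smooth fH metric by (auto simp: f_eq power2_eq_square)
  define n where "n = (\<lambda>z. P z ** N ** hconj (P z))"
  have normal: "unit_normal_H3 D f n"
    unfolding unit_normal_H3_def
  proof (intro conjI ballI)
    show "smooth_on D n" unfolding n_def by (rule smooth)
    fix z assume z: "z \<in> D"
    show "n z \<in> Her2" unfolding Her2_def n_def N_def mem_Collect_eq by (rule Her)
    show "lorentz (n z) (n z) = 1" "lorentz (n z) (f z) = 0"
      unfolding n_def f_eq lorentz_invariant[OF detP[OF z]]
      using s by (simp_all add: lorentz_eq N_def E_def)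
    show "lorentz (n z) (dx f z) = 0" "lorentz (n z) (dy f z) = 0"
      unfolding n_def dxf[OF z] dyf[OF z] lorentz_invariant[OF detP[OF z]]
      by (simp_all add: lorentz_eq N_def)
  qed
  have "mean_curv f n z = Defs.coth q" if z: "z \<in> D" for z
  proof -
    have cC: "Ck_on 1 D c"
    proof -
      have eq: "c z = (1 / 2 * cnj l * of_real (scrH q * (s - 1 / s ^ 3))) * of_real (exp (1 / 2 * u z))" for z
        by (simp add: c_def \<rho>_def)
      have "Ck_on 1 D u" using u by (simp add: smooth_on_def)
      then show ?thesis unfolding eq by (intro Ck_on_cmult Ck_on_of_real Ck_on_exp D)
    qed
    define c' where "c' = (\<lambda>h. Re h *\<^sub>R dx c z + Im h *\<^sub>R dy c z)"
    have dc: "(c has_derivative c') (at z)"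
      unfolding c'_def using cC z by (intro has_derivative_dx_dy) auto
    define M where "M = (\<lambda>h b. W z h ** offdiag (b * c z) + offdiag (b * c' h) + offdiag (b * c z) ** hconj (W z h))"
    have d2: "((\<lambda>z. P z ** offdiag (b * c z) ** hconj (P z)) has_derivative (\<lambda>h. P z ** M h b ** hconj (P z))) (at z)" for b
      unfolding M_def
      by (rule congruence_has_derivative[OF dP[OF z]
            bounded_linear.has_derivative[OF bounded_linear_offdiag has_derivative_mult_right[OF dc]]])
    have "(dx f has_derivative (\<lambda>h. P z ** M h 1 ** hconj (P z))) (at z)"
      by (rule has_derivative_transform_within_open[OF d2 D z]) (simp only: dxf)
    then have dxx: "dx (dx f) z = P z ** M 1 1 ** hconj (P z)" by (rule has_derivative_dx_dy_eq)
    have "(dy f has_derivative (\<lambda>h. P z ** M h \<i> ** hconj (P z))) (at z)"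
      by (rule has_derivative_transform_within_open[OF d2 D z]) (simp only: dyf)
    then have dyy: "dy (dy f) z = P z ** M \<i> \<i> ** hconj (P z)" by (rule has_derivative_dx_dy_eq)
    have "lorentz (dx (dx f) z) (n z) + lorentz (dy (dy f) z) (n z) = lorentz (M 1 1) N + lorentz (M \<i> \<i>) N"
      unfolding dxx dyy n_def lorentz_invariant[OF detP[OF z]] ..
    also have "\<dots> = - (1 / 2) * (scrH q * exp (u z / 2)) * \<rho> z * (1 / s + s ^ 3)"
      unfolding N_def
      by (rule sym_second_derivative_normal[OF ls s, where C = "\<lambda>h b. b * c' h" and W = "W z" and c = "c z"])
        (simp_all add: W_def c_def M_def)
    also have "\<dots> = - (1 / 2) * scrH q * exp (u z / 2) * (\<rho> z * s) * (1 / s\<^sup>2 + s\<^sup>2)"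
      using s by (simp add: field_simps power2_eq_square power3_eq_cube)
    also have "\<dots> = scrH q * (exp (u z / 2) * exp (u z / 2)) * (2 * cosh q)"
      unfolding \<rho>s cosh_s by simp
    also have "\<dots> = 2 * Defs.coth q * exp (u z)"
      by (simp add: scr Defs.coth_def flip: exp_add)
    finally have sum: "lorentz (dx (dx f) z) (n z) + lorentz (dy (dy f) z) (n z) = 2 * Defs.coth q * exp (u z)" .
    have "mean_curv f n z = (exp (u z) * (lorentz (dx (dx f) z) (n z) + lorentz (dy (dy f) z) (n z))) / (2 * (exp (u z) * exp (u z)))"
      by (simp add: mean_curv_def metric[OF z] algebra_simps)
    also have "\<dots> = Defs.coth q" unfolding sum by (simp add: field_simps)
    finally show ?thesis .
  qed
  with imm normal show "cmc_surface_H3 D (Defs.coth q) f" unfolding cmc_surface_H3_def by blast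
qed

section \<open>The Maurer-Cartan form of the unitary factor\<close>

lemma loop_SL2_tau3_unitary:
  assumes "loop_SL2_tau3 g" "norm l = 1"
  shows "hconj (g l) ** g l = mat 1" "g l ** hconj (g l) = mat 1" "det (g l) = 1"
proof -
  show d: "det (g l) = 1" using assms by (simp add: loop_SL2_tau3_def loop_SL2_def)
  have "tau3 g l = g l" using assms by (simp add: loop_SL2_tau3_def)
  then show u: "hconj (g l) ** g l = mat 1" using tau3_circle_iff[where g = g and l = l, OF d assms(2)] by blast
  have "hconj (g l) = adjugate (g l)"
    using u adjugate_inverse[OF d] by (metis matrix_mul_assoc matrix_mul_lid matrix_mul_rid)
  then show "g l ** hconj (g l) = mat 1" using adjugate_inverse[OF d] by simp
qed

text \<open>A statement about a single point \<open>z\<close>: the loops with suffix \<open>x\<close> and \<open>y\<close> are the partial derivatives, and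
  the hypotheses are the differentiated relations \<open>C = \<Phi> V\<close> and \<open>\<Phi>\<^sup>* \<Phi> = 1\<close>. In the proof \<open>P\<close> and \<open>R\<close> are the
  \<open>(1,0)\<close>- and the \<open>(0,1)\<close>-part of \<open>\<Phi>\<^sup>-\<^sup>1 d\<Phi>\<close>. One has orders at least \<open>-1\<close> and \<open>0\<close>, respectively, and
  \<open>P = - R\<^sup>*\<close> bounds the degrees from above as well. The conclusion is stated for the coefficients of
  \<open>d\<Phi>\<close>, with \<open>-S\<close> the constant term of \<open>R\<close>.\<close>

lemma maurer_cartan_three_terms:
  assumes \<Phi>: "loop_SL2_tau3 \<Phi>" and V: "loop_SL2_plus V"
    and w: "wiener_loop \<Phi>x" "wiener_loop \<Phi>y" "wiener_loop Vx" "wiener_loop Vy"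
    and Vneg: "\<And>k. k < 0 \<Longrightarrow> loop_coeff Vx k = 0" "\<And>k. k < 0 \<Longrightarrow> loop_coeff Vy k = 0"
    and \<eta>: "loop_series \<eta> N" "\<And>k. k < -1 \<Longrightarrow> N k = 0"
    and eqx: "\<And>l. norm l = 1 \<Longrightarrow> \<Phi>x l ** V l + \<Phi> l ** Vx l = \<Phi> l ** V l ** \<eta> l"
    and eqy: "\<And>l. norm l = 1 \<Longrightarrow> \<Phi>y l ** V l + \<Phi> l ** Vy l = cscale \<i> (\<Phi> l ** V l ** \<eta> l)"
    and ux: "\<And>l. norm l = 1 \<Longrightarrow> hconj (\<Phi>x l) ** \<Phi> l + hconj (\<Phi> l) ** \<Phi>x l = 0"
    and uy: "\<And>l. norm l = 1 \<Longrightarrow> hconj (\<Phi>y l) ** \<Phi> l + hconj (\<Phi> l) ** \<Phi>y l = 0"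
  defines "P1 \<equiv> loop_coeff V 0 ** N (-1) ** adjugate (loop_coeff V 0)"
    and "S \<equiv> cscale (1/2) (loop_coeff Vx 0 + cscale \<i> (loop_coeff Vy 0)) ** adjugate (loop_coeff V 0)"
  shows "cscale (1/2) (loop_coeff \<Phi>x k - cscale \<i> (loop_coeff \<Phi>y k)) =
      loop_coeff \<Phi> (k + 1) ** P1 + loop_coeff \<Phi> k ** hconj S"
    and "cscale (1/2) (loop_coeff \<Phi>x k + cscale \<i> (loop_coeff \<Phi>y k)) =
      - (loop_coeff \<Phi> k ** S + loop_coeff \<Phi> (k - 1) ** hconj P1)"
proof -
  define \<Phi>z where "\<Phi>z = (\<lambda>l. cscale (1/2) (\<Phi>x l - cscale \<i> (\<Phi>y l)))"
  define \<Phi>b where "\<Phi>b = (\<lambda>l. cscale (1/2) (\<Phi>x l + cscale \<i> (\<Phi>y l)))"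
  define Vz where "Vz = (\<lambda>l. cscale (1/2) (Vx l - cscale \<i> (Vy l)))"
  define Vb where "Vb = (\<lambda>l. cscale (1/2) (Vx l + cscale \<i> (Vy l)))"
  have V_SL2: "loop_SL2 V" using V by (simp add: loop_SL2_plus_def)
  have sV: "loop_series V (loop_coeff V)" using V_SL2 by (simp add: loop_SL2_def wiener_loop_series)
  have s\<Phi>: "loop_series \<Phi> (loop_coeff \<Phi>)"
    using \<Phi> by (simp add: loop_SL2_tau3_def loop_SL2_def wiener_loop_series)
  have s\<Phi>z: "loop_series \<Phi>z (\<lambda>k. cscale (1/2) (loop_coeff \<Phi>x k - cscale \<i> (loop_coeff \<Phi>y k)))"
    and s\<Phi>b: "loop_series \<Phi>b (\<lambda>k. cscale (1/2) (loop_coeff \<Phi>x k + cscale \<i> (loop_coeff \<Phi>y k)))"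
    and sVz: "loop_series Vz (\<lambda>k. cscale (1/2) (loop_coeff Vx k - cscale \<i> (loop_coeff Vy k)))"
    and sVb: "loop_series Vb (\<lambda>k. cscale (1/2) (loop_coeff Vx k + cscale \<i> (loop_coeff Vy k)))"
    unfolding \<Phi>z_def \<Phi>b_def Vz_def Vb_def
    by (intro loop_series_cscale loop_series_add loop_series_diff wiener_loop_series w)+
  have detV: "det (V l) = 1" if "norm l = 1" for l using V_SL2 that by (simp add: loop_SL2_def)
  have eqb: "\<Phi>b l ** V l = - (\<Phi> l ** Vb l)" and eqz: "\<Phi>z l ** V l = \<Phi> l ** V l ** \<eta> l - \<Phi> l ** Vz l" if l: "norm l = 1" for l
  proof -
    have "\<Phi>b l ** V l + \<Phi> l ** Vb l = cscale (1/2) ((\<Phi>x l ** V l + \<Phi> l ** Vx l) + cscale \<i> (\<Phi>y l ** V l + \<Phi> l ** Vy l))"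
      by (simp add: \<Phi>b_def Vb_def mat2_eq_iff algebra_simps)
    also have "\<dots> = 0" unfolding eqx[OF l] eqy[OF l] by (simp add: mat2_eq_iff algebra_simps)
    finally show "\<Phi>b l ** V l = - (\<Phi> l ** Vb l)" by (simp add: add_eq_0_iff2)
    have "\<Phi>z l ** V l + \<Phi> l ** Vz l = cscale (1/2) ((\<Phi>x l ** V l + \<Phi> l ** Vx l) - cscale \<i> (\<Phi>y l ** V l + \<Phi> l ** Vy l))"
      by (simp add: \<Phi>z_def Vz_def mat2_eq_iff algebra_simps)
    also have "\<dots> = \<Phi> l ** V l ** \<eta> l" unfolding eqx[OF l] eqy[OF l] by (simp add: mat2_eq_iff algebra_simps)
    finally show "\<Phi>z l ** V l = \<Phi> l ** V l ** \<eta> l - \<Phi> l ** Vz l" by (simp add: eq_diff_eq)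
  qed
  define P where "P = (\<lambda>l. hconj (\<Phi> l) ** \<Phi>z l)"
  define R where "R = (\<lambda>l. hconj (\<Phi> l) ** \<Phi>b l)"
  have R_eq: "R l = cscale (-1) (Vb l ** adjugate (V l))" and P_eq: "P l = V l ** \<eta> l ** adjugate (V l) - Vz l ** adjugate (V l)"
    if l: "norm l = 1" for l
  proof -
    have cancel: "hconj (\<Phi> l) ** (\<Phi> l ** X) = X" for X :: mat2
      using loop_SL2_tau3_unitary(1)[OF \<Phi> l] by (simp add: matrix_mul_assoc)
    have undo: "X ** V l ** adjugate (V l) = X" for X :: mat2
      using adjugate_inverse(1)[OF detV[OF l]] by (simp flip: matrix_mul_assoc)
    have "R l ** V l = hconj (\<Phi> l) ** (\<Phi>b l ** V l)" by (simp add: R_def matrix_mul_assoc)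
    also have "\<dots> = cscale (-1) (hconj (\<Phi> l) ** (\<Phi> l ** Vb l))" unfolding eqb[OF l] by (simp add: mat2_eq_iff algebra_simps)
    finally have "R l ** V l = cscale (-1) (Vb l)" unfolding cancel .
    then have "R l ** V l ** adjugate (V l) = cscale (-1) (Vb l) ** adjugate (V l)" by (simp only:)
    then show "R l = cscale (-1) (Vb l ** adjugate (V l))" unfolding undo cscale_mult_left .
    have "P l ** V l = hconj (\<Phi> l) ** (\<Phi>z l ** V l)" by (simp add: P_def matrix_mul_assoc)
    also have "\<dots> = hconj (\<Phi> l) ** (\<Phi> l ** (V l ** \<eta> l)) - hconj (\<Phi> l) ** (\<Phi> l ** Vz l)"
      unfolding eqz[OF l] by (simp add: mat2_eq_iff algebra_simps)
    finally have "P l ** V l = V l ** \<eta> l - Vz l" unfolding cancel .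
    then have "P l ** V l ** adjugate (V l) = (V l ** \<eta> l - Vz l) ** adjugate (V l)" by (simp only:)
    then show "P l = V l ** \<eta> l ** adjugate (V l) - Vz l ** adjugate (V l)"
      unfolding undo by (simp add: mat2_eq_iff algebra_simps)
  qed
  have skew: "P l = cscale (-1) (hconj (R l))" if l: "norm l = 1" for l
  proof -
    have a: "hconj (\<Phi>x l) ** \<Phi> l = cscale (-1) (hconj (\<Phi> l) ** \<Phi>x l)"
      and b: "hconj (\<Phi>y l) ** \<Phi> l = cscale (-1) (hconj (\<Phi> l) ** \<Phi>y l)"
      using ux[OF l] uy[OF l] by (simp_all add: mat2_eq_iff add_eq_0_iff2)
    have "hconj (R l) = cscale (1/2) (hconj (\<Phi>x l) ** \<Phi> l - cscale \<i> (hconj (\<Phi>y l) ** \<Phi> l))"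
      by (simp add: R_def \<Phi>b_def mat2_eq_iff algebra_simps)
    also have "\<dots> = cscale (-1) (P l)" unfolding a b by (simp add: P_def \<Phi>z_def mat2_eq_iff algebra_simps)
    finally show ?thesis by (simp add: mat2_eq_iff)
  qed
  have sA: "loop_series (\<lambda>l. adjugate (V l)) (\<lambda>k. adjugate (loop_coeff V k))"
    by (rule loop_series_adjugate[OF sV])
  have V0: "k < 0 \<Longrightarrow> loop_coeff V k = 0" for k by (rule plus_loop_coeff_neg[OF V])
  then have A0: "k < 0 \<Longrightarrow> adjugate (loop_coeff V k) = 0" for k by (simp add: mat2_eq_iff)
  obtain E1 where E1: "loop_series (\<lambda>l. Vb l ** adjugate (V l)) E1"
    and E1': "\<And>m n. (\<And>k. k < m \<Longrightarrow> cscale (1/2) (loop_coeff Vx k + cscale \<i> (loop_coeff Vy k)) = 0) \<Longrightarrow>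
      (\<And>k. k < n \<Longrightarrow> adjugate (loop_coeff V k) = 0) \<Longrightarrow>
      E1 (m + n) = cscale (1/2) (loop_coeff Vx m + cscale \<i> (loop_coeff Vy m)) ** adjugate (loop_coeff V n) \<and> (\<forall>k<m + n. E1 k = 0)"
    using loop_series_mult[OF sVb sA] by blast
  have E1: "loop_series (\<lambda>l. Vb l ** adjugate (V l)) E1" "E1 0 = S" "\<And>k. k < 0 \<Longrightarrow> E1 k = 0"
    using E1 E1'[of 0 0] A0 Vneg by (auto simp: S_def mat2_eq_iff)
  obtain E2 where E2: "loop_series (\<lambda>l. Vz l ** adjugate (V l)) E2"
    and E2': "\<And>m n. (\<And>k. k < m \<Longrightarrow> cscale (1/2) (loop_coeff Vx k - cscale \<i> (loop_coeff Vy k)) = 0) \<Longrightarrow>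
      (\<And>k. k < n \<Longrightarrow> adjugate (loop_coeff V k) = 0) \<Longrightarrow>
      E2 (m + n) = cscale (1/2) (loop_coeff Vx m - cscale \<i> (loop_coeff Vy m)) ** adjugate (loop_coeff V n) \<and> (\<forall>k<m + n. E2 k = 0)"
    using loop_series_mult[OF sVz sA] by blast
  have E2: "loop_series (\<lambda>l. Vz l ** adjugate (V l)) E2" "\<And>k. k < 0 \<Longrightarrow> E2 k = 0"
    using E2 E2'[of 0 0] A0 Vneg by (auto simp: mat2_eq_iff)
  obtain E3 where E3: "loop_series (\<lambda>l. V l ** \<eta> l) E3"
    and E3': "\<And>m n. (\<And>k. k < m \<Longrightarrow> loop_coeff V k = 0) \<Longrightarrow> (\<And>k. k < n \<Longrightarrow> N k = 0) \<Longrightarrow>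
      E3 (m + n) = loop_coeff V m ** N n \<and> (\<forall>k<m + n. E3 k = 0)"
    using loop_series_mult[OF sV \<eta>(1)] by blast
  have E3: "loop_series (\<lambda>l. V l ** \<eta> l) E3" "E3 (-1) = loop_coeff V 0 ** N (-1)" "\<And>k. k < -1 \<Longrightarrow> E3 k = 0"
    using E3 E3'[of 0 "-1"] V0 \<eta>(2) by auto
  obtain E4 where E4: "loop_series (\<lambda>l. V l ** \<eta> l ** adjugate (V l)) E4"
    and E4': "\<And>m n. (\<And>k. k < m \<Longrightarrow> E3 k = 0) \<Longrightarrow> (\<And>k. k < n \<Longrightarrow> adjugate (loop_coeff V k) = 0) \<Longrightarrow>
      E4 (m + n) = E3 m ** adjugate (loop_coeff V n) \<and> (\<forall>k<m + n. E4 k = 0)"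
    using loop_series_mult[OF E3(1) sA] by blast
  have E4: "loop_series (\<lambda>l. V l ** \<eta> l ** adjugate (V l)) E4" "E4 (-1) = P1" "\<And>k. k < -1 \<Longrightarrow> E4 k = 0"
    using E4 E4'[of "-1" 0] E3 A0 by (auto simp: P1_def)
  have sR: "loop_series R (\<lambda>k. cscale (-1) (E1 k))"
    by (rule loop_series_cong[OF loop_series_cscale[OF E1(1), of "-1"]]) (simp add: R_eq)
  have sP: "loop_series P (\<lambda>k. E4 k - E2 k)"
    by (rule loop_series_cong[OF loop_series_diff[OF E4(1) E2(1)]]) (simp add: P_eq)
  have sP': "loop_series P (\<lambda>k. cscale (-1) (hconj (cscale (-1) (E1 (- k)))))"
    by (rule loop_series_cong[OF loop_series_cscale[OF loop_series_hconj[OF sR], of "-1"]]) (simp add: skew)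
  have coeff: "E4 k - E2 k = hconj (E1 (- k))" for k
    using loop_coeff_series[OF sP, of k] loop_coeff_series[OF sP', of k] by (simp add: mat2_eq_iff)
  have P_zero: "E4 k - E2 k = 0" if "k \<notin> {-1, 0}" for k
  proof (cases "k < -1")
    case True
    then show ?thesis using E4(3) E2(2) by simp
  next
    case False
    then have "k > 0" using that by auto
    then show ?thesis unfolding coeff using E1(3)[of "- k"] by (simp add: mat2_eq_iff)
  qed
  have P_form: "P l = cscale (inverse l) P1 + hconj S" if "norm l = 1" for l
    using loop_series_laurent[OF sP P_zero that] E4(2) E2(2)[of "-1"] coeff[of 0] E1(2) by simp
  have z_form: "\<Phi>z l = cscale (l powi -1) (\<Phi> l ** P1) + \<Phi> l ** hconj S" if l: "norm l = 1" for l
  proof -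
    have "\<Phi> l ** P l = \<Phi>z l"
      using loop_SL2_tau3_unitary(2)[OF \<Phi> l] by (simp add: P_def matrix_mul_assoc)
    moreover have "\<Phi> l ** P l = cscale (l powi -1) (\<Phi> l ** P1) + \<Phi> l ** hconj S"
      unfolding P_form[OF l] by (simp add: power_int_minus mat2_eq_iff algebra_simps)
    ultimately show ?thesis by simp
  qed
  have b_form: "\<Phi>b l = cscale (-1) (\<Phi> l ** S + cscale (l powi 1) (\<Phi> l ** hconj P1))" if l: "norm l = 1" for l
  proof -
    have il: "cnj (inverse l) = l"
      using l complex_norm_square[of l] by (metis inverse_unique mult.commute of_real_1 one_power2 complex_cnj_inverse complex_cnj_cnj)
    have "\<Phi> l ** R l = \<Phi>b l"
      using loop_SL2_tau3_unitary(2)[OF \<Phi> l] by (simp add: R_def matrix_mul_assoc)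
    moreover have "R l = cscale (-1) (hconj (P l))" unfolding skew[OF l] by (simp add: mat2_eq_iff)
    moreover have "hconj (P l) = cscale l (hconj P1) + S"
      unfolding P_form[OF l] using il by (simp add: mat2_eq_iff)
    ultimately have "\<Phi>b l = \<Phi> l ** cscale (-1) (cscale l (hconj P1) + S)" by simp
    then show ?thesis by (simp add: mat2_eq_iff algebra_simps)
  qed
  have "loop_series \<Phi>z (\<lambda>k. loop_coeff \<Phi> (k - -1) ** P1 + loop_coeff \<Phi> k ** hconj S)"
    by (rule loop_series_cong[OF loop_series_add[OF
          loop_series_powi[OF loop_series_mult_const[OF s\<Phi>]] loop_series_mult_const[OF s\<Phi>]]])
      (simp only: z_form)
  from loop_coeff_series[OF this, of k] loop_coeff_series[OF s\<Phi>z, of k]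
  show "cscale (1/2) (loop_coeff \<Phi>x k - cscale \<i> (loop_coeff \<Phi>y k)) =
      loop_coeff \<Phi> (k + 1) ** P1 + loop_coeff \<Phi> k ** hconj S" by simp
  have "loop_series \<Phi>b (\<lambda>k. cscale (-1) (loop_coeff \<Phi> k ** S + loop_coeff \<Phi> (k - 1) ** hconj P1))"
    by (rule loop_series_cong[OF loop_series_cscale[OF loop_series_add[OF
          loop_series_mult_const[OF s\<Phi>] loop_series_powi[OF loop_series_mult_const[OF s\<Phi>]]]]])
      (simp only: b_form)
  from loop_coeff_series[OF this, of k] loop_coeff_series[OF s\<Phi>b, of k]
  show "cscale (1/2) (loop_coeff \<Phi>x k + cscale \<i> (loop_coeff \<Phi>y k)) =
      - (loop_coeff \<Phi> k ** S + loop_coeff \<Phi> (k - 1) ** hconj P1)" by (simp add: mat2_eq_iff)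
qed

text \<open>At the base point the factors are inverse to each other, so that the unitary factor extends to the
  disc and, being its own reflection, also to the outside.\<close>

lemma unitary_inverse_plus_constant:
  assumes \<Phi>: "loop_SL2_tau3 \<Phi>" and V: "loop_SL2_plus V"
    and inv: "\<And>l. norm l = 1 \<Longrightarrow> \<Phi> l ** V l = mat 1" and k: "k \<noteq> 0"
  shows "loop_coeff \<Phi> k = 0"
proof -
  have V_SL2: "loop_SL2 V" using V by (simp add: loop_SL2_plus_def)
  have sV: "loop_series V (loop_coeff V)" using V_SL2 by (simp add: loop_SL2_def wiener_loop_series)
  have s\<Phi>: "loop_series \<Phi> (loop_coeff \<Phi>)"
    using \<Phi> by (simp add: loop_SL2_tau3_def loop_SL2_def wiener_loop_series)
  have V0: "j < 0 \<Longrightarrow> loop_coeff V j = 0" for j by (rule plus_loop_coeff_neg[OF V])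
  show ?thesis
  proof (cases "k < 0")
    case True
    have "adjugate (V l) = \<Phi> l" if l: "norm l = 1" for l
    proof -
      have "det (V l) = 1" using V_SL2 l by (simp add: loop_SL2_def)
      then have "\<Phi> l ** (V l ** adjugate (V l)) = \<Phi> l" using adjugate_inverse by simp
      then show ?thesis using inv[OF l] by (simp add: matrix_mul_assoc)
    qed
    then have "loop_series \<Phi> (\<lambda>k. adjugate (loop_coeff V k))"
      by (rule loop_series_cong[OF loop_series_adjugate[OF sV]])
    from loop_coeff_series[OF this, of k] show ?thesis using V0[OF True] by (simp add: mat2_eq_iff)
  next
    case False
    have "hconj (\<Phi> l) = V l" if l: "norm l = 1" for l
    proof -
      have "hconj (\<Phi> l) ** (\<Phi> l ** V l) = V l"
        using loop_SL2_tau3_unitary(1)[OF \<Phi> l] by (simp add: matrix_mul_assoc)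
      then show ?thesis using inv[OF l] by simp
    qed
    then have "loop_series V (\<lambda>k. hconj (loop_coeff \<Phi> (- k)))"
      by (rule loop_series_cong[OF loop_series_hconj[OF s\<Phi>]])
    from loop_coeff_series[OF this, of "- k"] have "hconj (loop_coeff \<Phi> k) = 0" using V0[of "- k"] k False by simp
    then show ?thesis by (simp add: mat2_eq_iff)
  qed
qed

lemma wirtinger_split:
  "Re h *\<^sub>R X + Im h *\<^sub>R Y = cscale h (cscale (1/2) (X - cscale \<i> Y)) + cscale (cnj h) (cscale (1/2) (X + cscale \<i> Y))"
proof -
  have "Re h *\<^sub>R x + Im h *\<^sub>R y = h * (1/2 * (x - \<i> * y)) + cnj h * (1/2 * (x + \<i> * y))" for x y :: complex
    by (simp add: complex_eq_iff field_simps)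
  then show ?thesis by (simp add: mat2_eq_iff)
qed

lemma has_derivative_constant_on_open:
  assumes "(f has_derivative f') (at z)" "open D" "z \<in> D" "\<And>w. w \<in> D \<Longrightarrow> f w = c"
  shows "f' h = 0"
proof -
  have "((\<lambda>_. c) has_derivative (\<lambda>_. 0)) (at z)" by simp
  then have "(f has_derivative (\<lambda>_. 0)) (at z)"
    by (rule has_derivative_transform_within_open[OF _ assms(2,3)]) (simp add: assms(4))
  with assms(1) have "f' = (\<lambda>_. 0)" by (rule has_derivative_unique)
  then show ?thesis by simp
qed

text \<open>The coefficients of \<open>V\<close> that vanish identically have vanishing derivatives, so the constant term of
  \<open>(\<partial>V/\<partial>(cnj z)) V\<^sup>-\<^sup>1\<close> is diagonal; it is trace-free because the diagonal entries of \<open>V\<close> at \<open>\<lambda> = 0\<close> have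
  product one. Its first entry is the logarithmic derivative \<open>s\<close> of \<open>v\<close>.\<close>

lemma iwasawa_factor_coefficients:
  fixes \<eta> :: "int \<Rightarrow> complex \<Rightarrow> mat2" and C \<Phi> V :: "complex \<Rightarrow> complex \<Rightarrow> mat2"
  assumes D: "open D" and \<eta>: "holomorphic_potential D \<eta>"
    and dC: "\<And>z l. z \<in> D \<Longrightarrow> norm l = 1 \<Longrightarrow>
           ((\<lambda>z. C z l) has_derivative (\<lambda>h. C z l ** cscale h (potential_at \<eta> z l))) (at z)"
    and \<Phi>: "\<And>z. z \<in> D \<Longrightarrow> loop_SL2_tau3 (\<Phi> z)" and V: "\<And>z. z \<in> D \<Longrightarrow> loop_SL2_plus (V z)"
    and smooth: "loop_smooth_on D \<Phi>" "loop_smooth_on D V"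
    and split: "\<And>z l. z \<in> D \<Longrightarrow> norm l = 1 \<Longrightarrow> C z l = \<Phi> z l ** V z l"
  defines "v \<equiv> \<lambda>z. loop_coeff (V z) 0 $ 1 $ 1"
    and "s \<equiv> \<lambda>z. (dx (\<lambda>z. loop_coeff (V z) 0 $ 1 $ 1) z + \<i> * dy (\<lambda>z. loop_coeff (V z) 0 $ 1 $ 1) z) / (2 * loop_coeff (V z) 0 $ 1 $ 1)"
    and "P1 \<equiv> \<lambda>z. mat2 0 ((loop_coeff (V z) 0 $ 1 $ 1)\<^sup>2 * \<eta> (-1) z $ 1 $ 2) (\<eta> (-1) z $ 2 $ 1 / (loop_coeff (V z) 0 $ 1 $ 1)\<^sup>2) 0"
  shows "Ck_on n D v" and "z \<in> D \<Longrightarrow> v z \<noteq> 0"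
    and "z \<in> D \<Longrightarrow> ((\<lambda>z. loop_coeff (\<Phi> z) k) has_derivative
      (\<lambda>h. cscale h (loop_coeff (\<Phi> z) (k + 1) ** P1 z + loop_coeff (\<Phi> z) k ** diag2 (cnj (s z)) (- cnj (s z))) -
           cscale (cnj h) (loop_coeff (\<Phi> z) k ** diag2 (s z) (- s z) + loop_coeff (\<Phi> z) (k - 1) ** hconj (P1 z)))) (at z)"
proof -
  show v_smooth: "Ck_on n D v" for n
    unfolding v_def using smooth(2) D
    by (intro Ck_on_bounded_linear[OF D bounded_linear_mat2_nth] Ck_on_loop_coeff) (auto simp: loop_smooth_on_def)
  have V_SL2: "loop_SL2 (V z)" if "z \<in> D" for z using V[OF that] by (simp add: loop_SL2_plus_def)
  have sV: "loop_series (V z) (loop_coeff (V z))" if "z \<in> D" for z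
    using V_SL2[OF that] by (simp add: loop_SL2_def wiener_loop_series)
  have Vneg: "loop_coeff (V z) k = 0" if "z \<in> D" "k < 0" for z k by (rule plus_loop_coeff_neg[OF V[OF that(1)] that(2)])
  have off: "loop_coeff (V z) 0 $ 1 $ 2 = 0" "loop_coeff (V z) 0 $ 2 $ 1 = 0" if "z \<in> D" for z
    using twisted_coeff_0[OF sV[OF that]] V_SL2[OF that] by (auto simp: loop_SL2_def)
  have diag: "v z * loop_coeff (V z) 0 $ 2 $ 2 = 1" if z: "z \<in> D" for z
  proof -
    obtain E where E: "loop_series (\<lambda>l. V z l ** adjugate (V z l)) E"
      and E': "\<And>m n. (\<And>k. k < m \<Longrightarrow> loop_coeff (V z) k = 0) \<Longrightarrow> (\<And>k. k < n \<Longrightarrow> adjugate (loop_coeff (V z) k) = 0) \<Longrightarrow>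
        E (m + n) = loop_coeff (V z) m ** adjugate (loop_coeff (V z) n) \<and> (\<forall>k<m + n. E k = 0)"
      using loop_series_mult[OF sV[OF z] loop_series_adjugate[OF sV[OF z]]] by blast
    have E0: "E 0 = loop_coeff (V z) 0 ** adjugate (loop_coeff (V z) 0)"
      using E'[of 0 0] Vneg[OF z] by (simp add: mat2_eq_iff)
    have "loop_series (\<lambda>l. V z l ** adjugate (V z l)) (\<lambda>k. if k = 0 then mat 1 else 0)"
      by (rule loop_series_cong[OF loop_series_const])
        (use V_SL2[OF z] adjugate_inverse(1) in \<open>simp add: loop_SL2_def\<close>)
    from loop_coeff_series[OF this, of 0] loop_coeff_series[OF E, of 0] E0
    have "loop_coeff (V z) 0 ** adjugate (loop_coeff (V z) 0) = mat 1" by simp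
    then show ?thesis using off[OF z] by (simp add: mat2_eq_iff v_def)
  qed
  show v0: "v z \<noteq> 0" if "z \<in> D" for z using diag[OF that] by auto
  obtain \<Phi>x \<Phi>y where \<Phi>xy: "loop_Ck_on 0 D \<Phi>x" "loop_Ck_on 0 D \<Phi>y"
    and \<Phi>lim: "\<And>z. z \<in> D \<Longrightarrow> ((\<lambda>h. loop_norm (\<lambda>l. \<Phi> (z + h) l - \<Phi> z l - Re h *\<^sub>R \<Phi>x z l - Im h *\<^sub>R \<Phi>y z l) / norm h) \<longlongrightarrow> 0) (at 0)"
    using smooth(1)[unfolded loop_smooth_on_def, rule_format, of "Suc 0"] by (simp only: loop_Ck_on.simps(2)) blast
  obtain Vx Vy where Vxy: "loop_Ck_on 0 D Vx" "loop_Ck_on 0 D Vy"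
    and Vlim: "\<And>z. z \<in> D \<Longrightarrow> ((\<lambda>h. loop_norm (\<lambda>l. V (z + h) l - V z l - Re h *\<^sub>R Vx z l - Im h *\<^sub>R Vy z l) / norm h) \<longlongrightarrow> 0) (at 0)"
    using smooth(2)[unfolded loop_smooth_on_def, rule_format, of "Suc 0"] by (simp only: loop_Ck_on.simps(2)) blast
  have w\<Phi>: "wiener_loop (\<Phi> z)" and wV: "wiener_loop (V z)" if "z \<in> D" for z
    using \<Phi>[OF that] V_SL2[OF that] by (auto simp: loop_SL2_tau3_def loop_SL2_def)
  assume z: "z \<in> D"
  have wxy: "wiener_loop (\<Phi>x z)" "wiener_loop (\<Phi>y z)" "wiener_loop (Vx z)" "wiener_loop (Vy z)"
    using \<Phi>xy Vxy loop_Ck_on_wiener z by blast+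
  have d\<Phi>: "((\<lambda>w. \<Phi> w l) has_derivative (\<lambda>h. Re h *\<^sub>R \<Phi>x z l + Im h *\<^sub>R \<Phi>y z l)) (at z)" if "norm l = 1" for l
    by (rule loop_eval_has_derivative[OF D z w\<Phi> wxy(1,2) \<Phi>lim[OF z] that])
  have dV: "((\<lambda>w. V w l) has_derivative (\<lambda>h. Re h *\<^sub>R Vx z l + Im h *\<^sub>R Vy z l)) (at z)" if "norm l = 1" for l
    by (rule loop_eval_has_derivative[OF D z wV wxy(3,4) Vlim[OF z] that])
  have dVk: "((\<lambda>w. loop_coeff (V w) k) has_derivative (\<lambda>h. Re h *\<^sub>R loop_coeff (Vx z) k + Im h *\<^sub>R loop_coeff (Vy z) k)) (at z)" for k
    by (rule loop_coeff_has_derivative[OF D z wV wxy(3,4) Vlim[OF z]])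
  have d\<Phi>k: "((\<lambda>w. loop_coeff (\<Phi> w) k) has_derivative (\<lambda>h. Re h *\<^sub>R loop_coeff (\<Phi>x z) k + Im h *\<^sub>R loop_coeff (\<Phi>y z) k)) (at z)" for k
    by (rule loop_coeff_has_derivative[OF D z w\<Phi> wxy(1,2) \<Phi>lim[OF z]])
  have neg: "loop_coeff (Vx z) k = 0" "loop_coeff (Vy z) k = 0" if "k < 0" for k
    using has_derivative_constant_on_open[OF dVk[of k] D z Vneg[OF _ that], of 1]
      has_derivative_constant_on_open[OF dVk[of k] D z Vneg[OF _ that], of \<i>] by simp_all
  have eq: "\<Phi>x z l ** V z l + \<Phi> z l ** Vx z l = \<Phi> z l ** V z l ** potential_at \<eta> z l"
    "\<Phi>y z l ** V z l + \<Phi> z l ** Vy z l = cscale \<i> (\<Phi> z l ** V z l ** potential_at \<eta> z l)" if l: "norm l = 1" for l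
  proof -
    have "((\<lambda>w. \<Phi> w l ** V w l) has_derivative
      (\<lambda>h. \<Phi> z l ** (Re h *\<^sub>R Vx z l + Im h *\<^sub>R Vy z l) + (Re h *\<^sub>R \<Phi>x z l + Im h *\<^sub>R \<Phi>y z l) ** V z l)) (at z)"
      by (rule bounded_bilinear.FDERIV[OF bounded_bilinear_mat2_mult d\<Phi>[OF l] dV[OF l]])
    then have "((\<lambda>w. C w l) has_derivative
      (\<lambda>h. \<Phi> z l ** (Re h *\<^sub>R Vx z l + Im h *\<^sub>R Vy z l) + (Re h *\<^sub>R \<Phi>x z l + Im h *\<^sub>R \<Phi>y z l) ** V z l)) (at z)"
      by (rule has_derivative_transform_within_open[OF _ D z]) (simp add: split l)
    from has_derivative_unique[OF this dC[OF z l]]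
    have *: "\<Phi> z l ** (Re h *\<^sub>R Vx z l + Im h *\<^sub>R Vy z l) + (Re h *\<^sub>R \<Phi>x z l + Im h *\<^sub>R \<Phi>y z l) ** V z l =
        \<Phi> z l ** V z l ** cscale h (potential_at \<eta> z l)" for h
      unfolding split[OF z l] by (rule fun_cong)
    show "\<Phi>x z l ** V z l + \<Phi> z l ** Vx z l = \<Phi> z l ** V z l ** potential_at \<eta> z l"
      using *[of 1] by (simp add: mat2_eq_iff algebra_simps)
    show "\<Phi>y z l ** V z l + \<Phi> z l ** Vy z l = cscale \<i> (\<Phi> z l ** V z l ** potential_at \<eta> z l)"
      using *[of \<i>] by (simp add: mat2_eq_iff algebra_simps)
  qed
  have un: "hconj (\<Phi>x z l) ** \<Phi> z l + hconj (\<Phi> z l) ** \<Phi>x z l = 0"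
    "hconj (\<Phi>y z l) ** \<Phi> z l + hconj (\<Phi> z l) ** \<Phi>y z l = 0" if l: "norm l = 1" for l
  proof -
    have "((\<lambda>w. hconj (\<Phi> w l) ** \<Phi> w l) has_derivative
      (\<lambda>h. hconj (\<Phi> z l) ** (Re h *\<^sub>R \<Phi>x z l + Im h *\<^sub>R \<Phi>y z l) + hconj (Re h *\<^sub>R \<Phi>x z l + Im h *\<^sub>R \<Phi>y z l) ** \<Phi> z l)) (at z)"
      by (rule bounded_bilinear.FDERIV[OF bounded_bilinear_mat2_mult
            bounded_linear.has_derivative[OF bounded_linear_hconj d\<Phi>[OF l]] d\<Phi>[OF l]])
    note zero = has_derivative_constant_on_open[OF this D z loop_SL2_tau3_unitary(1)[OF \<Phi> l]]
    show "hconj (\<Phi>x z l) ** \<Phi> z l + hconj (\<Phi> z l) ** \<Phi>x z l = 0" using zero[of 1] by (simp add: add.commute)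
    show "hconj (\<Phi>y z l) ** \<Phi> z l + hconj (\<Phi> z l) ** \<Phi>y z l = 0" using zero[of \<i>] by (simp add: add.commute)
  qed
  define N where "N = (\<lambda>k. if k \<ge> -1 then \<eta> k z else 0)"
  have sN: "loop_series (potential_at \<eta> z) N" unfolding N_def by (rule potential_series[OF \<eta> z])
  define S where "S = cscale (1/2) (loop_coeff (Vx z) 0 + cscale \<i> (loop_coeff (Vy z) 0)) ** adjugate (loop_coeff (V z) 0)"
  have Nneg: "N k = 0" if "k < -1" for k using that by (simp add: N_def)
  note mc = maurer_cartan_three_terms[OF \<Phi>[OF z] V[OF z] wxy neg sN Nneg eq un, folded S_def]
  have P1_eq: "loop_coeff (V z) 0 ** N (-1) ** adjugate (loop_coeff (V z) 0) = P1 z"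
  proof -
    have "\<eta> (-1) z $ 1 $ 1 = 0" "\<eta> (-1) z $ 2 $ 2 = 0"
      using \<eta> z unfolding holomorphic_potential_def by auto
    moreover have "loop_coeff (V z) 0 $ 2 $ 2 = 1 / v z" using diag[OF z] v0[OF z] by (simp add: field_simps)
    ultimately show ?thesis
      using off[OF z] v0[OF z] by (simp add: mat2_eq_iff N_def P1_def v_def power2_eq_square field_simps)
  qed
  have S_eq: "S = diag2 (s z) (- s z)"
  proof -
    let ?w = "\<lambda>z. loop_coeff (V z) 0 $ 2 $ 2"
    have entry: "((\<lambda>w. loop_coeff (V w) 0 $ i $ j) has_derivative
        (\<lambda>h. Re h *\<^sub>R loop_coeff (Vx z) 0 $ i $ j + Im h *\<^sub>R loop_coeff (Vy z) 0 $ i $ j)) (at z)" for i j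
      using bounded_linear.has_derivative[OF bounded_linear_mat2_nth dVk[of 0]] by simp
    have vx: "dx v z = loop_coeff (Vx z) 0 $ 1 $ 1" "dy v z = loop_coeff (Vy z) 0 $ 1 $ 1"
      unfolding v_def using dx_dy_eqI[OF entry] by auto
    have offx: "loop_coeff (Vx z) 0 $ 1 $ 2 = 0" "loop_coeff (Vx z) 0 $ 2 $ 1 = 0"
      "loop_coeff (Vy z) 0 $ 1 $ 2 = 0" "loop_coeff (Vy z) 0 $ 2 $ 1 = 0"
      using has_derivative_constant_on_open[OF entry[of 1 2] D z off(1), of 1]
        has_derivative_constant_on_open[OF entry[of 1 2] D z off(1), of \<i>]
        has_derivative_constant_on_open[OF entry[of 2 1] D z off(2), of 1]
        has_derivative_constant_on_open[OF entry[of 2 1] D z off(2), of \<i>] by simp_all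
    note prod = has_derivative_constant_on_open[OF has_derivative_mult[OF entry[of 1 1] entry[of 2 2]] D z diag[unfolded v_def]]
    have px: "v z * loop_coeff (Vx z) 0 $ 2 $ 2 = - (dx v z * ?w z)"
      and py: "v z * loop_coeff (Vy z) 0 $ 2 $ 2 = - (dy v z * ?w z)"
      using prod[of 1] prod[of \<i>] vx by (simp_all add: v_def add_eq_0_iff2)
    have w: "?w z = 1 / v z" using diag[OF z] v0[OF z] by (simp add: field_simps)
    have sz: "s z = (dx v z + \<i> * dy v z) / (2 * v z)" by (simp add: s_def v_def)
    have "S $ 1 $ 1 = s z"
      using offx off[OF z] by (simp add: S_def sz w vx v_def[symmetric] add_divide_distrib)
    moreover have "S $ 2 $ 2 = - s z"
    proof -
      have "S $ 2 $ 2 = 1 / 2 * (v z * loop_coeff (Vx z) 0 $ 2 $ 2 + \<i> * (v z * loop_coeff (Vy z) 0 $ 2 $ 2))"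
        using offx off[OF z] by (simp add: S_def v_def algebra_simps)
      also have "\<dots> = - s z" unfolding px py w using v0[OF z] by (simp add: sz field_simps)
      finally show ?thesis .
    qed
    moreover have "S $ 1 $ 2 = 0" "S $ 2 $ 1 = 0" using offx off[OF z] by (simp_all add: S_def)
    ultimately show ?thesis by (simp add: mat2_eq_iff)
  qed
  have hS: "hconj S = diag2 (cnj (s z)) (- cnj (s z))" by (simp add: S_eq mat2_eq_iff)
  have mz: "cscale (1/2) (loop_coeff (\<Phi>x z) k - cscale \<i> (loop_coeff (\<Phi>y z) k)) =
      loop_coeff (\<Phi> z) (k + 1) ** P1 z + loop_coeff (\<Phi> z) k ** diag2 (cnj (s z)) (- cnj (s z))"
    and mb: "cscale (1/2) (loop_coeff (\<Phi>x z) k + cscale \<i> (loop_coeff (\<Phi>y z) k)) =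
      - (loop_coeff (\<Phi> z) k ** diag2 (s z) (- s z) + loop_coeff (\<Phi> z) (k - 1) ** hconj (P1 z))" for k
    using mc[of k] unfolding P1_eq hS unfolding S_eq by blast+
  have "(\<lambda>h. Re h *\<^sub>R loop_coeff (\<Phi>x z) k + Im h *\<^sub>R loop_coeff (\<Phi>y z) k) =
    (\<lambda>h. cscale h (loop_coeff (\<Phi> z) (k + 1) ** P1 z + loop_coeff (\<Phi> z) k ** diag2 (cnj (s z)) (- cnj (s z))) -
           cscale (cnj h) (loop_coeff (\<Phi> z) k ** diag2 (s z) (- s z) + loop_coeff (\<Phi> z) (k - 1) ** hconj (P1 z)))"
    unfolding wirtinger_split mz mb by (simp add: fun_eq_iff mat2_eq_iff algebra_simps)
  then show "((\<lambda>z. loop_coeff (\<Phi> z) k) has_derivative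
      (\<lambda>h. cscale h (loop_coeff (\<Phi> z) (k + 1) ** P1 z + loop_coeff (\<Phi> z) k ** diag2 (cnj (s z)) (- cnj (s z))) -
           cscale (cnj h) (loop_coeff (\<Phi> z) k ** diag2 (s z) (- s z) + loop_coeff (\<Phi> z) (k - 1) ** hconj (P1 z)))) (at z)"
    using d\<Phi>k[of k] by simp
qed

section \<open>The gauge and the extended frame\<close>

text \<open>The integral of a function that is not integrable is \<open>0\<close>, which obeys the bound as well.\<close>

lemma norm_fourier_coeff_bounded:
  assumes "\<And>l. norm l = 1 \<Longrightarrow> norm (f l) \<le> 1"
  shows "norm (fourier_coeff f k) \<le> 1"
proof -
  let ?g = "\<lambda>t. f (cis t) * cis (- (of_int k * t))"
  have "norm (integral {0..2 * pi} ?g) \<le> 2 * pi"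
  proof (cases "?g integrable_on {0..2 * pi}")
    case True
    have "norm (integral {0..2 * pi} ?g) \<le> 1 * measure lborel (cbox 0 (2 * pi))"
    proof (rule has_integral_bound)
      show "(?g has_integral integral {0..2 * pi} ?g) (cbox 0 (2 * pi))"
        using integrable_integral[OF True] by simp
      show "norm (?g t) \<le> 1" for t using assms[of "cis t"] by (simp add: norm_mult)
    qed simp
    then show ?thesis by simp
  next
    case False
    then show ?thesis by (simp add: not_integrable_integral)
  qed
  then show ?thesis by (simp add: fourier_coeff_def norm_divide norm_mult)
qed

lemma unitary_entry_le:
  assumes "hconj A ** A = mat 1"
  shows "norm (A $ i $ j) \<le> 1"
proof -
  have "(hconj A ** A) $ j $ j = 1" unfolding assms by (simp add: mat_def)
  then have "complex_of_real ((norm (A $ 1 $ j))\<^sup>2 + (norm (A $ 2 $ j))\<^sup>2) = 1"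
    unfolding of_real_add complex_norm_square by (simp add: mult.commute)
  then have s: "(norm (A $ 1 $ j))\<^sup>2 + (norm (A $ 2 $ j))\<^sup>2 = 1" by (simp only: of_real_eq_1_iff)
  have "(norm (A $ 1 $ j))\<^sup>2 \<le> 1" "(norm (A $ 2 $ j))\<^sup>2 \<le> 1"
    using s zero_le_power2[of "norm (A $ 1 $ j)"] zero_le_power2[of "norm (A $ 2 $ j)"] by linarith+
  then have "(norm (A $ i $ j))\<^sup>2 \<le> 1" using exhaust_2[of i] by metis
  then show ?thesis by (simp add: abs_square_le_1)
qed

text \<open>This bound, uniform in \<open>k\<close> and in the loop, is the a priori bound that \<open>three_term_decay\<close> needs.\<close>

lemma loop_coeff_unitary_bounded:
  assumes "loop_SL2_tau3 g"
  shows "norm (loop_coeff g k) \<le> 4"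
proof -
  have "norm (loop_coeff g k) \<le> (\<Sum>i\<in>UNIV. \<Sum>j\<in>UNIV. norm (loop_coeff g k $ i $ j))" by (rule norm_mat2_le)
  also have "\<dots> \<le> (\<Sum>i\<in>(UNIV :: 2 set). \<Sum>j\<in>(UNIV :: 2 set). 1)"
    unfolding loop_coeff_def
    by (intro sum_mono) (simp add: norm_fourier_coeff_bounded unitary_entry_le loop_SL2_tau3_unitary(1)[OF assms])
  finally show ?thesis by simp
qed

abbreviation (input) gauge :: "real \<Rightarrow> mat2" where
  "gauge t \<equiv> diag2 (cis t) (cis (- t))"

lemma loop_SL2_tau3_gauge:
  assumes g: "loop_SL2_tau3 g" and eq: "\<And>l. norm l = 1 \<Longrightarrow> h l = g l ** gauge t"
  shows "loop_SL2_tau3 h"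
proof -
  have SL: "loop_SL2 g" using g by (simp add: loop_SL2_tau3_def)
  have "loop_series h (\<lambda>k. loop_coeff g k ** gauge t)"
    by (rule loop_series_cong[OF loop_series_mult_const[OF wiener_loop_series]])
      (use SL eq in \<open>auto simp: loop_SL2_def\<close>)
  then have w: "wiener_loop h" by (rule loop_series_wiener)
  have dg: "det (gauge t) = 1" by (simp add: det_2 cis_mult)
  have d: "det (h l) = 1" if "norm l = 1" for l
    using SL that unfolding eq[OF that] det_mul dg by (simp add: loop_SL2_def)
  have tw: "h (- l) = sigma (h l)" if l: "norm l = 1" for l
  proof -
    have "g (- l) = sigma (g l)" using SL l by (simp add: loop_SL2_def twisted_def)
    then show ?thesis using eq[of l] eq[of "- l"] l by (simp add: sigma_eq mat2_eq_iff)
  qed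
  have ug: "hconj (gauge t) ** gauge t = mat 1" by (simp add: mat2_eq_iff cis_cnj cis_mult)
  have "tau3 h l = h l" if l: "norm l = 1" for l
  proof -
    have "hconj (h l) ** h l = hconj (gauge t) ** (hconj (g l) ** g l) ** gauge t"
      unfolding eq[OF l] hconj_mult by (simp add: matrix_mul_assoc)
    then have "hconj (h l) ** h l = mat 1"
      unfolding loop_SL2_tau3_unitary(1)[OF g l] by (simp add: ug)
    then show ?thesis using tau3_circle_iff[where g = h and l = l, OF d[OF l] l] by simp
  qed
  then show ?thesis using w d tw by (auto simp: loop_SL2_tau3_def loop_SL2_def twisted_def)
qed

lemma has_derivative_cis:
  assumes "(t has_derivative t') (at z)"
  shows "((\<lambda>z. cis (t z)) has_derivative (\<lambda>h. t' h *\<^sub>R (\<i> * cis (t z)))) (at z)"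
proof -
  have "((\<lambda>z. exp (\<i> * of_real (t z))) has_derivative (\<lambda>h. exp (\<i> * of_real (t z)) * (\<i> * of_real (t' h)))) (at z)"
    by (intro has_derivative_compose[OF has_derivative_mult_right[OF bounded_linear.has_derivative[OF bounded_linear_of_real assms]]
          DERIV_exp[unfolded has_field_derivative_def]])
  then show ?thesis by (simp add: cis_conv_exp scaleR_conv_of_real mult_ac)
qed

lemma has_derivative_diag2:
  assumes "(a has_derivative a') (at z)" "(d has_derivative d') (at z)" "\<And>h. diag2 (a' h) (d' h) = M h"
  shows "((\<lambda>z. diag2 (a z) (d z)) has_derivative M) (at z)"
proof -
  have lin: "bounded_linear (\<lambda>x. cscale x N)" for N
    by (rule bounded_bilinear.bounded_linear_left[OF bounded_bilinear_cscale])
  have eq: "diag2 x y = cscale x (diag2 1 0) + cscale y (diag2 0 1)" for x y by (simp add: mat2_eq_iff)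
  have "M = (\<lambda>h. cscale (a' h) (diag2 1 0) + cscale (d' h) (diag2 0 1))"
    by (rule ext) (simp only: assms(3)[symmetric] eq[of "a' _"])
  then show ?thesis unfolding eq[of "a _"]
    by (simp only:) (intro has_derivative_add bounded_linear.has_derivative[OF lin] assms)
qed

lemma coth_gt_1: "q > 0 \<Longrightarrow> Defs.coth q > 1"
proof -
  assume "q > 0"
  then have "sinh q > 0" by simp
  moreover have "cosh q - sinh q = exp (- q)" by (rule cosh_minus_sinh)
  then have "cosh q > sinh q" using exp_gt_zero[of "- q"] by linarith
  ultimately show ?thesis by (simp add: Defs.coth_def)
qed

text \<open>Here \<open>2 s\<close> is the derivative of \<open>G\<close> with respect to \<open>cnj z\<close>. Subtracting the differential of \<open>\<i> Im G / 2\<close>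
  from that of \<open>G / 2\<close> leaves the differential of \<open>Re G / 2\<close>, that is of \<open>u / 4\<close>.\<close>

lemma gauge_diagonal:
  fixes G :: "complex \<Rightarrow> complex"
  assumes dG: "(G has_derivative (\<lambda>h. Re h *\<^sub>R Gx + Im h *\<^sub>R Gy)) (at z)"
    and s: "4 * s = Gx + \<i> * Gy"
    and u: "u = (\<lambda>z. 2 * Re (G z) + K)" and \<theta>: "\<theta> = (\<lambda>z. (Im (G z) - pi) / 2)"
  shows "(\<theta> has_derivative (\<lambda>h. (Re h * Im Gx + Im h * Im Gy) / 2)) (at z)"
    and "h * cnj s - cnj h * s + \<i> * of_real ((Re h * Im Gx + Im h * Im Gy) / 2) =
      h * (wirt_z u z / 4) - cnj h * (wirt_zbar u z / 4)"
proof -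
  have Re: "((\<lambda>z. Re (G z)) has_derivative (\<lambda>h. Re (Re h *\<^sub>R Gx + Im h *\<^sub>R Gy))) (at z)"
    and Im: "((\<lambda>z. Im (G z)) has_derivative (\<lambda>h. Im (Re h *\<^sub>R Gx + Im h *\<^sub>R Gy))) (at z)"
    by (rule bounded_linear.has_derivative[OF bounded_linear_Re dG] bounded_linear.has_derivative[OF bounded_linear_Im dG])+
  show "(\<theta> has_derivative (\<lambda>h. (Re h * Im Gx + Im h * Im Gy) / 2)) (at z)"
    using bounded_linear.has_derivative[OF bounded_linear_divide[of 2] has_derivative_diff[OF Im has_derivative_const[of pi]]]
    unfolding \<theta> by simp
  have "(u has_derivative (\<lambda>h. Re h *\<^sub>R (2 * Re Gx) + Im h *\<^sub>R (2 * Re Gy))) (at z)"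
    unfolding u by (rule derivative_eq_intros Re refl)+ (simp add: algebra_simps)
  from dx_dy_eqI[OF this] have du: "dx u z = 2 * Re Gx" "dy u z = 2 * Re Gy" .
  have sv: "s = (Gx + \<i> * Gy) / 4" unfolding s[symmetric] by simp
  show "h * cnj s - cnj h * s + \<i> * of_real ((Re h * Im Gx + Im h * Im Gy) / 2) =
      h * (wirt_z u z / 4) - cnj h * (wirt_zbar u z / 4)"
    by (simp add: complex_eq_iff sv wirt_z_def wirt_zbar_def du field_simps)
qed

theorem theorem9p4:
  fixes D :: "complex set" and z\<^sub>0 :: complex
    and \<eta> :: "int \<Rightarrow> complex \<Rightarrow> complex^2^2"
    and C \<Phi> V :: "complex \<Rightarrow> complex \<Rightarrow> complex^2^2"
  assumes "open D" and "connected D" and "simply_connected D" and "z\<^sub>0 \<in> D"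
    and "holomorphic_potential D \<eta>"
    and "\<And>z l. z \<in> D \<Longrightarrow> l \<noteq> 0 \<Longrightarrow>
           ((\<lambda>z. C z l) has_derivative (\<lambda>h. C z l ** cscale h (potential_at \<eta> z l))) (at z)"
    and "\<And>l. l \<noteq> 0 \<Longrightarrow> C z\<^sub>0 l = mat 1"
    and "\<And>z. z \<in> D \<Longrightarrow> loop_SL2_tau3 (\<Phi> z)"
    and "\<And>z. z \<in> D \<Longrightarrow> loop_SL2_plus (V z)"
    and "loop_smooth_on D \<Phi>" and "loop_smooth_on D V"
    and "\<And>z l. z \<in> D \<Longrightarrow> norm l = 1 \<Longrightarrow> C z l = \<Phi> z l ** V z l"
  shows "\<exists>\<theta> :: complex \<Rightarrow> real. \<exists>w :: complex \<Rightarrow> complex. \<exists>\<Psi> H.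
           smooth_on D \<theta> \<and> w holomorphic_on D \<and> inj_on w D \<and> H > 1 \<and>
           extended_frame_of_cmc (w ` D) H \<Psi> \<and>
           (\<forall>z\<in>D. \<forall>l. norm l = 1 \<longrightarrow>
              \<Psi> (w z) l = \<Phi> z l ** diag2 (cis (\<theta> z)) (cis (- \<theta> z)))"
proof -
  note D = assms(1) and \<eta> = assms(5) and \<Phi> = assms(8)
  \<comment> \<open>An arbitrary positive number.\<close>
  define q :: real where "q = 1"
  have q: "q > 0" by (simp add: q_def)
  have scr: "scrH q > 0" using q scrH_eq[of q] by simp
  define a where "a = (\<lambda>z. \<eta> (-1) z $ 1 $ 2)"
  define b where "b = (\<lambda>z. \<eta> (-1) z $ 2 $ 1)"
  have ab: "a holomorphic_on D" "b holomorphic_on D" and a0: "\<And>z. z \<in> D \<Longrightarrow> a z \<noteq> 0"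
    using \<eta> by (auto simp: holomorphic_potential_def a_def b_def)
  define v where "v = (\<lambda>z. loop_coeff (V z) 0 $ 1 $ 1)"
  define s where "s = (\<lambda>z. (dx v z + \<i> * dy v z) / (2 * v z))"
  define P1 where "P1 = (\<lambda>z. mat2 0 ((v z)\<^sup>2 * a z) (b z / (v z)\<^sup>2) 0)"
  note coeffs = iwasawa_factor_coefficients[OF D \<eta> assms(6) \<Phi> assms(9-12)]
  have vC: "Ck_on n D v" for n
    unfolding v_def by (rule coeffs(1)) auto
  have v0: "v z \<noteq> 0" if "z \<in> D" for z
    unfolding v_def by (rule coeffs(2)) (use that in auto)
  have d\<Phi>: "((\<lambda>z. loop_coeff (\<Phi> z) k) has_derivative
      (\<lambda>h. cscale h (loop_coeff (\<Phi> z) (k + 1) ** P1 z + loop_coeff (\<Phi> z) k ** diag2 (cnj (s z)) (- cnj (s z))) -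
           cscale (cnj h) (loop_coeff (\<Phi> z) k ** diag2 (s z) (- s z) + loop_coeff (\<Phi> z) (k - 1) ** hconj (P1 z)))) (at z)"
    if "z \<in> D" for z k
    unfolding P1_def s_def v_def a_def b_def by (rule coeffs(3)) (use that in auto)
  define F where "F = (\<lambda>z. v z * v z * a z)"
  have FC: "Ck_on n D F" for n
    unfolding F_def
    by (intro Ck_on_bilinear[OF D bounded_bilinear_mult] vC Ck_on_holomorphic[OF D ab(1)])
  have F_cont: "continuous_on D F" using FC[of 0] by simp
  obtain G where G: "continuous_on D G" "\<And>z. z \<in> D \<Longrightarrow> exp (G z) = F z"
  proof (rule continuous_logarithm_on_simply_connected[OF F_cont assms(3)])
    show "locally path_connected D" using D by (rule open_imp_locally_path_connected)
    show "F z \<noteq> 0" if "z \<in> D" for z using v0[OF that] a0[OF that] by (simp add: F_def)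
  qed auto
  have GC: "Ck_on n D G" for n by (rule Ck_on_continuous_log[OF D G FC])
  have dG: "(G has_derivative (\<lambda>h. Re h *\<^sub>R dx G z + Im h *\<^sub>R dy G z)) (at z)" if "z \<in> D" for z
    using GC[of "Suc 0"] that by (intro has_derivative_dx_dy) auto
  \<comment> \<open>The holomorphic factor \<open>a\<close> of \<open>exp G = v\<^sup>2 a\<close> does not contribute to the derivative by \<open>cnj z\<close>.\<close>
  have s4: "4 * s z = dx G z + \<i> * dy G z" if z: "z \<in> D" for z
  proof -
    have dv: "(v has_derivative (\<lambda>h. Re h *\<^sub>R dx v z + Im h *\<^sub>R dy v z)) (at z)"
      using vC[of "Suc 0"] z by (intro has_derivative_dx_dy) auto
    have da: "(a has_derivative (*) (deriv a z)) (at z)"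
      using holomorphic_derivI[OF ab(1) D z] by (simp add: has_field_derivative_def)
    have dF: "(F has_derivative (\<lambda>h. v z * v z * (deriv a z * h) + (v z * (Re h *\<^sub>R dx v z + Im h *\<^sub>R dy v z) +
        (Re h *\<^sub>R dx v z + Im h *\<^sub>R dy v z) * v z) * a z)) (at z)"
      unfolding F_def by (intro has_derivative_mult dv da)
    note log = has_derivative_continuous_log[OF D z G dF]
    have dG': "dx G z = exp (- G z) * (v z * v z * deriv a z + 2 * v z * dx v z * a z)"
      "dy G z = exp (- G z) * (v z * v z * (deriv a z * \<i>) + 2 * v z * dy v z * a z)"
      using has_derivative_dx_dy_eq[OF log] by (simp_all add: algebra_simps)
    have "exp (- G z) * exp (G z) = 1" by (simp flip: exp_add)
    then have e: "exp (- G z) * (v z * v z * a z) = 1" unfolding G(2)[OF z] F_def .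
    have "dx G z + \<i> * dy G z = 2 * (exp (- G z) * (v z * v z * a z)) * ((dx v z + \<i> * dy v z) / v z)"
      unfolding dG' using v0[OF z] by (simp add: field_simps)
    also have "\<dots> = 4 * s z" unfolding e using v0[OF z] by (simp add: s_def field_simps)
    finally show ?thesis ..
  qed
  \<comment> \<open>The constant in \<open>u\<close> achieves \<open>scrH q * exp (u / 2) / 2 = exp (Re G)\<close>; the shift by \<open>\<pi>\<close> in \<open>\<theta>\<close> produces the
    minus sign in the upper right entry of the frame equation.\<close>
  define u where "u = (\<lambda>z. 2 * Re (G z) + 2 * ln (2 / scrH q))"
  define \<theta> where "\<theta> = (\<lambda>z. (Im (G z) - pi) / 2)"
  define Q where "Q = (\<lambda>z. - 2 * a z * b z / of_real (scrH q))"
  have u_smooth: "smooth_on D u"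
  proof -
    have "bounded_linear (\<lambda>x. 2 * Re x)"
      using bounded_linear_compose[OF bounded_linear_mult_right bounded_linear_Re] .
    then show ?thesis unfolding smooth_on_def u_def
      by (intro allI Ck_on_add[OF D] Ck_on_const Ck_on_bounded_linear[OF D _ GC])
  qed
  have \<theta>_smooth: "smooth_on D \<theta>"
  proof -
    have "bounded_linear (\<lambda>x. 1 / 2 * Im x)"
      using bounded_linear_compose[OF bounded_linear_mult_right bounded_linear_Im] .
    then have "Ck_on n D (\<lambda>z. 1 / 2 * Im (G z) + (- pi / 2))" for n
      by (intro Ck_on_add[OF D] Ck_on_const Ck_on_bounded_linear[OF D _ GC])
    moreover have "\<theta> = (\<lambda>z. 1 / 2 * Im (G z) + (- pi / 2))" by (simp add: \<theta>_def fun_eq_iff field_simps)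
    ultimately show ?thesis by (simp add: smooth_on_def)
  qed
  have Q_hol: "Q holomorphic_on D" unfolding Q_def using scr by (intro holomorphic_intros ab) simp
  have expu: "exp (u z / 2) = 2 / scrH q * exp (Re (G z))" for z
    using scr by (simp add: u_def exp_add add_divide_distrib mult.commute)
  have expu': "exp (- u z / 2) = scrH q / 2 * exp (- Re (G z))" for z
  proof -
    have "exp (- u z / 2) = inverse (exp (u z / 2))" by (simp add: exp_minus)
    then show ?thesis unfolding expu using scr by (simp add: exp_minus field_simps)
  qed
  define A where "A = (\<lambda>z. mat2 0 (of_real (- (1/2) * scrH q * exp (u z / 2))) (Q z * of_real (exp (- u z / 2))) 0)"
  define B where "B = (\<lambda>z. diag2 (wirt_z u z / 4) (- wirt_z u z / 4))"
  define C' where "C' = (\<lambda>z. diag2 (- wirt_zbar u z / 4) (wirt_zbar u z / 4))"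
  define E where "E = (\<lambda>z. mat2 0 (- cnj (Q z) * of_real (exp (- u z / 2))) (of_real (1/2 * scrH q * exp (u z / 2))) 0)"
  have UV: "Umat q u Q z l = cscale (inverse l) (A z) + B z" "Vmat q u Q z l = C' z + cscale l (E z)" for z l
    by (simp_all add: Umat_def Vmat_def A_def B_def C'_def E_def mat2_eq_iff)
  have gA: "P1 z ** gauge (\<theta> z) = gauge (\<theta> z) ** A z" if z: "z \<in> D" for z
  proof -
    have e: "exp (G z) = of_real (exp (Re (G z))) * cis (Im (G z))"
      by (simp add: exp_eq_polar)
    have F: "(v z)\<^sup>2 * a z = of_real (exp (Re (G z))) * cis (Im (G z))"
      using G(2)[OF z] e by (simp add: F_def power2_eq_square)
    have c: "cis (Im (G z)) = - (cis (\<theta> z) * cis (\<theta> z))"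
    proof -
      have "\<theta> z + \<theta> z = Im (G z) - pi" by (simp add: \<theta>_def)
      then have "cis (\<theta> z) * cis (\<theta> z) = cis (Im (G z) - pi)" by (simp only: cis_mult)
      then show ?thesis by (simp add: complex_eq_iff cos_diff sin_diff)
    qed
    have 12: "(v z)\<^sup>2 * a z * cis (- \<theta> z) = cis (\<theta> z) * of_real (- exp (Re (G z)))"
    proof -
      have "cis (\<theta> z) * cis (- \<theta> z) = 1" by (simp add: cis_mult)
      then show ?thesis unfolding F c by (simp add: mult.assoc)
    qed
    have 21: "b z / (v z)\<^sup>2 * cis (\<theta> z) = cis (- \<theta> z) * (- (a z * b z) * of_real (exp (- Re (G z))))"
    proof -
      have "cis (- \<theta> z) * (- (a z * b z) * of_real (exp (- Re (G z)))) * ((v z)\<^sup>2 * a z) =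
          cis (- \<theta> z) * cis (\<theta> z) * cis (\<theta> z) * (a z * b z) * of_real (exp (- Re (G z)) * exp (Re (G z)))"
        unfolding F c by (simp only: of_real_mult) (simp only: mult_ac minus_mult_left[symmetric] minus_mult_right[symmetric] minus_minus)
      also have "\<dots> = cis (\<theta> z) * (a z * b z)" by (simp add: cis_mult flip: exp_add)
      finally have "cis (- \<theta> z) * (- (a z * b z) * of_real (exp (- Re (G z)))) * (v z)\<^sup>2 * a z = cis (\<theta> z) * b z * a z"
        by (simp only: mult_ac)
      then have "cis (- \<theta> z) * (- (a z * b z) * of_real (exp (- Re (G z)))) * (v z)\<^sup>2 = cis (\<theta> z) * b z"
        by (rule mult_right_cancel[OF a0[OF z], THEN iffD1])
      then have "cis (- \<theta> z) * (- (a z * b z) * of_real (exp (- Re (G z)))) = cis (\<theta> z) * b z / (v z)\<^sup>2"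
        using v0[OF z] by (subst nonzero_eq_divide_eq) auto
      then show ?thesis by (simp add: mult.commute)
    qed
    have A_eq: "A z = mat2 0 (of_real (- exp (Re (G z)))) (- (a z * b z) * of_real (exp (- Re (G z)))) 0"
      unfolding A_def expu expu' Q_def using scr by (simp add: mat2_eq_iff)
    show ?thesis unfolding A_eq P1_def using 12 21 by (simp add: mat2_eq_iff mult.commute)
  qed
  have gE: "hconj (P1 z) ** gauge (\<theta> z) = cscale (-1) (gauge (\<theta> z) ** E z)" if z: "z \<in> D" for z
  proof -
    have P: "P1 z = gauge (\<theta> z) ** A z ** gauge (- \<theta> z)"
    proof -
      have "gauge (\<theta> z) ** gauge (- \<theta> z) = mat 1" by (simp add: mat2_eq_iff cis_mult)
      then have "P1 z ** gauge (\<theta> z) ** gauge (- \<theta> z) = P1 z" by (simp flip: matrix_mul_assoc)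
      then show ?thesis unfolding gA[OF z] by simp
    qed
    have "hconj (P1 z) ** gauge (\<theta> z) = gauge (\<theta> z) ** hconj (A z) ** (gauge (- \<theta> z) ** gauge (\<theta> z))"
      unfolding P by (simp add: mat2_eq_iff cis_cnj algebra_simps)
    also have "gauge (- \<theta> z) ** gauge (\<theta> z) = mat 1" by (simp add: mat2_eq_iff cis_mult)
    also have "hconj (A z) = cscale (-1) (E z)" by (simp add: A_def E_def mat2_eq_iff)
    finally show ?thesis by (simp add: mat2_eq_iff)
  qed
  define X where "X = (\<lambda>k z. loop_coeff (\<Phi> z) k ** gauge (\<theta> z))"
  \<comment> \<open>The coefficient equations of the gauged loop are those of the form \<open>U dz + V d(cnj z)\<close>.\<close>
  have dX: "(X k has_derivative
        (\<lambda>h. cscale h (X (k + 1) z ** A z + X k z ** B z) +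
             cscale (cnj h) (X k z ** C' z + X (k - 1) z ** E z))) (at z)" if z: "z \<in> D" for k z
  proof -
    define t where "t = (\<lambda>h. (Re h * Im (dx G z) + Im h * Im (dy G z)) / 2)"
    have d\<theta>: "(\<theta> has_derivative t) (at z)"
      unfolding t_def by (rule gauge_diagonal(1)[OF dG[OF z] s4[OF z] u_def \<theta>_def])
    have cis_der: "((\<lambda>z. cis (\<theta> z)) has_derivative (\<lambda>h. t h *\<^sub>R (\<i> * cis (\<theta> z)))) (at z)"
      by (rule has_derivative_cis[OF d\<theta>])
    have cis_der': "((\<lambda>z. cis (- \<theta> z)) has_derivative (\<lambda>h. (- t h) *\<^sub>R (\<i> * cis (- \<theta> z)))) (at z)"
      by (rule has_derivative_cis[OF has_derivative_minus[OF d\<theta>]])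
    have dgauge: "((\<lambda>z. gauge (\<theta> z)) has_derivative (\<lambda>h. gauge (\<theta> z) ** diag2 (\<i> * of_real (t h)) (- (\<i> * of_real (t h))))) (at z)"
      by (rule has_derivative_diag2[OF cis_der cis_der']) (simp add: mat2_eq_iff scaleR_conv_of_real mult_ac)
    have key: "cscale h (diag2 (cnj (s z)) (- cnj (s z)) ** gauge (\<theta> z)) - cscale (cnj h) (diag2 (s z) (- s z) ** gauge (\<theta> z)) +
        gauge (\<theta> z) ** diag2 (\<i> * of_real (t h)) (- (\<i> * of_real (t h))) = gauge (\<theta> z) ** (cscale h (B z) + cscale (cnj h) (C' z))" for h
    proof -
      have k: "h * cnj (s z) - cnj h * s z + \<i> * of_real (t h) = h * (wirt_z u z / 4) - cnj h * (wirt_zbar u z / 4)"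
        unfolding t_def by (rule gauge_diagonal(2)[OF dG[OF z] s4[OF z] u_def \<theta>_def])
      have "cscale h (diag2 (cnj (s z)) (- cnj (s z)) ** gauge (\<theta> z)) - cscale (cnj h) (diag2 (s z) (- s z) ** gauge (\<theta> z)) +
        gauge (\<theta> z) ** diag2 (\<i> * of_real (t h)) (- (\<i> * of_real (t h))) =
        diag2 (cis (\<theta> z) * (h * cnj (s z) - cnj h * s z + \<i> * of_real (t h))) (- cis (- \<theta> z) * (h * cnj (s z) - cnj h * s z + \<i> * of_real (t h)))"
        by (simp add: mat2_eq_iff algebra_simps)
      then show ?thesis unfolding k by (simp add: mat2_eq_iff B_def C'_def algebra_simps)
    qed
    let ?L = "\<lambda>k. loop_coeff (\<Phi> z) k" and ?g = "gauge (\<theta> z)"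
    have "(X k has_derivative (\<lambda>h. ?L k ** (?g ** diag2 (\<i> * of_real (t h)) (- (\<i> * of_real (t h)))) +
        (cscale h (?L (k + 1) ** P1 z + ?L k ** diag2 (cnj (s z)) (- cnj (s z))) -
           cscale (cnj h) (?L k ** diag2 (s z) (- s z) + ?L (k - 1) ** hconj (P1 z))) ** ?g)) (at z)"
      unfolding X_def by (rule bounded_bilinear.FDERIV[OF bounded_bilinear_mat2_mult d\<Phi>[OF z] dgauge])
    moreover have "?L k ** (?g ** diag2 (\<i> * of_real (t h)) (- (\<i> * of_real (t h)))) +
        (cscale h (?L (k + 1) ** P1 z + ?L k ** diag2 (cnj (s z)) (- cnj (s z))) -
           cscale (cnj h) (?L k ** diag2 (s z) (- s z) + ?L (k - 1) ** hconj (P1 z))) ** ?g =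
        cscale h (X (k + 1) z ** A z + X k z ** B z) + cscale (cnj h) (X k z ** C' z + X (k - 1) z ** E z)" for h
    proof -
      have "?L k ** (?g ** diag2 (\<i> * of_real (t h)) (- (\<i> * of_real (t h)))) +
        (cscale h (?L (k + 1) ** P1 z + ?L k ** diag2 (cnj (s z)) (- cnj (s z))) -
           cscale (cnj h) (?L k ** diag2 (s z) (- s z) + ?L (k - 1) ** hconj (P1 z))) ** ?g =
        cscale h (?L (k + 1) ** (P1 z ** ?g)) - cscale (cnj h) (?L (k - 1) ** (hconj (P1 z) ** ?g)) +
        ?L k ** (cscale h (diag2 (cnj (s z)) (- cnj (s z)) ** ?g) - cscale (cnj h) (diag2 (s z) (- s z) ** ?g) +
          ?g ** diag2 (\<i> * of_real (t h)) (- (\<i> * of_real (t h))))"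
        by (simp add: mat2_eq_iff algebra_simps)
      also have "\<dots> = cscale h (X (k + 1) z ** A z + X k z ** B z) + cscale (cnj h) (X k z ** C' z + X (k - 1) z ** E z)"
        unfolding key gA[OF z] gE[OF z] X_def
        by (simp add: mat2_eq_iff algebra_simps)
      finally show ?thesis .
    qed
    ultimately show ?thesis by simp
  qed
  obtain L where L: "L > 0" "\<And>(M :: mat2) (N :: mat2). norm (M ** N) \<le> norm M * norm N * L"
    using bounded_bilinear.pos_bounded[OF bounded_bilinear_mat2_mult] by blast
  have X_bound: "norm (X k z) \<le> 4 * 4 * L" if "z \<in> D" for k z
  proof -
    have g: "norm (gauge (\<theta> z)) \<le> 4" using norm_mat2_le[of "gauge (\<theta> z)"] by (simp add: sum_2)
    have "norm (X k z) \<le> norm (loop_coeff (\<Phi> z) k) * norm (gauge (\<theta> z)) * L" unfolding X_def by (rule L)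
    also have "\<dots> \<le> 4 * 4 * L"
      using L(1) by (intro mult_right_mono mult_mono loop_coeff_unitary_bounded[OF \<Phi>[OF that]] g) auto
    finally show ?thesis .
  qed
  have X_start: "X k z\<^sub>0 = 0" if k: "k \<noteq> 0" for k
  proof -
    have "\<Phi> z\<^sub>0 l ** V z\<^sub>0 l = mat 1" if "norm l = 1" for l
    proof -
      have "l \<noteq> 0" using that by auto
      then show ?thesis using assms(12)[OF assms(4) that] assms(7)[of l] by simp
    qed
    from unitary_inverse_plus_constant[OF \<Phi>[OF assms(4)] assms(9)[OF assms(4)] this k]
    show ?thesis by (simp add: X_def)
  qed
  have un: "Ck_on k D u" for k using u_smooth by (simp add: smooth_on_def)
  have du: "Ck_on 0 D (\<lambda>z. of_real (dx u z) :: complex)" "Ck_on 0 D (\<lambda>z. of_real (dy u z) :: complex)"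
    using un[of "Suc 0"] by (auto intro!: continuous_intros)
  have "continuous_on D u" using un[of 0] by simp
  then have conts: "continuous_on D A" "continuous_on D B" "continuous_on D C'" "continuous_on D E"
    unfolding A_def B_def C'_def E_def wirt_z_def wirt_zbar_def using du
    by (intro Ck_on_mat2[OF D, of 0, simplified] continuous_intros holomorphic_on_imp_continuous_on[OF Q_hol]; simp)+
  define \<Psi> where "\<Psi> = (\<lambda>z l. \<Sum>\<^sub>\<infinity>k. cscale (l powi k) (X k z))"
  have \<Psi>_sum: "((\<lambda>k. cscale (l powi k) (X k z)) has_sum \<Psi> z l) UNIV" if "z \<in> D" "l \<noteq> 0" for z l
    unfolding \<Psi>_def by (rule laurent_frame(1)[OF D assms(2,4) dX conts X_bound X_start that])
  have \<Psi>_hol: "(\<lambda>l. \<Psi> z l $ i $ j) holomorphic_on - {0}" if "z \<in> D" for z i j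
    unfolding \<Psi>_def by (rule laurent_frame(2)[OF D assms(2,4) dX conts X_bound X_start that])
  have \<Psi>_der: "((\<lambda>z. \<Psi> z l) has_derivative
      (\<lambda>h. \<Psi> z l ** (cscale h (Umat q u Q z l) + cscale (cnj h) (Vmat q u Q z l)))) (at z)"
    if "z \<in> D" "l \<noteq> 0" for z l
    unfolding \<Psi>_def UV by (rule laurent_frame(3)[OF D assms(2,4) dX conts X_bound X_start that])
  have circle: "\<Psi> z l = \<Phi> z l ** gauge (\<theta> z)" if z: "z \<in> D" and l: "norm l = 1" for z l
  proof -
    have "loop_series (\<lambda>l. \<Phi> z l ** gauge (\<theta> z)) (\<lambda>k. X k z)"
      unfolding X_def by (intro loop_series_mult_const wiener_loop_series)
        (use \<Phi>[OF z] in \<open>simp add: loop_SL2_tau3_def loop_SL2_def\<close>)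
    then have 1: "((\<lambda>k. X k z $ i $ j * l powi k) has_sum (\<Phi> z l ** gauge (\<theta> z)) $ i $ j) UNIV" for i j
      using l by (simp add: loop_series_def circle_series_def)
    have "l \<noteq> 0" using l by auto
    from has_sum_bounded_linear[OF bounded_linear_mat2_nth \<Psi>_sum[OF z this]]
    have "((\<lambda>k. X k z $ i $ j * l powi k) has_sum \<Psi> z l $ i $ j) UNIV" for i j
      by (simp add: mult.commute)
    then have "\<Psi> z l $ i $ j = (\<Phi> z l ** gauge (\<theta> z)) $ i $ j" for i j
      using 1 has_sum_unique by blast
    then show ?thesis by (simp only: mat2_eq_iff)
  qed
  have ext: "extended_frame D q u Q \<Psi>"
    unfolding extended_frame_def
    using u_smooth Q_hol \<Psi>_hol \<Psi>_der loop_SL2_tau3_gauge[OF \<Phi> circle] by blast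
  have "extended_frame_of_cmc D (Defs.coth q) \<Psi>"
    unfolding extended_frame_of_cmc_def
    using q ext sym_formula_cmc[OF D q ext] by blast
  then show ?thesis
    using \<theta>_smooth coth_gt_1[OF q] circle
    by (intro exI[of _ \<theta>] exI[of _ "\<lambda>z. z"] exI[of _ \<Psi>] exI[of _ "Defs.coth q"]) (simp add: holomorphic_on_ident)
qed

end
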